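(* Let $X\subset\mathbb P V=\mathbb P^5$ be a general cubic hypersurface over $\mathbb C$, with equation $P=0$, $P\in S^3V^*$, and let $F(X)\subset G(2,V)$ be the (smooth, four-dimensional) variety of lines contained in $X$. Let $\Omega$ be the skew-symmetric form on the tangent spaces $T_\ell F(X)$ determined by $$K(u\wedge v,u\wedge v)=\omega(u,v)\,\Omega(u,v),\qquad u,v\in T_\ell F(X),$$ where $\omega$ and $K$ are the forms defined in the context. Then $\Omega$ defines a symplectic structure on $F(X)$, i.e. it is an everywhere non-degenerate closed holomorphic $2$-form.
   Context: Write $P(x,y,z)$ for the polarization of $P$ (the symmetric trilinear form with $P(x,x,x)=P(x)$). Let $T$ be the rank two tautological bundle on $G(2,V)$ and $Q=V/T$ the quotient bundle, so $TG(2,V)=Hom(T,Q)$. For a line $\ell=\mathbb P T\subset X$, $$T_\ell F(X)=\{u\in Hom(T,Q): P(x,x,\bar u(x))=0\ \ \forall x\in T\},$$ where $\bar u(x)\in V$ is any representative of $u(x)\in Q=V/T$. For $x,y \in T$ and $u\in T_\ell F(X)$ the expressions $P(x,y,u(\cdot))$ are computed on representatives. The form $\omega$: for a basis $e,f$ of $T$ and $u,v\in T_\ell F(X)$, $$\begin{aligned}\omega(u,v)=\ &P(e,e,u(f))P(f,f,v(e))-P(e,e,v(f))P(f,f,u(e))\\&+2P(e,f,u(f))P(e,e,v(f))-2P(e,e,u(f))P(e,f,v(f))\\&+2P(f,f,u(e))P(e,f,v(e))-2P(e,f,u(e))P(f,f,v(e)).\end{aligned}$$ It is a skew-symmetric form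 on $TF(X)$ with values in $(\wedge^2T^* )^{\otimes3}=\mathcal O(3)$. If $\ell$ is a general line of $X$, the tangent hyperplanes to $X$ at the points of $\ell$ intersect along a plane $\mathbb P S\supset\ell$, and there $\omega$ has rank two with radical $Hom(T,S/T)$. The form $K$: it is the quadratic form on $\wedge^2T_\ell G(2,V)=(\wedge^2T^*\otimes S^2Q)\oplus(S^2T^*\otimes\wedge^2Q)$, defined up to a nonzero scalar, given by the composition of natural morphisms $$S^2(\wedge^2T_\ell G(2,V))\to S^2(S^2T^*\otimes\wedge^2Q)\to S^2(S^2T^* )\otimes S^2(\wedge^2Q)\to(\wedge^2T^* )^{\otimes2}\otimes\wedge^4Q,$$ with values in $\mathcal O(3)\otimes\det V$. Up to a nonzero constant, $K(u\wedge v,u\wedge v)=u(e)\wedge u(f)\wedge v(e)\wedge v(f)\in\wedge^4Q$. The form $\Omega$ takes values in the trivial line bundle $\det V$ and is defined up to a nonzero scalar. The identity $K(u\wedge v,u\wedge v)=\omega(u,v)\Omega(u,v)$ determines $\Omega$ at a general line $\ell\in F(X)$, and $\Omega$ is understood as the resulting form on $F(X)$. *)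

theory Defs
  imports "HOL-Analysis.Analysis"
begin

type_synonym V = "complex^6"

(* A cubic P in S^3 V^* is given by its polarization; the cubic itself is x \<mapsto> P x x x. *)
definition cubic :: "(V \<Rightarrow> V \<Rightarrow> V \<Rightarrow> complex) \<Rightarrow> bool" where
  "cubic P \<longleftrightarrow>
     (\<forall>x y z. P x y z = P y x z \<and> P x y z = P x z y) \<and>
     (\<forall>y z. Vector_Spaces.linear (*s) (*) (\<lambda>x. P x y z))"

(* The evaluations P \<mapsto> P x y z span the dual of S^3 V^*, so on cubics these are exactly
   the polynomial functions in the coefficients of P. *)
inductive polynomial_on_cubics :: "((V \<Rightarrow> V \<Rightarrow> V \<Rightarrow> complex) \<Rightarrow> complex) \<Rightarrow> bool" where
  const: "polynomial_on_cubics (\<lambda>P. a)"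
| eval: "polynomial_on_cubics (\<lambda>P. P x y z)"
| add: "polynomial_on_cubics f \<Longrightarrow> polynomial_on_cubics g \<Longrightarrow> polynomial_on_cubics (\<lambda>P. f P + g P)"
| mult: "polynomial_on_cubics f \<Longrightarrow> polynomial_on_cubics g \<Longrightarrow> polynomial_on_cubics (\<lambda>P. f P * g P)"

(* R holds on a nonempty Zariski open set of cubics; every such set contains one of the
   form {\<Phi> \<noteq> 0} with \<Phi> a polynomial that is not identically zero. *)
definition for_general_cubic :: "((V \<Rightarrow> V \<Rightarrow> V \<Rightarrow> complex) \<Rightarrow> bool) \<Rightarrow> bool" where
  "for_general_cubic R \<longleftrightarrow>
     (\<exists>\<Phi>. polynomial_on_cubics \<Phi> \<and> (\<exists>P. cubic P \<and> \<Phi> P \<noteq> 0) \<and>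
          (\<forall>P. cubic P \<and> \<Phi> P \<noteq> 0 \<longrightarrow> R P))"

definition grassmannian2 :: "V set set" where
  "grassmannian2 = {T. vec.subspace T \<and> vec.dim T = 2}"

definition fano :: "(V \<Rightarrow> V \<Rightarrow> V \<Rightarrow> complex) \<Rightarrow> V set set" where
  "fano P = {T \<in> grassmannian2. \<forall>x\<in>T. P x x x = 0}"

definition is_basis :: "V set \<Rightarrow> V \<Rightarrow> V \<Rightarrow> bool" where
  "is_basis T e f \<longleftrightarrow> e \<noteq> f \<and> vec.independent {e, f} \<and> vec.span {e, f} = T"

(* An element of Hom(T,Q), Q = V/T, is represented by a linear map V \<rightarrow> V; two such maps
   represent the same element iff their difference maps T into T. *)
definition hom_eq :: "V set \<Rightarrow> (V \<Rightarrow> V) \<Rightarrow> (V \<Rightarrow> V) \<Rightarrow> bool" where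
  "hom_eq T u v \<longleftrightarrow> (\<forall>x\<in>T. u x - v x \<in> T)"

definition tangent_fano :: "(V \<Rightarrow> V \<Rightarrow> V \<Rightarrow> complex) \<Rightarrow> V set \<Rightarrow> (V \<Rightarrow> V) set" where
  "tangent_fano P T = {u. Vector_Spaces.linear (*s) (*s) u \<and> (\<forall>x\<in>T. P x x (u x) = 0)}"

(* The values of omega and K below lie in O(3) and O(3) \<otimes> det V; the basis e, f of T
   trivializes O(3), and the standard basis of V trivializes det V. *)
definition omega ::
  "(V \<Rightarrow> V \<Rightarrow> V \<Rightarrow> complex) \<Rightarrow> V \<Rightarrow> V \<Rightarrow> (V \<Rightarrow> V) \<Rightarrow> (V \<Rightarrow> V) \<Rightarrow> complex" where
  "omega P e f u v =
     P e e (u f) * P f f (v e) - P e e (v f) * P f f (u e)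
     + 2 * P e f (u f) * P e e (v f) - 2 * P e e (u f) * P e f (v f)
     + 2 * P f f (u e) * P e f (v e) - 2 * P e f (u e) * P f f (v e)"

(* K(u \<and> v, u \<and> v) = u(e) \<and> u(f) \<and> v(e) \<and> v(f) in \<wedge>^4 Q, where \<wedge>^4 Q is identified with
   \<wedge>^6 V by taking the exterior product with e \<and> f. *)
definition K_form :: "V \<Rightarrow> V \<Rightarrow> (V \<Rightarrow> V) \<Rightarrow> (V \<Rightarrow> V) \<Rightarrow> complex" where
  "K_form e f u v = det (vector [e, f, u e, u f, v e, v f] :: complex^6^6)"

definition holomorphic_C4 :: "(complex^4) set \<Rightarrow> (complex^4 \<Rightarrow> complex) \<Rightarrow> bool" where
  "holomorphic_C4 U g \<longleftrightarrow>
     (\<forall>t\<in>U. \<exists>D. (g has_derivative D) (at t) \<and> Vector_Spaces.linear (*s) (*) D)"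

definition line_at :: "(complex^4 \<Rightarrow> V) \<Rightarrow> (complex^4 \<Rightarrow> V) \<Rightarrow> complex^4 \<Rightarrow> V set" where
  "line_at e f t = vec.span {e t, f t}"

(* A representative of the derivative of t \<mapsto> line_at e f t in direction \<xi>, as an element
   of Hom(T,Q): it sends e t, f t to the derivatives of e, f modulo T. *)
definition line_deriv ::
  "(complex^4 \<Rightarrow> V) \<Rightarrow> (complex^4 \<Rightarrow> V) \<Rightarrow> complex^4 \<Rightarrow> complex^4 \<Rightarrow> V \<Rightarrow> V" where
  "line_deriv e f t \<xi> =
     (SOME u. Vector_Spaces.linear (*s) (*s) u \<and>
        u (e t) = frechet_derivative e (at t) \<xi> \<and> u (f t) = frechet_derivative f (at t) \<xi>)"

(* Local holomorphic parametrization of F(X) by an open subset of C^4: an injective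
   immersion into G(2,V), lifted to a moving basis, whose image is open in F(X).
   The topology of G(2,V) is the quotient topology from pairs of independent vectors. *)
definition fano_chart ::
  "(V \<Rightarrow> V \<Rightarrow> V \<Rightarrow> complex) \<Rightarrow> (complex^4) set \<Rightarrow> (complex^4 \<Rightarrow> V) \<Rightarrow> (complex^4 \<Rightarrow> V) \<Rightarrow> bool" where
  "fano_chart P U e f \<longleftrightarrow>
     open U \<and>
     (\<forall>i. holomorphic_C4 U (\<lambda>t. e t $ i) \<and> holomorphic_C4 U (\<lambda>t. f t $ i)) \<and>
     (\<forall>t\<in>U. is_basis (line_at e f t) (e t) (f t) \<and> line_at e f t \<in> fano P) \<and>
     inj_on (line_at e f) U \<and>
     (\<forall>t\<in>U. \<forall>\<xi>. hom_eq (line_at e f t) (line_deriv e f t \<xi>) (\<lambda>x. 0) \<longrightarrow> \<xi> = 0) \<and>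
     openin (top_of_set {(a, b). \<exists>T\<in>fano P. is_basis T a b})
            {(a, b). \<exists>T\<in>line_at e f ` U. is_basis T a b}"

(* F(X) is a complex fourfold whose tangent spaces are the spaces tangent_fano P T. *)
definition smooth_fourfold :: "(V \<Rightarrow> V \<Rightarrow> V \<Rightarrow> complex) \<Rightarrow> bool" where
  "smooth_fourfold P \<longleftrightarrow>
     (\<forall>T\<in>fano P. \<exists>U e f. fano_chart P U e f \<and> T \<in> line_at e f ` U) \<and>
     (\<forall>U e f. fano_chart P U e f \<longrightarrow> (\<forall>t\<in>U.
        (\<forall>\<xi>. line_deriv e f t \<xi> \<in> tangent_fano P (line_at e f t)) \<and>
        (\<forall>u\<in>tangent_fano P (line_at e f t). \<exists>\<xi>. hom_eq (line_at e f t) u (line_deriv e f t \<xi>))))"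

definition two_form_on_fano ::
  "(V \<Rightarrow> V \<Rightarrow> V \<Rightarrow> complex) \<Rightarrow> (V set \<Rightarrow> (V \<Rightarrow> V) \<Rightarrow> (V \<Rightarrow> V) \<Rightarrow> complex) \<Rightarrow> bool" where
  "two_form_on_fano P \<Omega> \<longleftrightarrow>
     (\<forall>T\<in>fano P. \<forall>u\<in>tangent_fano P T. \<forall>v\<in>tangent_fano P T.
        \<Omega> T u v = - \<Omega> T v u \<and>
        (\<forall>a. \<Omega> T (\<lambda>x. a *s u x) v = a * \<Omega> T u v) \<and>
        (\<forall>w\<in>tangent_fano P T.
           \<Omega> T (\<lambda>x. u x + w x) v = \<Omega> T u v + \<Omega> T w v \<and>
           (hom_eq T u w \<longrightarrow> \<Omega> T u v = \<Omega> T w v)))"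

definition pullback ::
  "(V set \<Rightarrow> (V \<Rightarrow> V) \<Rightarrow> (V \<Rightarrow> V) \<Rightarrow> complex) \<Rightarrow> (complex^4 \<Rightarrow> V) \<Rightarrow> (complex^4 \<Rightarrow> V) \<Rightarrow>
   complex^4 \<Rightarrow> complex^4 \<Rightarrow> complex^4 \<Rightarrow> complex" where
  "pullback \<Omega> e f \<xi> \<eta> t = \<Omega> (line_at e f t) (line_deriv e f t \<xi>) (line_deriv e f t \<eta>)"

definition continuous_form ::
  "(V \<Rightarrow> V \<Rightarrow> V \<Rightarrow> complex) \<Rightarrow> (V set \<Rightarrow> (V \<Rightarrow> V) \<Rightarrow> (V \<Rightarrow> V) \<Rightarrow> complex) \<Rightarrow> bool" where
  "continuous_form P \<Omega> \<longleftrightarrow>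
     (\<forall>U e f. fano_chart P U e f \<longrightarrow> (\<forall>\<xi> \<eta>. continuous_on U (pullback \<Omega> e f \<xi> \<eta>)))"

definition holomorphic_form ::
  "(V \<Rightarrow> V \<Rightarrow> V \<Rightarrow> complex) \<Rightarrow> (V set \<Rightarrow> (V \<Rightarrow> V) \<Rightarrow> (V \<Rightarrow> V) \<Rightarrow> complex) \<Rightarrow> bool" where
  "holomorphic_form P \<Omega> \<longleftrightarrow>
     (\<forall>U e f. fano_chart P U e f \<longrightarrow> (\<forall>\<xi> \<eta>. holomorphic_C4 U (pullback \<Omega> e f \<xi> \<eta>)))"

(* d\<Omega> = 0 in charts, evaluated on constant vector fields. *)
definition closed_form ::
  "(V \<Rightarrow> V \<Rightarrow> V \<Rightarrow> complex) \<Rightarrow> (V set \<Rightarrow> (V \<Rightarrow> V) \<Rightarrow> (V \<Rightarrow> V) \<Rightarrow> complex) \<Rightarrow> bool" where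
  "closed_form P \<Omega> \<longleftrightarrow>
     (\<forall>U e f. fano_chart P U e f \<longrightarrow> (\<forall>t\<in>U. \<forall>\<xi> \<eta> \<zeta>.
        frechet_derivative (pullback \<Omega> e f \<eta> \<zeta>) (at t) \<xi>
        + frechet_derivative (pullback \<Omega> e f \<zeta> \<xi>) (at t) \<eta>
        + frechet_derivative (pullback \<Omega> e f \<xi> \<eta>) (at t) \<zeta> = 0))"

definition nondegenerate_form ::
  "(V \<Rightarrow> V \<Rightarrow> V \<Rightarrow> complex) \<Rightarrow> (V set \<Rightarrow> (V \<Rightarrow> V) \<Rightarrow> (V \<Rightarrow> V) \<Rightarrow> complex) \<Rightarrow> bool" where
  "nondegenerate_form P \<Omega> \<longleftrightarrow>
     (\<forall>T\<in>fano P. \<forall>u\<in>tangent_fano P T.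
        (\<forall>v\<in>tangent_fano P T. \<Omega> T u v = 0) \<longrightarrow> hom_eq T u (\<lambda>x. 0))"

definition symplectic_form ::
  "(V \<Rightarrow> V \<Rightarrow> V \<Rightarrow> complex) \<Rightarrow> (V set \<Rightarrow> (V \<Rightarrow> V) \<Rightarrow> (V \<Rightarrow> V) \<Rightarrow> complex) \<Rightarrow> bool" where
  "symplectic_form P \<Omega> \<longleftrightarrow>
     two_form_on_fano P \<Omega> \<and> holomorphic_form P \<Omega> \<and> closed_form P \<Omega> \<and> nondegenerate_form P \<Omega>"

(* The scalar c is the normalization of K, which is only defined up to a nonzero scalar.
   Where omega vanishes identically on a tangent space, the identity says nothing about
   \<Omega>; continuity fixes \<Omega> at such lines as the limit of its values at general lines. *)
definition determined_form ::
  "complex \<Rightarrow> (V \<Rightarrow> V \<Rightarrow> V \<Rightarrow> complex) \<Rightarrow> (V set \<Rightarrow> (V \<Rightarrow> V) \<Rightarrow> (V \<Rightarrow> V) \<Rightarrow> complex) \<Rightarrow> bool" where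
  "determined_form c P \<Omega> \<longleftrightarrow>
     two_form_on_fano P \<Omega> \<and> continuous_form P \<Omega> \<and>
     (\<forall>T\<in>fano P. \<forall>e f. is_basis T e f \<longrightarrow>
        (\<forall>u\<in>tangent_fano P T. \<forall>v\<in>tangent_fano P T.
           c * K_form e f u v = omega P e f u v * \<Omega> T u v))"

end

(*
  Write X = x e + y f for a basis e, f of T. For vectors w, w' put A = P(X,X,w) and B = P(X,X,w'),
  and let G be the binary quadratic form e /\ f /\ u(X) /\ v(X) /\ w /\ w'. If A and B have no common
  zero, the Grothendieck residue of G / (A B) does not change under linear changes of the basis of T
  and of (w,w'), and omega times this residue is 3 K; so it is Omega up to a constant. Unlike
  K / omega, it makes sense on every line of a smooth cubic, is holomorphic, and is nondegenerate by
  inspection in coordinates with A = x^2 and B = y^2. In such coordinates dOmega is a cyclic sum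
  which, by Cramer's rule and P(X,X,u(X)) = 0, is the residue of a total derivative, hence zero.
  Omega is determined by K = omega Omega and continuity because omega vanishes identically on no
  open set of lines: otherwise differentiating the relation P(e,f,.) = 0 satisfied by a moving basis
  produces a plane contained in X.
  General means: smooth and without planes. Both conditions hold off a hypersurface because the cubics
  violating them depend on 55 parameters, and 56 polynomials in 55 variables are algebraically
  dependent.
*)
theory Submission
  imports Defs "HOL-Complex_Analysis.Cauchy_Integral_Formula"
    "HOL-Computational_Algebra.Fundamental_Theorem_Algebra"
begin

section \<open>General cubics\<close>

text \<open>Linear changes of \<open>(w, w')\<close> compare only pairs spanning the same plane.
  Residues for different planes agree because both satisfy the identity with K and omega: they
  coincide where omega is not identically zero, and elsewhere by continuity. The density statement
  about omega thus serves twice, for the uniqueness of Omega and for the independence of the residue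
  of all choices. An adapted frame is obtained at each line separately, with no control on how it
  varies. So \<open>w\<close>, \<open>w'\<close> are kept constant, and a moving basis of T is
  recombined with constant coefficients so as to be adapted at the one point where a derivative is
  taken. Smoothness of the cubic says that \<open>P x x\<close> is a nonzero functional for each
  nonzero \<open>x\<close> in T. This yields A and B without common zero even on lines where
  \<open>P e e\<close>, \<open>P e f\<close>, \<open>P f f\<close> are linearly dependent. The same
  adapted coordinates solve the equations of F(X) by the inverse function theorem and so provide its
  charts.\<close>

text \<open>Gaussian elimination by induction on the equations \<open>L\<close>: a pivot
  \<open>k0\<close> in the equation \<open>l\<close> removes one unknown together with that
  equation.\<close>

lemma homogeneous_system_nontrivial:
  fixes A :: "'k \<Rightarrow> 'l \<Rightarrow> complex"
  assumes "finite L" "finite K" "card L < card K"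
  shows "\<exists>c. (\<exists>k\<in>K. c k \<noteq> 0) \<and> (\<forall>l\<in>L. (\<Sum>k\<in>K. c k * A k l) = 0)"
  using assms
proof (induction L arbitrary: K A rule: finite_induct)
  case empty
  then obtain k where "k \<in> K" by fastforce
  then show ?case by (intro exI[of _ "\<lambda>_. 1"]) auto
next
  case (insert l L)
  show ?case
  proof (cases "\<forall>k\<in>K. A k l = 0")
    case True
    with insert.IH[of K A] insert.prems insert.hyps show ?thesis by auto
  next
    case False
    then obtain k0 where k0: "k0 \<in> K" "A k0 l \<noteq> 0" by auto
    define A' where "A' = (\<lambda>k j. A k j - A k l / A k0 l * A k0 j)"
    have "card L < card (K - {k0})" using insert.prems insert.hyps k0 by simp
    with insert.IH[of "K - {k0}" A'] insert.prems obtain c k1 where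
      c: "k1 \<in> K - {k0}" "c k1 \<noteq> 0" "\<And>j. j \<in> L \<Longrightarrow> (\<Sum>k\<in>K-{k0}. c k * A' k j) = 0" by auto
    \<comment> \<open>The entry at the pivot is forced by equation \<open>l\<close>; with it, every
      other equation turns into its eliminated version with matrix \<open>A'\<close>.\<close>
    define c' where "c' = c(k0 := - (\<Sum>k\<in>K-{k0}. c k * A k l) / A k0 l)"
    have split: "(\<Sum>k\<in>K. c' k * A k j) =
        - (\<Sum>k\<in>K-{k0}. c k * A k l) / A k0 l * A k0 j + (\<Sum>k\<in>K-{k0}. c k * A k j)" for j
    proof -
      have "(\<Sum>k\<in>K-{k0}. c' k * A k j) = (\<Sum>k\<in>K-{k0}. c k * A k j)"
        by (intro sum.cong) (auto simp: c'_def)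
      then show ?thesis using k0 insert.prems by (simp add: sum.remove[of K k0] c'_def)
    qed
    have "(\<Sum>k\<in>K. c' k * A k j) = 0" if "j \<in> insert l L" for j
    proof (cases "j = l")
      case True
      then show ?thesis using k0 by (simp add: split)
    next
      case False
      then have "0 = (\<Sum>k\<in>K-{k0}. c k * A' k j)" using c that by auto
      also have "\<dots> = (\<Sum>k\<in>K-{k0}. c k * A k j) - (\<Sum>k\<in>K-{k0}. c k * A k l) / A k0 l * A k0 j"
        by (simp add: A'_def algebra_simps sum_subtractf sum_divide_distrib sum_distrib_left)
      finally show ?thesis by (simp add: split)
    qed
    moreover have "k1 \<in> K" "c' k1 \<noteq> 0" using c by (auto simp: c'_def)
    ultimately show ?thesis by blast
  qed
qed

section \<open>Polynomial functions in finitely many variables and their algebraic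
  dependence\<close>

text \<open>Polynomials are treated as functions of the values of the variables. The bound
  \<open>d\<close> restricts each exponent separately, so that the monomials are indexed by the
  finite function space \<open>M \<rightarrow>\<^sub>E {..d}\<close>.\<close>

inductive_set poly_fun :: "'m set \<Rightarrow> nat \<Rightarrow> (('m \<Rightarrow> complex) \<Rightarrow> complex) set"
  for M :: "'m set" and d :: nat where
  zero: "(\<lambda>x. 0) \<in> poly_fun M d"
| add_monom: "(\<forall>i\<in>M. k i \<le> d) \<Longrightarrow> f \<in> poly_fun M d \<Longrightarrow>
    (\<lambda>x. a * (\<Prod>i\<in>M. x i ^ k i) + f x) \<in> poly_fun M d"

lemma poly_fun_mono: "f \<in> poly_fun M d \<Longrightarrow> d \<le> d' \<Longrightarrow> f \<in> poly_fun M d'"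
  by (induction rule: poly_fun.induct) (auto intro!: poly_fun.intros intro: order_trans)

lemma poly_fun_add:
  "f \<in> poly_fun M d \<Longrightarrow> g \<in> poly_fun M d \<Longrightarrow> (\<lambda>x. f x + g x) \<in> poly_fun M d"
  by (induction rule: poly_fun.induct) (auto simp: add.assoc intro: poly_fun.intros)

lemma poly_fun_monom:
  "(\<forall>i\<in>M. k i \<le> d) \<Longrightarrow> (\<lambda>x. a * (\<Prod>i\<in>M. x i ^ k i)) \<in> poly_fun M d"
  using poly_fun.add_monom[OF _ poly_fun.zero, of M k d a] by simp

lemma poly_fun_const: "(\<lambda>x. a) \<in> poly_fun M d"
  using poly_fun_monom[of M "\<lambda>_. 0" d a] by simp

lemma poly_fun_var:
  assumes "finite M" "i \<in> M" "1 \<le> d"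
  shows "(\<lambda>x. x i) \<in> poly_fun M d"
proof -
  have "(\<Prod>j\<in>M. x j ^ (if j = i then 1 else 0)) = (\<Prod>j\<in>M. if j = i then x j else 1)"
    for x :: "'a \<Rightarrow> complex"
    by (intro prod.cong) auto
  then have "(\<Prod>j\<in>M. x j ^ (if j = i then 1 else 0)) = x i" for x :: "'a \<Rightarrow> complex"
    using assms by simp
  then show ?thesis
    using poly_fun_monom[of M "\<lambda>j. if j = i then 1 else 0" d 1] assms by simp
qed

lemma poly_fun_monom_mult:
  assumes "g \<in> poly_fun M e" "\<forall>i\<in>M. k i \<le> d"
  shows "(\<lambda>x. a * (\<Prod>i\<in>M. x i ^ k i) * g x) \<in> poly_fun M (d + e)"
  using assms
proof (induction rule: poly_fun.induct)
  case zero
  then show ?case by (simp add: poly_fun.zero)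
next
  case (add_monom k' g b)
  have "(\<lambda>x. (a * b) * (\<Prod>i\<in>M. x i ^ (k i + k' i)) + a * (\<Prod>i\<in>M. x i ^ k i) * g x)
      \<in> poly_fun M (d + e)"
    using add_monom by (intro poly_fun.intros) (auto intro: add_mono)
  then show ?case by (simp add: power_add prod.distrib algebra_simps)
qed

lemma poly_fun_mult:
  assumes "f \<in> poly_fun M d" "g \<in> poly_fun M e"
  shows "(\<lambda>x. f x * g x) \<in> poly_fun M (d + e)"
  using assms(1)
proof (induction rule: poly_fun.induct)
  case zero
  then show ?case by (simp add: poly_fun.zero)
next
  case (add_monom k f a)
  then show ?case
    using poly_fun_add[OF poly_fun_monom_mult[OF assms(2), of k d a] add_monom.IH]
    by (simp add: algebra_simps)
qed

lemma poly_fun_sum: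
  "(\<And>i. i \<in> I \<Longrightarrow> f i \<in> poly_fun M d) \<Longrightarrow> (\<lambda>x. \<Sum>i\<in>I. f i x) \<in> poly_fun M d"
  by (induction I rule: infinite_finite_induct) (auto intro: poly_fun.zero poly_fun_add)

lemma poly_fun_prod:
  "(\<And>i. i \<in> I \<Longrightarrow> f i \<in> poly_fun M d) \<Longrightarrow> (\<lambda>x. \<Prod>i\<in>I. f i x) \<in> poly_fun M (card I * d)"
  by (induction I rule: infinite_finite_induct) (auto intro: poly_fun_const poly_fun_mult)

text \<open>Collecting equal monomials bounds the dimension of the space of these functions by
  \<open>(d + 1) ^ card M\<close>, the bound on which the counting rests.\<close>

lemma poly_fun_coeffs:
  assumes "f \<in> poly_fun M d" "finite M"
  shows "\<exists>c. \<forall>x. f x = (\<Sum>k\<in>M \<rightarrow>\<^sub>E {..d}. c k * (\<Prod>i\<in>M. x i ^ k i))"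
  using assms
proof (induction rule: poly_fun.induct)
  case zero
  then show ?case by (intro exI[of _ "\<lambda>_. 0"]) simp
next
  case (add_monom k f a)
  then obtain c where c: "\<And>x. f x = (\<Sum>k\<in>M \<rightarrow>\<^sub>E {..d}. c k * (\<Prod>i\<in>M. x i ^ k i))" by blast
  \<comment> \<open>The monomial sees \<open>k\<close> only on \<open>M\<close>; the restriction is
    the representative of \<open>k\<close> in the extensional function space.\<close>
  define k' where "k' = restrict k M"
  have k': "k' \<in> M \<rightarrow>\<^sub>E {..d}" using add_monom by (auto simp: k'_def)
  have eq: "(\<Prod>i\<in>M. x i ^ k i) = (\<Prod>i\<in>M. x i ^ k' i)" for x :: "'a \<Rightarrow> complex"
    by (intro prod.cong) (auto simp: k'_def)
  have fin: "finite (M \<rightarrow>\<^sub>E {..d})" using add_monom by (simp add: finite_PiE)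
  have "a * (\<Prod>i\<in>M. x i ^ k i) + f x =
      (\<Sum>l\<in>M \<rightarrow>\<^sub>E {..d}. (c(k' := c k' + a)) l * (\<Prod>i\<in>M. x i ^ l i))" for x
  proof -
    have "(\<Sum>l\<in>(M \<rightarrow>\<^sub>E {..d}) - {k'}. (c(k' := c k' + a)) l * (\<Prod>i\<in>M. x i ^ l i))
        = (\<Sum>l\<in>(M \<rightarrow>\<^sub>E {..d}) - {k'}. c l * (\<Prod>i\<in>M. x i ^ l i))"
      by (intro sum.cong) auto
    then show ?thesis
      using fin k' unfolding c eq by (simp add: sum.remove[of _ k'] algebra_simps)
  qed
  then show ?case by blast
qed

text \<open>Counting: products of Lagrange polynomials for the grid \<open>{0..D}\<close> are \<open>(D+1) ^ card I\<close> in
  number, while after substitution they lie in a space of dimension \<open>O(D ^ card M)\<close>. A nontrivial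
  relation between them is automatically nonzero at some grid point.\<close>

lemma algebraically_dependent:
  fixes \<phi> :: "'i \<Rightarrow> ('m \<Rightarrow> complex) \<Rightarrow> complex"
  assumes "finite I" "finite M" "card M < card I" "\<And>i. i \<in> I \<Longrightarrow> \<phi> i \<in> poly_fun M d"
  obtains \<Psi> e y where "\<Psi> \<in> poly_fun I e" "\<And>x. \<Psi> (\<lambda>i. \<phi> i x) = 0" "\<Psi> y \<noteq> 0"
proof -
  define n m C where "n = card I" and "m = card M" and "C = n * d + 1"
  \<comment> \<open>There are \<open>(D + 1) ^ n\<close> products, each with exponents at most
    \<open>N\<close> after substitution: \<open>n\<close> blocks of \<open>D\<close> factors with
    exponents at most \<open>d\<close>. Since \<open>N + 1 \<le> C * (D + 1)\<close>, the number of
    monomials is at most \<open>C ^ m * (D + 1) ^ m\<close>, and \<open>D = C ^ m\<close> makes this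
    smaller than \<open>(D + 1) ^ (m + 1)\<close>.\<close>
  define D where "D = C ^ m"
  define N where "N = n * (D * d)"
  have "(N + 1) ^ m < (D + 1) ^ n"
  proof -
    have "N + 1 \<le> C * (D + 1)" unfolding N_def C_def by (simp add: algebra_simps)
    then have "(N + 1) ^ m \<le> C ^ m * (D + 1) ^ m"
      by (metis power_mono power_mult_distrib zero_le)
    also have "\<dots> < (D + 1) * (D + 1) ^ m" unfolding D_def by (intro mult_strict_right_mono) auto
    also have "\<dots> \<le> (D + 1) ^ n"
      using assms(3) power_increasing[of "Suc m" n "D + 1"] by (simp add: n_def m_def)
    finally show ?thesis .
  qed
  then have card: "card (M \<rightarrow>\<^sub>E {..N}) < card (I \<rightarrow>\<^sub>E {..D})"
    using assms by (simp add: card_PiE n_def m_def)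
  define Lag where "Lag = (\<lambda>(k :: 'i \<Rightarrow> nat) (y :: 'i \<Rightarrow> complex).
    \<Prod>i\<in>I. \<Prod>j\<in>{..D} - {k i}. y i - of_nat j)"
  have Lag_poly: "(\<lambda>x. Lag k (\<lambda>i. \<phi> i x)) \<in> poly_fun M N" if "k \<in> I \<rightarrow>\<^sub>E {..D}" for k
  proof -
    have "(\<lambda>x. \<Prod>j\<in>{..D} - {k i}. \<phi> i x - of_nat j) \<in> poly_fun M (D * d)" if "i \<in> I" for i
    proof -
      have "card ({..D} - {k i}) = D" using \<open>k \<in> _\<close> that by (auto simp: card_Diff_singleton_if PiE_iff)
      moreover have "(\<lambda>x. \<phi> i x + (- of_nat j)) \<in> poly_fun M d" for j
        using assms(4)[OF that] by (intro poly_fun_add poly_fun_const)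
      ultimately show ?thesis
        using poly_fun_prod[of "{..D} - {k i}" "\<lambda>j x. \<phi> i x - of_nat j" M d] by simp
    qed
    then show ?thesis unfolding Lag_def N_def n_def by (rule poly_fun_prod)
  qed
  have "\<forall>k\<in>I \<rightarrow>\<^sub>E {..D}. \<exists>c. \<forall>x. Lag k (\<lambda>i. \<phi> i x) =
      (\<Sum>l\<in>M \<rightarrow>\<^sub>E {..N}. c l * (\<Prod>i\<in>M. x i ^ l i))"
    using poly_fun_coeffs[OF Lag_poly assms(2)] by blast
  from bchoice[OF this] obtain B where B: "\<And>k x. k \<in> I \<rightarrow>\<^sub>E {..D} \<Longrightarrow> Lag k (\<lambda>i. \<phi> i x) =
      (\<Sum>l\<in>M \<rightarrow>\<^sub>E {..N}. B k l * (\<Prod>i\<in>M. x i ^ l i))"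
    by blast
  have fin: "finite (I \<rightarrow>\<^sub>E {..D})" "finite (M \<rightarrow>\<^sub>E {..N})" using assms by (auto intro: finite_PiE)
  obtain c k0 where c: "k0 \<in> I \<rightarrow>\<^sub>E {..D}" "c k0 \<noteq> 0"
      "\<And>l. l \<in> M \<rightarrow>\<^sub>E {..N} \<Longrightarrow> (\<Sum>k\<in>I \<rightarrow>\<^sub>E {..D}. c k * B k l) = 0"
    using homogeneous_system_nontrivial[OF fin(2,1) card, of B] by blast
  define \<Psi> where "\<Psi> = (\<lambda>y. \<Sum>k\<in>I \<rightarrow>\<^sub>E {..D}. c k * Lag k y)"
  have "\<Psi> (\<lambda>i. \<phi> i x) = 0" for x
  proof -
    have "\<Psi> (\<lambda>i. \<phi> i x) =
        (\<Sum>k\<in>I \<rightarrow>\<^sub>E {..D}. \<Sum>l\<in>M \<rightarrow>\<^sub>E {..N}. c k * B k l * (\<Prod>i\<in>M. x i ^ l i))"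
      unfolding \<Psi>_def by (intro sum.cong refl) (simp add: B sum_distrib_left mult.assoc)
    also have "\<dots> = (\<Sum>l\<in>M \<rightarrow>\<^sub>E {..N}. (\<Sum>k\<in>I \<rightarrow>\<^sub>E {..D}. c k * B k l) * (\<Prod>i\<in>M. x i ^ l i))"
      by (subst sum.swap) (simp add: sum_distrib_right)
    also have "\<dots> = 0" using c by (intro sum.neutral) auto
    finally show ?thesis .
  qed
  \<comment> \<open>At the grid point \<open>k0\<close> every product other than
    \<open>Lag k0\<close> contains a vanishing factor, so the relation cannot be zero as a
    function.\<close>
  moreover have "\<Psi> (\<lambda>i. of_nat (k0 i)) \<noteq> 0"
  proof -
    have "Lag k (\<lambda>i. of_nat (k0 i)) = 0" if k: "k \<in> I \<rightarrow>\<^sub>E {..D}" "k \<noteq> k0" for k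
    proof -
      obtain i where "i \<in> I" "k i \<noteq> k0 i" using PiE_ext[OF k(1) c(1)] k(2) by blast
      moreover have "k0 i \<in> {..D}" using c(1) \<open>i \<in> I\<close> by (auto simp: PiE_iff)
      ultimately have "\<exists>j\<in>{..D} - {k i}. complex_of_nat (k0 i) - of_nat j = 0"
        by (intro bexI[of _ "k0 i"]) auto
      then have "(\<Prod>j\<in>{..D} - {k i}. complex_of_nat (k0 i) - of_nat j) = 0"
        by (rule prod_zero[rotated]) simp
      then have "\<exists>i\<in>I. (\<Prod>j\<in>{..D} - {k i}. complex_of_nat (k0 i) - of_nat j) = 0"
        using \<open>i \<in> I\<close> by (rule bexI)
      then show ?thesis unfolding Lag_def by (rule prod_zero[OF assms(1)])
    qed
    then have "\<Psi> (\<lambda>i. of_nat (k0 i)) = c k0 * Lag k0 (\<lambda>i. of_nat (k0 i))"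
      unfolding \<Psi>_def using fin c(1) by (subst sum.remove[of _ k0]) (auto intro: sum.neutral)
    moreover have "Lag k0 (\<lambda>i. of_nat (k0 i)) \<noteq> 0" unfolding Lag_def using assms(1) by auto
    ultimately show ?thesis using c by simp
  qed
  moreover obtain e where "\<Psi> \<in> poly_fun I e"
  proof -
    have "Lag k \<in> poly_fun I (card I * Suc D)" if "k \<in> I \<rightarrow>\<^sub>E {..D}" for k
    proof -
      have "(\<lambda>y. \<Prod>j\<in>{..D} - {k i}. y i - of_nat j) \<in> poly_fun I (Suc D)" if "i \<in> I" for i
      proof -
        have "(\<lambda>y. y i + (- of_nat j)) \<in> poly_fun I 1" for j
          using that assms(1) by (intro poly_fun_add poly_fun_const poly_fun_var) auto
        then have "(\<lambda>y. \<Prod>j\<in>{..D} - {k i}. y i - of_nat j) \<in> poly_fun I (card ({..D} - {k i}) * 1)"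
          by (intro poly_fun_prod) simp
        moreover have "card ({..D} - {k i}) \<le> Suc D"
          using card_mono[of "{..D}" "{..D} - {k i}"] by auto
        ultimately show ?thesis using poly_fun_mono by fastforce
      qed
      then show ?thesis unfolding Lag_def by (rule poly_fun_prod)
    qed
    then have "(\<lambda>y. c k * Lag k y) \<in> poly_fun I (0 + card I * Suc D)" if "k \<in> I \<rightarrow>\<^sub>E {..D}" for k
      using that by (intro poly_fun_mult poly_fun_const) auto
    then have "\<Psi> \<in> poly_fun I (0 + card I * Suc D)" unfolding \<Psi>_def by (rule poly_fun_sum)
    then show ?thesis using that by blast
  qed
  ultimately show ?thesis using that by blast
qed

section \<open>Coordinates on the space of cubics\<close>

text \<open>The coordinates on cubics are indexed by the 56 multisets of three indices. An arbitrary
  ordering of each multiset turns its coordinate into an evaluation of \<open>P\<close>.\<close>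

definition coeff_rep :: "6 multiset \<Rightarrow> 6 \<times> 6 \<times> 6" where
  "coeff_rep s = (SOME (i, j, k). s = {#i, j, k#})"

definition cubic_coeff :: "(V \<Rightarrow> V \<Rightarrow> V \<Rightarrow> complex) \<Rightarrow> 6 multiset \<Rightarrow> complex" where
  "cubic_coeff P s =
     (case coeff_rep s of (i, j, k) \<Rightarrow> P (axis i 1) (axis j 1) (axis k 1))"

text \<open>Only the values of \<open>Y\<close> on \<open>triples\<close> are read, and
  \<open>cubic_coeff\<close> recovers them: any choice of the 56 coordinates comes from a
  cubic.\<close>

definition cubic_of :: "(6 multiset \<Rightarrow> complex) \<Rightarrow> V \<Rightarrow> V \<Rightarrow> V \<Rightarrow> complex" where
  "cubic_of Y x y z = (\<Sum>i\<in>UNIV. \<Sum>j\<in>UNIV. \<Sum>k\<in>UNIV. x $ i * y $ j * z $ k * Y {#i, j, k#})"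

definition triples :: "6 multiset set" where
  "triples = (\<lambda>(i, j, k). {#i, j, k#}) ` UNIV"

lemma finite_triples: "finite triples"
  unfolding triples_def by simp

lemma cubicD:
  assumes "cubic P"
  shows "P x y z = P y x z" "P x y z = P x z y"
    "P (x + x') y z = P x y z + P x' y z" "P (c *s x) y z = c * P x y z"
proof -
  show "P x y z = P y x z" "P x y z = P x z y" using assms unfolding cubic_def by blast+
  interpret Vector_Spaces.linear "(*s)" "(*)" "\<lambda>x. P x y z" using assms unfolding cubic_def by blast
  show "P (x + x') y z = P x y z + P x' y z" "P (c *s x) y z = c * P x y z" using add scale by auto
qed

lemma cubic_linear:
  assumes "cubic P"
  shows "P x (y + y') z = P x y z + P x y' z" "P x (c *s y) z = c * P x y z"
    "P x y (z + z') = P x y z + P x y z'" "P x y (c *s z) = c * P x y z"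
  using cubicD[OF assms] by metis+

lemma cubic_zero:
  assumes "cubic P"
  shows "P 0 y z = 0" "P x 0 z = 0" "P x y 0 = 0"
  using cubicD(4)[OF assms, of 0 0] cubic_linear(2)[OF assms, of x 0 0] cubic_linear(4)[OF assms, of x y 0 0]
  by simp_all

lemma cubic_sum:
  assumes "cubic P"
  shows "P (\<Sum>i\<in>I. f i) y z = (\<Sum>i\<in>I. P (f i) y z)" "P x (\<Sum>i\<in>I. f i) z = (\<Sum>i\<in>I. P x (f i) z)"
    "P x y (\<Sum>i\<in>I. f i) = (\<Sum>i\<in>I. P x y (f i))"
  by (induction I rule: infinite_finite_induct)
     (auto simp: cubic_zero[OF assms] cubicD(3)[OF assms] cubic_linear[OF assms])

text \<open>The ordering chosen by \<open>coeff_rep\<close> is a permutation of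
  \<open>i, j, k\<close>, and \<open>P\<close> is symmetric.\<close>

lemma cubic_coeff_triple:
  assumes "cubic P"
  shows "cubic_coeff P {#i, j, k#} = P (axis i 1) (axis j 1) (axis k 1)"
proof -
  obtain a b c where rep: "coeff_rep {#i, j, k#} = (a, b, c)" by (metis prod_cases3)
  have "case coeff_rep {#i, j, k#} of (a, b, c) \<Rightarrow> {#i, j, k#} = {#a, b, c#}"
    unfolding coeff_rep_def by (rule someI[of _ "(i, j, k)"]) simp
  then have "{#i, j, k#} = {#a, b, c#}" by (simp add: rep)
  then have "mset [i, j, k] = mset [a, b, c]" by simp
  then have "(i = a \<and> (j = b \<and> k = c \<or> j = c \<and> k = b)) \<or> (i = b \<and> (j = a \<and> k = c \<or> j = c \<and> k = a))
     \<or> (i = c \<and> (j = a \<and> k = b \<or> j = b \<and> k = a))"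
    by (auto simp: add_eq_conv_ex)
  then show ?thesis unfolding cubic_coeff_def rep using cubicD(1,2)[OF assms] by (auto; metis)
qed

lemma cubic_expand:
  assumes "cubic P"
  shows "P x y z = (\<Sum>i\<in>UNIV. \<Sum>j\<in>UNIV. \<Sum>k\<in>UNIV. x $ i * y $ j * z $ k * cubic_coeff P {#i, j, k#})"
proof -
  have "P x y z = P (\<Sum>i\<in>UNIV. x $ i *s axis i 1) (\<Sum>i\<in>UNIV. y $ i *s axis i 1) (\<Sum>i\<in>UNIV. z $ i *s axis i 1)"
    by (simp add: basis_expansion)
  also have "\<dots> = (\<Sum>i\<in>UNIV. x $ i * P (axis i 1) (\<Sum>i\<in>UNIV. y $ i *s axis i 1) (\<Sum>i\<in>UNIV. z $ i *s axis i 1))"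
    by (simp only: cubic_sum(1)[OF assms] cubicD(4)[OF assms])
  also have "\<dots> = (\<Sum>i\<in>UNIV. x $ i * (\<Sum>j\<in>UNIV. y $ j * (\<Sum>k\<in>UNIV. z $ k * P (axis i 1) (axis j 1) (axis k 1))))"
    by (subst cubic_sum(2)[OF assms], subst cubic_linear(2)[OF assms],
        subst cubic_sum(3)[OF assms], subst cubic_linear(4)[OF assms]) (rule refl)
  finally show ?thesis
    by (simp add: cubic_coeff_triple[OF assms] sum_distrib_left mult.assoc)
qed

lemma cubic_cubic_of: "cubic (cubic_of Y)"
proof -
  have sym: "cubic_of Y x y z = cubic_of Y y x z" for x y z
    unfolding cubic_of_def by (subst sum.swap) (simp add: ac_simps add_mset_commute)
  have sym': "cubic_of Y x y z = cubic_of Y x z y" for x y z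
    unfolding cubic_of_def
    by (rule sum.cong[OF refl], subst sum.swap) (simp add: ac_simps add_mset_commute)
  have "Vector_Spaces.linear (*s) (*) (\<lambda>x. cubic_of Y x y z)" for y z
    by (unfold_locales)
       (simp_all add: cubic_of_def algebra_simps sum.distrib sum_distrib_left)
  with sym sym' show ?thesis unfolding cubic_def by blast
qed

lemma cubic_coeff_cubic_of:
  assumes "s \<in> triples"
  shows "cubic_coeff (cubic_of Y) s = Y s"
proof -
  obtain i j k where s: "s = {#i, j, k#}" using assms unfolding triples_def by auto
  have "cubic_of Y (axis i 1) (axis j 1) (axis k 1) = Y {#i, j, k#}"
  proof -
    have "(\<Sum>l\<in>UNIV. axis m 1 $ l * f l) = f m" for m :: 6 and f :: "6 \<Rightarrow> complex"
      by (subst sum.remove[of _ m]) (auto simp: axis_def intro!: sum.neutral)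
    then show ?thesis
      unfolding cubic_of_def by (simp add: mult.assoc flip: sum_distrib_left)
  qed
  then show ?thesis by (simp add: s cubic_coeff_triple[OF cubic_cubic_of])
qed

section \<open>Polynomial conditions and general cubics\<close>

lemma polynomial_on_cubics_prod:
  "(\<And>i. i \<in> I \<Longrightarrow> polynomial_on_cubics (f i)) \<Longrightarrow> polynomial_on_cubics (\<lambda>P. \<Prod>i\<in>I. f i P)"
  by (induction I rule: infinite_finite_induct) (auto intro: polynomial_on_cubics.intros)

lemma polynomial_on_cubics_power:
  "polynomial_on_cubics f \<Longrightarrow> polynomial_on_cubics (\<lambda>P. f P ^ n)"
  by (induction n) (auto intro: polynomial_on_cubics.intros)

lemma polynomial_on_cubics_coeff: "polynomial_on_cubics (\<lambda>P. cubic_coeff P s)"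
  unfolding cubic_coeff_def by (cases "coeff_rep s") (simp add: polynomial_on_cubics.eval)

lemma polynomial_on_cubics_poly_fun:
  "\<Psi> \<in> poly_fun I e \<Longrightarrow> polynomial_on_cubics (\<lambda>P. \<Psi> (cubic_coeff P))"
  by (induction rule: poly_fun.induct)
     (auto intro!: polynomial_on_cubics.intros polynomial_on_cubics_prod
       polynomial_on_cubics_power polynomial_on_cubics_coeff)

text \<open>Irreducibility of the space of cubics, tested on a line: along the affine line
  \<open>L\<close> through a point with \<open>\<Phi> \<noteq> 0\<close> and a point with
  \<open>\<Psi> \<noteq> 0\<close>, both are nonzero polynomials in one variable, and so is their
  product.\<close>

lemma for_general_cubic_conj:
  assumes "for_general_cubic R" "for_general_cubic S"
  shows "for_general_cubic (\<lambda>P. R P \<and> S P)"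
proof -
  obtain \<Phi> P where \<Phi>: "polynomial_on_cubics \<Phi>" "cubic P" "\<Phi> P \<noteq> 0" "\<And>P. cubic P \<Longrightarrow> \<Phi> P \<noteq> 0 \<Longrightarrow> R P"
    using assms(1) unfolding for_general_cubic_def by blast
  obtain \<Psi> Q where \<Psi>: "polynomial_on_cubics \<Psi>" "cubic Q" "\<Psi> Q \<noteq> 0" "\<And>P. cubic P \<Longrightarrow> \<Psi> P \<noteq> 0 \<Longrightarrow> S P"
    using assms(2) unfolding for_general_cubic_def by blast
  define L where "L = (\<lambda>t x y z. P x y z + t * (Q x y z - P x y z))"
  have cubic_L: "cubic (L t)" for t
  proof -
    have "Vector_Spaces.linear (*s) (*) (\<lambda>x. L t x y z)" for y z
      by unfold_locales (simp_all add: L_def cubicD(3,4)[OF \<Phi>(2)] cubicD(3,4)[OF \<Psi>(2)] algebra_simps)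
    moreover have "L t x y z = L t y x z" "L t x y z = L t x z y" for x y z
      unfolding L_def using cubicD(1,2)[OF \<Phi>(2)] cubicD(1,2)[OF \<Psi>(2)] by metis+
    ultimately show ?thesis unfolding cubic_def by blast
  qed
  have poly: "\<exists>p. \<forall>t. f (L t) = poly p t" if "polynomial_on_cubics f" for f
    using that
  proof (induction rule: polynomial_on_cubics.induct)
    case (const a)
    show ?case by (intro exI[of _ "[:a:]"]) simp
  next
    case (eval x y z)
    show ?case by (intro exI[of _ "[:P x y z, Q x y z - P x y z:]"]) (simp add: L_def)
  next
    case (add f g)
    then show ?case by (metis poly_add)
  next
    case (mult f g)
    then show ?case by (metis poly_mult)
  qed
  obtain p q where pq: "\<And>t. \<Phi> (L t) = poly p t" "\<And>t. \<Psi> (L t) = poly q t"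
    using poly[OF \<Phi>(1)] poly[OF \<Psi>(1)] by blast
  have "L 0 = P" "L 1 = Q" by (simp_all add: L_def)
  then have "p \<noteq> 0" "q \<noteq> 0" using pq(1)[of 0] pq(2)[of 1] \<Phi>(3) \<Psi>(3) by auto
  then obtain t where "poly (p * q) t \<noteq> 0" by (metis mult_eq_0_iff poly_all_0_iff_0)
  then have "\<Phi> (L t) * \<Psi> (L t) \<noteq> 0" by (simp add: pq)
  moreover have "polynomial_on_cubics (\<lambda>P. \<Phi> P * \<Psi> P)" using \<Phi>(1) \<Psi>(1) by (rule mult)
  ultimately show ?thesis unfolding for_general_cubic_def
    using cubic_L \<Phi>(4) \<Psi>(4) by (intro exI[of _ "\<lambda>P. \<Phi> P * \<Psi> P"]) auto
qed

lemma for_general_cubic_ball: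
  assumes "finite I" "\<And>i. i \<in> I \<Longrightarrow> for_general_cubic (R i)"
  shows "for_general_cubic (\<lambda>P. \<forall>i\<in>I. R i P)"
  using assms
proof (induction I rule: finite_induct)
  case empty
  have "cubic (cubic_of (\<lambda>_. 0))" by (rule cubic_cubic_of)
  then show ?case unfolding for_general_cubic_def by (intro exI[of _ "\<lambda>_. 1"]) (auto intro: const)
next
  case (insert i I)
  then show ?case using for_general_cubic_conj[of "R i" "\<lambda>P. \<forall>i\<in>I. R i P"] by auto
qed

lemma for_general_cubic_mono:
  "for_general_cubic R \<Longrightarrow> (\<And>P. cubic P \<Longrightarrow> R P \<Longrightarrow> S P) \<Longrightarrow> for_general_cubic S"
  unfolding for_general_cubic_def by blast

text \<open>The bad cubics are described by fewer parameters than there are coefficients: the coefficients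
  outside \<open>J\<close> together with the extra parameters \<open>N\<close> determine those in \<open>J\<close>.\<close>

lemma for_general_cubic_by_counting:
  fixes \<phi> :: "6 multiset \<Rightarrow> (6 multiset + 'b \<Rightarrow> complex) \<Rightarrow> complex"
  assumes "J \<subseteq> triples" "finite N" "card N < card J"
    and "\<And>s. s \<in> J \<Longrightarrow> \<phi> s \<in> poly_fun (Inl ` (triples - J) \<union> Inr ` N) d"
    and bad: "\<And>P. cubic P \<Longrightarrow> B P \<Longrightarrow> \<exists>x. (\<forall>s\<in>triples - J. x (Inl s) = cubic_coeff P s) \<and>
       (\<forall>s\<in>J. cubic_coeff P s = \<phi> s x)"
  shows "for_general_cubic (\<lambda>P. \<not> B P)"
proof -
  define M where "M = (Inl ` (triples - J) \<union> Inr ` N :: (6 multiset + 'b) set)"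
  have fin: "finite M" "finite J" "finite (triples - J)"
    using finite_triples assms(1,2) finite_subset by (auto simp: M_def)
  have "card M = card (triples - J) + card N"
    unfolding M_def using fin assms(2) by (subst card_Un_disjoint) (auto simp: card_image)
  moreover have "card (triples - J) + card J = card triples"
    using assms(1) finite_triples by (metis card_Diff_subset card_mono fin(2) le_add_diff_inverse2)
  ultimately have card: "card M < card triples" using assms(3) by simp
  define \<phi>' where "\<phi>' = (\<lambda>s. if s \<in> J then \<phi> s else (\<lambda>x. x (Inl s)))"
  have "\<phi>' s \<in> poly_fun M (Suc d)" if "s \<in> triples" for s
    using assms(4)[of s] that fin poly_fun_mono[of "\<phi> s" M d "Suc d"] poly_fun_var[of M "Inl s" "Suc d"]
    unfolding \<phi>'_def M_def by auto
  \<comment> \<open>All coefficients of a bad cubic are values of the \<open>\<phi>'\<close>, which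
    outnumber their variables. A relation \<open>\<Psi>\<close> among the \<open>\<phi>'\<close> is
    therefore an equation satisfied by every bad cubic.\<close>
  then obtain \<Psi> e Y where \<Psi>: "\<Psi> \<in> poly_fun triples e" "\<And>x. \<Psi> (\<lambda>i. \<phi>' i x) = 0" "\<Psi> Y \<noteq> 0"
    using algebraically_dependent[OF finite_triples fin(1) card] by metis
  have cong: "\<Psi> f = \<Psi> g" if "\<And>s. s \<in> triples \<Longrightarrow> f s = g s" for f g
    using \<Psi>(1)
  proof (induction rule: poly_fun.induct)
    case (add_monom k h a)
    have "(\<Prod>i\<in>triples. f i ^ k i) = (\<Prod>i\<in>triples. g i ^ k i)"
      using that by (intro prod.cong) auto
    then show ?case using add_monom by simp
  qed simp
  have "\<Psi> (cubic_coeff (cubic_of Y)) \<noteq> 0"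
    using \<Psi>(3) cong[of "cubic_coeff (cubic_of Y)" Y] cubic_coeff_cubic_of by auto
  moreover have "\<not> B P" if "cubic P" "\<Psi> (cubic_coeff P) \<noteq> 0" for P
  proof
    assume "B P"
    with bad[OF that(1)] obtain x where x: "\<And>s. s \<in> triples - J \<Longrightarrow> x (Inl s) = cubic_coeff P s"
      "\<And>s. s \<in> J \<Longrightarrow> cubic_coeff P s = \<phi> s x" by blast
    have "\<Psi> (cubic_coeff P) = \<Psi> (\<lambda>s. \<phi>' s x)" by (rule cong) (auto simp: \<phi>'_def x)
    with \<Psi>(2) that show False by simp
  qed
  ultimately show ?thesis
    unfolding for_general_cubic_def using polynomial_on_cubics_poly_fun[OF \<Psi>(1)] cubic_cubic_of by blast
qed

section \<open>Singular cubics and cubics containing a plane\<close>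

text \<open>The equation is linear in the coefficients and \<open>(i, j, k)\<close> enters with
  factor 1. The sum runs over ordered triples, so it may still contain the same coefficient through
  another ordering; the applications choose \<open>x\<close>, \<open>y\<close>, \<open>z\<close>
  such that those terms vanish.\<close>

lemma cubic_coeff_solve:
  assumes "cubic P" "x $ i = 1" "y $ j = 1" "z $ k = 1" "P x y z = 0"
  shows "cubic_coeff P {#i, j, k#} =
    - (\<Sum>(a, b, c)\<in>UNIV - {(i, j, k)}. x $ a * y $ b * z $ c * cubic_coeff P {#a, b, c#})"
proof -
  have "(\<Sum>(a, b, c)\<in>UNIV. x $ a * y $ b * z $ c * cubic_coeff P {#a, b, c#}) = 0"
    using cubic_expand[OF assms(1), of x y z] assms(5)
    by (simp add: sum.cartesian_product UNIV_Times_UNIV[symmetric] del: UNIV_Times_UNIV)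
  then show ?thesis
    using assms(2-4) by (subst (asm) sum.remove[of _ "(i, j, k)"]) (auto simp: add_eq_0_iff)
qed

lemma poly_fun_uminus: "f \<in> poly_fun M d \<Longrightarrow> (\<lambda>x. - f x) \<in> poly_fun M d"
  using poly_fun_mult[OF poly_fun_const[of "-1" M 0], of f d] by simp

lemma triple_in_triples: "{#i, j, k#} \<in> triples"
  unfolding triples_def by (rule image_eqI[of _ _ "(i, j, k)"]) auto

text \<open>A singular point with coordinate \<open>i0\<close> equal to 1 has five free coordinates
  and imposes the six equations \<open>P x x (axis k 1) = 0\<close>, which are solved for the
  coefficients at \<open>{#i0, i0, k#}\<close>.\<close>

lemma for_general_cubic_nonsingular_chart:
  "for_general_cubic (\<lambda>P. \<not> (\<exists>x. x $ i0 = 1 \<and> (\<forall>y. P x x y = 0)))"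
proof -
  define J where "J = (\<lambda>k. {#i0, i0, k#}) ` UNIV"
  define N where "N = UNIV - {i0}"
  define M where "M = (Inl ` (triples - J) \<union> Inr ` N :: (6 multiset + 6) set)"
  define third where "third = (\<lambda>s. SOME k. s = {#i0, i0, k#})"
  define p :: "6 \<Rightarrow> (6 multiset + 6 \<Rightarrow> complex) \<Rightarrow> complex"
    where "p = (\<lambda>a x. if a = i0 then 1 else x (Inr a))"
  define term3 where "term3 = (\<lambda>k f (x :: 6 multiset + 6 \<Rightarrow> complex).
     - (\<Sum>(a, b, c)\<in>UNIV - {(i0, i0, k)}. p a x * p b x * axis k 1 $ c * f {#a, b, c#} x))"
  define \<psi> where "\<psi> = (\<lambda>s. if s \<in> J then term3 (third s) (\<lambda>s x. x (Inl s)) else (\<lambda>x. x (Inl s)))"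
  \<comment> \<open>The equation for \<open>k = i0\<close> still contains the coefficients at
    \<open>{#i0, i0, b#}\<close> with \<open>b \<noteq> i0\<close>. These are therefore solved
    first, by \<open>\<psi>\<close>, and substituted.\<close>
  define \<phi> where "\<phi> = (\<lambda>s. if s = {#i0, i0, i0#} then term3 i0 \<psi> else \<psi> s)"
  have J: "J \<subseteq> triples" unfolding J_def using triple_in_triples by auto
  have "card J = 6" unfolding J_def by (subst card_image) (auto intro: inj_onI)
  then have card: "card N < card J" by (simp add: N_def card_Diff_singleton_if)
  have third: "third {#i0, i0, k#} = k" for k
  proof -
    have "{#i0, i0, k#} = {#i0, i0, third {#i0, i0, k#}#}" unfolding third_def by (rule someI) simp
    then show ?thesis by simp
  qed
  have fin: "finite M" unfolding M_def N_def using finite_triples by simp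
  have p: "p a \<in> poly_fun M 1" for a
    using fin poly_fun_var[of M "Inr a" 1] by (cases "a = i0") (auto simp: p_def M_def N_def poly_fun_const)
  have term3: "term3 k f \<in> poly_fun M (1 + 1 + 0 + d)"
    if f: "\<And>a b. (a, b) \<noteq> (i0, i0) \<Longrightarrow> f {#a, b, k#} \<in> poly_fun M d" for k f d
  proof -
    have "(\<lambda>x. p a x * p b x * axis k 1 $ c * f {#a, b, c#} x) \<in> poly_fun M (1 + 1 + 0 + d)"
      if "(a, b, c) \<noteq> (i0, i0, k)" for a b c
    proof (cases "c = k")
      case True
      with that f[of a b] show ?thesis by (intro poly_fun_mult p poly_fun_const) auto
    next
      case False
      then show ?thesis by (simp add: axis_def poly_fun.zero)
    qed
    then show ?thesis unfolding term3_def by (intro poly_fun_uminus poly_fun_sum) auto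
  qed
  have notin: "{#a, b, k#} \<notin> J" if "(a, b) \<noteq> (i0, i0)" "k \<noteq> i0" for a b k
    using that by (auto simp: J_def add_eq_conv_ex)
  have \<psi>: "\<psi> s \<in> poly_fun M (1 + 1 + 0 + 1)" if s: "s \<in> triples" "s \<noteq> {#i0, i0, i0#}" for s
  proof (cases "s \<in> J")
    case True
    then obtain k where k: "s = {#i0, i0, k#}" unfolding J_def by auto
    have "(\<lambda>x. x (Inl {#a, b, k#})) \<in> poly_fun M 1" if "(a, b) \<noteq> (i0, i0)" for a b
    proof -
      have "k \<noteq> i0" using s(2) k by auto
      with notin[OF that] triple_in_triples have "Inl {#a, b, k#} \<in> M" unfolding M_def by blast
      then show ?thesis using fin by (intro poly_fun_var) auto
    qed
    then have "term3 k (\<lambda>s x. x (Inl s)) \<in> poly_fun M (1 + 1 + 0 + 1)" by (rule term3)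
    then show ?thesis using True by (simp add: \<psi>_def k third)
  next
    case False
    with s(1) have "Inl s \<in> M" unfolding M_def by blast
    with False fin show ?thesis unfolding \<psi>_def by (auto intro: poly_fun_var)
  qed
  have \<phi>: "\<phi> s \<in> poly_fun M 5" if "s \<in> J" for s
  proof (cases "s = {#i0, i0, i0#}")
    case True
    have "term3 i0 \<psi> \<in> poly_fun M (1 + 1 + 0 + (1 + 1 + 0 + 1))"
    proof (intro term3 \<psi> triple_in_triples)
      fix a b assume "(a, b) \<noteq> (i0, i0)"
      then show "{#a, b, i0#} \<noteq> {#i0, i0, i0#}" by (auto simp: add_eq_conv_ex)
    qed
    then have "term3 i0 \<psi> \<in> poly_fun M 5" by (rule poly_fun_mono) simp
    with True show ?thesis by (simp add: \<phi>_def)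
  next
    case False
    with \<psi>[of s] that J have "\<phi> s \<in> poly_fun M (1 + 1 + 0 + 1)" by (auto simp: \<phi>_def)
    then show ?thesis by (rule poly_fun_mono) simp
  qed
  show ?thesis
  proof (rule for_general_cubic_by_counting[OF J _ card, where d = 5 and \<phi> = \<phi>])
    show "finite N" by (simp add: N_def)
    show "\<phi> s \<in> poly_fun (Inl ` (triples - J) \<union> Inr ` N) 5" if "s \<in> J" for s
      using \<phi>[OF that] by (simp add: M_def)
    fix P assume P: "cubic P" "\<exists>x. x $ i0 = 1 \<and> (\<forall>y. P x x y = 0)"
    then obtain x where x: "x $ i0 = 1" "\<And>y. P x x y = 0" by blast
    define X where "X = case_sum (cubic_coeff P) (\<lambda>a. x $ a)"
    have pX: "p a X = x $ a" for a by (simp add: p_def X_def x)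
    have t: "term3 k f X = cubic_coeff P {#i0, i0, k#}"
      if f: "\<And>a b. (a, b) \<noteq> (i0, i0) \<Longrightarrow> f {#a, b, k#} X = cubic_coeff P {#a, b, k#}" for k f
    proof -
      have "x $ a * x $ b * axis k 1 $ c * f {#a, b, c#} X =
          x $ a * x $ b * axis k 1 $ c * cubic_coeff P {#a, b, c#}"
        if "(a, b, c) \<noteq> (i0, i0, k)" for a b c
        using that f[of a b] by (cases "c = k") (auto simp: axis_def)
      then have "(\<Sum>(a, b, c)\<in>UNIV - {(i0, i0, k)}. x $ a * x $ b * axis k 1 $ c * f {#a, b, c#} X) =
          (\<Sum>(a, b, c)\<in>UNIV - {(i0, i0, k)}. x $ a * x $ b * axis k 1 $ c * cubic_coeff P {#a, b, c#})"
        by (intro sum.cong refl) (metis (mono_tags, lifting) DiffD2 case_prod_conv prod_cases3 singletonI)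
      then have "term3 k f X = - (\<Sum>(a, b, c)\<in>UNIV - {(i0, i0, k)}.
          x $ a * x $ b * axis k 1 $ c * cubic_coeff P {#a, b, c#})"
        unfolding term3_def pX by simp
      also have "\<dots> = cubic_coeff P {#i0, i0, k#}"
        by (rule cubic_coeff_solve[symmetric]) (use P(1) x in auto)
      finally show ?thesis .
    qed
    have \<psi>X: "\<psi> s X = cubic_coeff P s" for s
    proof (cases "s \<in> J")
      case True
      then obtain k where k: "s = {#i0, i0, k#}" unfolding J_def by auto
      show ?thesis using True t[where k = k and f = "\<lambda>s x. x (Inl s)"] by (simp add: \<psi>_def k third) (simp add: X_def)
    next
      case False
      then show ?thesis by (simp add: \<psi>_def X_def)
    qed
    have "\<phi> s X = cubic_coeff P s" for s
      using t[where k = i0 and f = \<psi>] by (auto simp: \<phi>_def \<psi>X)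
    then show "\<exists>x. (\<forall>s\<in>triples - J. x (Inl s) = cubic_coeff P s) \<and> (\<forall>s\<in>J. cubic_coeff P s = \<phi> s x)"
      by (intro exI[of _ X]) (auto simp: X_def)
  qed
qed

text \<open>A plane with a basis in reduced echelon form with pivots \<open>s\<close>,
  \<open>t\<close>, \<open>u\<close> has nine free entries. Vanishing of \<open>P\<close> on it is
  ten equations, solved for the ten coefficients supported on the pivots.\<close>

lemma for_general_cubic_no_plane_chart:
  fixes s t u :: 6
  assumes "distinct [s, t, u]"
  shows "for_general_cubic (\<lambda>P. \<not> (\<exists>r. (\<forall>i\<in>{s, t, u}. \<forall>j\<in>{s, t, u}. r i $ j = (if i = j then 1 else 0)) \<and>
     (\<forall>i\<in>{s, t, u}. \<forall>j\<in>{s, t, u}. \<forall>k\<in>{s, t, u}. P (r i) (r j) (r k) = 0)))"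
proof -
  define S where "S = {s, t, u}"
  define J where "J = (\<lambda>(i, j, k). {#i, j, k#}) ` (S \<times> S \<times> S)"
  define N where "N = S \<times> (UNIV - S)"
  define M where "M = (Inl ` (triples - J) \<union> Inr ` N :: (6 multiset + 6 \<times> 6) set)"
  define rep where "rep = (\<lambda>\<sigma>. SOME (i, j, k). i \<in> S \<and> j \<in> S \<and> k \<in> S \<and> \<sigma> = {#i, j, k#})"
  define p :: "6 \<Rightarrow> 6 \<Rightarrow> (6 multiset + 6 \<times> 6 \<Rightarrow> complex) \<Rightarrow> complex"
    where "p = (\<lambda>i a x. if a \<in> S then (if i = a then 1 else 0) else x (Inr (i, a)))"
  define \<phi> where "\<phi> = (\<lambda>\<sigma> (x :: 6 multiset + 6 \<times> 6 \<Rightarrow> complex). case rep \<sigma> of (i, j, k) \<Rightarrow>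
     - (\<Sum>(a, b, c)\<in>UNIV - {(i, j, k)}. p i a x * p j b x * p k c x * x (Inl {#a, b, c#})))"
  have rep: "\<exists>i\<in>S. \<exists>j\<in>S. \<exists>k\<in>S. rep \<sigma> = (i, j, k) \<and> \<sigma> = {#i, j, k#}" if \<sigma>: "\<sigma> \<in> J" for \<sigma>
  proof -
    have "case rep \<sigma> of (i, j, k) \<Rightarrow> i \<in> S \<and> j \<in> S \<and> k \<in> S \<and> \<sigma> = {#i, j, k#}"
    proof -
      obtain i j k where "\<sigma> = {#i, j, k#}" "i \<in> S" "j \<in> S" "k \<in> S" using \<sigma> by (auto simp: J_def)
      then have "case (i, j, k) of (i, j, k) \<Rightarrow> i \<in> S \<and> j \<in> S \<and> k \<in> S \<and> \<sigma> = {#i, j, k#}" by simp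
      then show ?thesis unfolding rep_def by (rule someI)
    qed
    then show ?thesis by (cases "rep \<sigma>") auto
  qed
  have J: "J \<subseteq> triples" unfolding J_def using triple_in_triples by auto
  have S: "s \<in> S" "t \<in> S" "u \<in> S" "card S = 3" "s \<noteq> t" "s \<noteq> u" "t \<noteq> u"
    using assms by (auto simp: S_def)
  have "card N = 9" unfolding N_def using S(4) by (simp add: card_cartesian_product card_Diff_subset)
  moreover have "10 \<le> card J"
  proof -
    \<comment> \<open>A multiset of size three in \<open>S\<close> is determined by its
      multiplicities at \<open>s\<close> and \<open>t\<close>, and ten pairs of multiplicities
      occur.\<close>
    define f where "f = (\<lambda>m. (count m s, count m t))"
    have "(\<lambda>(i, j, k). f {#i, j, k#}) ` (S \<times> S \<times> S) = f ` J"
      unfolding J_def image_image by (intro image_cong) auto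
    moreover have "(3, 0) \<in> (\<lambda>(i, j, k). f {#i, j, k#}) ` (S \<times> S \<times> S)"
      "(2, 1) \<in> (\<lambda>(i, j, k). f {#i, j, k#}) ` (S \<times> S \<times> S)"
      "(2, 0) \<in> (\<lambda>(i, j, k). f {#i, j, k#}) ` (S \<times> S \<times> S)"
      "(1, 2) \<in> (\<lambda>(i, j, k). f {#i, j, k#}) ` (S \<times> S \<times> S)"
      "(1, 1) \<in> (\<lambda>(i, j, k). f {#i, j, k#}) ` (S \<times> S \<times> S)"
      "(1, 0) \<in> (\<lambda>(i, j, k). f {#i, j, k#}) ` (S \<times> S \<times> S)"
      "(0, 3) \<in> (\<lambda>(i, j, k). f {#i, j, k#}) ` (S \<times> S \<times> S)"
      "(0, 2) \<in> (\<lambda>(i, j, k). f {#i, j, k#}) ` (S \<times> S \<times> S)"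
      "(0, 1) \<in> (\<lambda>(i, j, k). f {#i, j, k#}) ` (S \<times> S \<times> S)"
      "(0, 0) \<in> (\<lambda>(i, j, k). f {#i, j, k#}) ` (S \<times> S \<times> S)"
      using S by (simp_all add: f_def S_def image_iff)
    ultimately have "{(3, 0), (2, 1), (2, 0), (1, 2), (1, 1), (1, 0), (0, 3), (0, 2), (0, 1), (0, 0)} \<subseteq> f ` J"
      by auto
    moreover have "finite (f ` J)" unfolding J_def S_def by simp
    ultimately have "card {(3 :: nat, 0 :: nat), (2, 1), (2, 0), (1, 2), (1, 1), (1, 0), (0, 3), (0, 2), (0, 1), (0, 0)} \<le> card (f ` J)"
      by (intro card_mono)
    also have "\<dots> \<le> card J" by (rule card_image_le) (simp add: J_def S_def)
    finally show ?thesis by simp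
  qed
  ultimately have card: "card N < card J" by simp
  have fin: "finite M" unfolding M_def N_def S_def using finite_triples by simp
  have p: "p i a \<in> poly_fun M 1" if "i \<in> S" for i a
    using fin that poly_fun_var[of M "Inr (i, a)" 1]
    by (cases "a \<in> S"; cases "i = a") (auto simp: p_def M_def N_def poly_fun_const)
  have \<phi>: "\<phi> \<sigma> \<in> poly_fun M (1 + 1 + 1 + 1)" if \<sigma>: "\<sigma> \<in> J" for \<sigma>
  proof -
    obtain i j k where ijk: "i \<in> S" "j \<in> S" "k \<in> S" "rep \<sigma> = (i, j, k)" using rep[OF \<sigma>] by blast
    have "(\<lambda>x. p i a x * p j b x * p k c x * x (Inl {#a, b, c#})) \<in> poly_fun M (1 + 1 + 1 + 1)"
      if "(a, b, c) \<noteq> (i, j, k)" for a b c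
    \<comment> \<open>The rows restricted to \<open>S\<close> form the identity matrix, so among
      triples in \<open>S\<close> only \<open>(i, j, k)\<close> itself has a nonzero factor. Hence
      each equation contains just one of the coefficients in \<open>J\<close>.\<close>
    proof (cases "a \<in> S \<and> b \<in> S \<and> c \<in> S")
      case True
      with that have "(\<lambda>x. p i a x * p j b x * p k c x * x (Inl {#a, b, c#})) = (\<lambda>x. 0)"
        by (auto simp: p_def)
      then show ?thesis by (simp only: poly_fun.zero)
    next
      case False
      have "set_mset {#a, b, c#} \<subseteq> S" if "{#a, b, c#} \<in> J"
        using that unfolding J_def by (auto simp del: set_mset_add_mset_insert) auto
      with False have "{#a, b, c#} \<notin> J" by auto
      then have "Inl {#a, b, c#} \<in> M" using triple_in_triples unfolding M_def by blast
      then show ?thesis using ijk fin by (intro poly_fun_mult p poly_fun_var) auto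
    qed
    then show ?thesis unfolding \<phi>_def ijk(4) prod.case by (intro poly_fun_uminus poly_fun_sum) auto
  qed
  show ?thesis
  proof (rule for_general_cubic_by_counting[OF J _ card, where d = "1 + 1 + 1 + 1" and \<phi> = \<phi>])
    show "finite N" by (simp add: N_def S_def)
    show "\<phi> \<sigma> \<in> poly_fun (Inl ` (triples - J) \<union> Inr ` N) (1 + 1 + 1 + 1)" if "\<sigma> \<in> J" for \<sigma>
      using \<phi>[OF that] by (simp add: M_def)
    fix P assume P: "cubic P" "\<exists>r. (\<forall>i\<in>{s, t, u}. \<forall>j\<in>{s, t, u}. r i $ j = (if i = j then 1 else 0)) \<and>
     (\<forall>i\<in>{s, t, u}. \<forall>j\<in>{s, t, u}. \<forall>k\<in>{s, t, u}. P (r i) (r j) (r k) = 0)"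
    then obtain r where r: "\<And>i j. i \<in> S \<Longrightarrow> j \<in> S \<Longrightarrow> r i $ j = (if i = j then 1 else 0)"
      "\<And>i j k. i \<in> S \<Longrightarrow> j \<in> S \<Longrightarrow> k \<in> S \<Longrightarrow> P (r i) (r j) (r k) = 0" unfolding S_def by blast
    define X where "X = case_sum (cubic_coeff P) (\<lambda>(i, a). r i $ a)"
    have pX: "p i a X = r i $ a" if "i \<in> S" for i a using that by (simp add: p_def X_def r)
    have "cubic_coeff P \<sigma> = \<phi> \<sigma> X" if \<sigma>: "\<sigma> \<in> J" for \<sigma>
    proof -
      obtain i j k where ijk: "i \<in> S" "j \<in> S" "k \<in> S" "rep \<sigma> = (i, j, k)" "\<sigma> = {#i, j, k#}"
        using rep[OF \<sigma>] by blast
      have "\<phi> \<sigma> X = - (\<Sum>(a, b, c)\<in>UNIV - {(i, j, k)}. r i $ a * r j $ b * r k $ c * cubic_coeff P {#a, b, c#})"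
        unfolding \<phi>_def ijk(4) prod.case pX[OF ijk(1)] pX[OF ijk(2)] pX[OF ijk(3)] by (simp add: X_def)
      also have "\<dots> = cubic_coeff P \<sigma>"
        unfolding ijk(5) by (rule cubic_coeff_solve[symmetric]) (use P(1) ijk r in auto)
      finally show ?thesis by simp
    qed
    then show "\<exists>x. (\<forall>\<sigma>\<in>triples - J. x (Inl \<sigma>) = cubic_coeff P \<sigma>) \<and> (\<forall>\<sigma>\<in>J. cubic_coeff P \<sigma> = \<phi> \<sigma> x)"
      by (intro exI[of _ X]) (auto simp: X_def)
  qed
qed

text \<open>\<open>P x x\<close> is one third of the differential of the cubic at \<open>x\<close>;
  a point where it vanishes lies on the hypersurface automatically.\<close>

definition singular_cubic :: "(V \<Rightarrow> V \<Rightarrow> V \<Rightarrow> complex) \<Rightarrow> bool" where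
  "singular_cubic P \<longleftrightarrow> (\<exists>x. x \<noteq> 0 \<and> (\<forall>y. P x x y = 0))"

definition contains_plane :: "(V \<Rightarrow> V \<Rightarrow> V \<Rightarrow> complex) \<Rightarrow> bool" where
  "contains_plane P \<longleftrightarrow> (\<exists>W. vec.subspace W \<and> vec.dim W = 3 \<and> (\<forall>x\<in>W. \<forall>y\<in>W. \<forall>z\<in>W. P x y z = 0))"

lemma for_general_cubic_nonsingular: "for_general_cubic (\<lambda>P. \<not> singular_cubic P)"
proof -
  have "for_general_cubic (\<lambda>P. \<forall>i\<in>UNIV. \<not> (\<exists>x. x $ i = 1 \<and> (\<forall>y. P x x y = 0)))"
    using for_general_cubic_nonsingular_chart by (intro for_general_cubic_ball) auto
  then show ?thesis
  proof (rule for_general_cubic_mono)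
    fix P assume P: "cubic P" "\<forall>i\<in>UNIV. \<not> (\<exists>x. x $ i = 1 \<and> (\<forall>y. P x x y = 0))"
    show "\<not> singular_cubic P"
    proof
      assume "singular_cubic P"
      then obtain x where x: "x \<noteq> 0" "\<And>y. P x x y = 0" unfolding singular_cubic_def by blast
      then obtain i where i: "x $ i \<noteq> 0" by (auto simp: vec_eq_iff)
      define x' where "x' = (1 / x $ i) *s x"
      have "x' $ i = 1" "\<And>y. P x' x' y = 0"
        using i by (simp_all add: x'_def cubicD(4)[OF P(1)] cubic_linear(2)[OF P(1)] x)
      with P show False by blast
    qed
  qed
qed

text \<open>Row reduction: as long as fewer than three vectors are found, \<open>W\<close> is not in
  their span; a vector outside it is cleared at the pivots found so far and scaled to have entry 1
  at a new one.\<close>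

lemma reduced_basis:
  fixes W :: "V set"
  assumes W: "vec.subspace W" "vec.dim W = 3"
  obtains s t u r where "distinct [s, t, u]"
    "\<And>i. i \<in> {s, t, u} \<Longrightarrow> r i \<in> W"
    "\<And>i j. i \<in> {s, t, u} \<Longrightarrow> j \<in> {s, t, u} \<Longrightarrow> r i $ j = (if i = j then 1 else 0)"
proof -
  have notin: "\<not> W \<subseteq> vec.span B" if "finite B" "card B < 3" for B
    using vec.dim_le_card[of W B] that W(2) by auto
  note sub = vec.subspace_diff[OF W(1)] vec.subspace_scale[OF W(1)]
  obtain x s where x: "x \<in> W" "x $ s = 1"
  proof -
    obtain x where "x \<in> W" "x \<noteq> 0" using notin[of "{}"] by auto
    then obtain s where "x $ s \<noteq> 0" by (auto simp: vec_eq_iff)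
    with \<open>x \<in> W\<close> show ?thesis by (intro that[of "(1 / x $ s) *s x" s]) (auto intro: sub)
  qed
  obtain y t where y: "y \<in> W" "y $ s = 0" "y $ t = 1"
  proof -
    obtain y where y: "y \<in> W" "y \<notin> vec.span {x}" using notin[of "{x}"] by auto
    define y' where "y' = y - y $ s *s x"
    have "y' \<noteq> 0" using y(2) by (auto simp: y'_def vec.span_singleton)
    then obtain t where t: "y' $ t \<noteq> 0" by (auto simp: vec_eq_iff)
    moreover have "y' $ s = 0" "y' \<in> W" using x y by (auto simp: y'_def intro: sub)
    ultimately show ?thesis by (intro that[of "(1 / y' $ t) *s y'" t]) (auto intro: sub)
  qed
  define x2 where "x2 = x - x $ t *s y"
  have x2: "x2 \<in> W" "x2 $ s = 1" "x2 $ t = 0" using x y by (auto simp: x2_def intro: sub)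
  obtain z u where z: "z \<in> W" "z $ s = 0" "z $ t = 0" "z $ u = 1"
  proof -
    obtain z where z: "z \<in> W" "z \<notin> vec.span {x2, y}" 
    proof -
      have "card {x2, y} < 3" by (simp add: card_insert_if)
      then show ?thesis using notin[of "{x2, y}"] that by blast
    qed
    define z' where "z' = z - z $ s *s x2 - z $ t *s y"
    have "z' \<noteq> 0"
    proof
      assume "z' = 0"
      then have "z = z $ s *s x2 + z $ t *s y" by (simp add: z'_def algebra_simps)
      moreover have "z $ s *s x2 + z $ t *s y \<in> vec.span {x2, y}"
        by (intro vec.span_add vec.span_scale vec.span_base) auto
      ultimately show False using z(2) by simp
    qed
    then obtain u where u: "z' $ u \<noteq> 0" by (auto simp: vec_eq_iff)
    moreover have "z' $ s = 0" "z' $ t = 0" "z' \<in> W" using x2 y z by (auto simp: z'_def intro: sub)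
    ultimately show ?thesis by (intro that[of "(1 / z' $ u) *s z'" u]) (auto intro: sub)
  qed
  \<comment> \<open>Back substitution at the last pivot \<open>u\<close>; \<open>x2\<close> has
    already been cleared at \<open>t\<close>.\<close>
  define r where "r = (\<lambda>i. if i = s then x2 - x2 $ u *s z else if i = t then y - y $ u *s z else z)"
  have d: "distinct [s, t, u]" using x2 y z by auto
  show ?thesis
    by (rule that[of s t u r, OF d]) (use d x2 y z in \<open>auto simp: r_def intro!: sub\<close>)
qed

lemma for_general_cubic_no_plane: "for_general_cubic (\<lambda>P. \<not> contains_plane P)"
proof -
  define D :: "(6 \<times> 6 \<times> 6) set" where "D = {(s, t, u). distinct [s, t, u]}"
  define R where "R = (\<lambda>(s, t, u) P. \<not> (\<exists>r :: 6 \<Rightarrow> V. (\<forall>i\<in>{s, t, u}. \<forall>j\<in>{s, t, u}. r i $ j = (if i = j then 1 else 0)) \<and>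
     (\<forall>i\<in>{s, t, u}. \<forall>j\<in>{s, t, u}. \<forall>k\<in>{s, t, u}. P (r i) (r j) (r k) = (0::complex))))"
  have "for_general_cubic (\<lambda>P. \<forall>i\<in>D. R i P)"
  proof (rule for_general_cubic_ball)
    show "for_general_cubic (R i)" if i: "i \<in> D" for i
    proof -
      obtain s t u where i: "i = (s, t, u)" "distinct [s, t, u]" using i unfolding D_def by blast
      show ?thesis unfolding R_def i(1) prod.case by (rule for_general_cubic_no_plane_chart[OF i(2)])
    qed
  qed simp
  then show ?thesis
  proof (rule for_general_cubic_mono)
    fix P assume P: "cubic P" "\<forall>i\<in>D. R i P"
    show "\<not> contains_plane P"
    proof
      assume "contains_plane P"
      then obtain W where W: "vec.subspace W" "vec.dim W = 3" "\<And>x y z. x \<in> W \<Longrightarrow> y \<in> W \<Longrightarrow> z \<in> W \<Longrightarrow> P x y z = 0"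
        unfolding contains_plane_def by blast
      obtain s t u r where r: "distinct [s, t, u]" "\<And>i. i \<in> {s, t, u} \<Longrightarrow> r i \<in> W"
        "\<And>i j. i \<in> {s, t, u} \<Longrightarrow> j \<in> {s, t, u} \<Longrightarrow> r i $ j = (if i = j then 1 else 0)"
        using reduced_basis[OF W(1,2)] by metis
      have "R (s, t, u) P" using P(2) r(1) by (auto simp: D_def)
      moreover have "\<exists>r :: 6 \<Rightarrow> V. (\<forall>i\<in>{s, t, u}. \<forall>j\<in>{s, t, u}. r i $ j = (if i = j then 1 else 0)) \<and>
          (\<forall>i\<in>{s, t, u}. \<forall>j\<in>{s, t, u}. \<forall>k\<in>{s, t, u}. P (r i) (r j) (r k) = 0)"
        by (intro exI[of _ r] conjI ballI r(3) W(3) r(2))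
      ultimately show False unfolding R_def prod.case by blast
    qed
  qed
qed

section \<open>Holomorphic functions of four variables\<close>

lemma norm_scalar_mult_vec: "norm (c *s x) = norm c * norm (x :: complex ^ 'n)"
  by (simp add: norm_vec_def norm_mult L2_set_right_distrib)

lemma scaleR_vec_complex: "r *\<^sub>R x = complex_of_real r *s (x :: complex ^ 'n)"
  by (simp add: vec_eq_iff) (simp add: scaleR_conv_of_real)

lemma bounded_linear_scalar_mult_left: "bounded_linear (\<lambda>h. h *s (v :: complex ^ 'n))"
  unfolding linear_conv_bounded_linear[symmetric] linear_iff
  by (simp add: vec.scale_left_distrib scaleR_vec_complex scaleR_conv_of_real)

lemma complex_linear_iff:
  fixes D :: "complex ^ 'n \<Rightarrow> complex"
  shows "Vector_Spaces.linear (*s) (*) D \<longleftrightarrow> (\<forall>x y. D (x + y) = D x + D y) \<and> (\<forall>c x. D (c *s x) = c * D x)"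
proof -
  have "vector_space ((*s) :: complex \<Rightarrow> complex ^ 'n \<Rightarrow> complex ^ 'n)" "vector_space ((*) :: complex \<Rightarrow> complex \<Rightarrow> complex)"
    by unfold_locales (simp_all add: algebra_simps)
  then show ?thesis
    by (auto simp: Vector_Spaces.linear_iff)
qed

lemma complex_linear_vec_iff:
  fixes D :: "complex ^ 'n \<Rightarrow> complex ^ 'm"
  shows "Vector_Spaces.linear (*s) (*s) D \<longleftrightarrow> (\<forall>x y. D (x + y) = D x + D y) \<and> (\<forall>c x. D (c *s x) = c *s D x)"
proof -
  have "vector_space ((*s) :: complex \<Rightarrow> complex ^ 'n \<Rightarrow> complex ^ 'n)" "vector_space ((*s) :: complex \<Rightarrow> complex ^ 'm \<Rightarrow> complex ^ 'm)"
    by unfold_locales (simp_all add: algebra_simps)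
  then show ?thesis
    by (auto simp: Vector_Spaces.linear_iff)
qed

text \<open>The direction precedes the point, so that \<open>dird g \<xi>\<close> is again a
  function of the point and can be differentiated once more.\<close>

abbreviation dird :: "('a::real_normed_vector \<Rightarrow> 'b::real_normed_vector) \<Rightarrow> 'a \<Rightarrow> 'a \<Rightarrow> 'b" where
  "dird g \<xi> t \<equiv> frechet_derivative g (at t) \<xi>"

lemma dird_eq: "(g has_derivative D) (at t) \<Longrightarrow> dird g \<xi> t = D \<xi>"
  by (metis frechet_derivative_at)

lemma holomorphic_C4D:
  assumes "holomorphic_C4 U g" "t \<in> U"
  shows "(g has_derivative frechet_derivative g (at t)) (at t)"
    "dird g (\<xi> + \<eta>) t = dird g \<xi> t + dird g \<eta> t" "dird g (c *s \<xi>) t = c * dird g \<xi> t"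
proof -
  obtain D where D: "(g has_derivative D) (at t)" "Vector_Spaces.linear (*s) (*) D"
    using assms unfolding holomorphic_C4_def by blast
  then have "frechet_derivative g (at t) = D" using frechet_derivative_at by metis
  with D show "(g has_derivative frechet_derivative g (at t)) (at t)"
    "dird g (\<xi> + \<eta>) t = dird g \<xi> t + dird g \<eta> t" "dird g (c *s \<xi>) t = c * dird g \<xi> t"
    by (simp_all add: complex_linear_iff)
qed

text \<open>Additivity comes with the real derivative; complex homogeneity is all that has to be
  checked.\<close>

lemma holomorphic_C4I:
  assumes "\<And>t. t \<in> U \<Longrightarrow> \<exists>D. (g has_derivative D) (at t) \<and> (\<forall>c \<xi>. D (c *s \<xi>) = c * D \<xi>)"
  shows "holomorphic_C4 U g"
  unfolding holomorphic_C4_def complex_linear_iff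
proof
  fix t assume "t \<in> U"
  with assms obtain D where D: "(g has_derivative D) (at t)" "\<And>c \<xi>. D (c *s \<xi>) = c * D \<xi>" by blast
  then show "\<exists>D. (g has_derivative D) (at t) \<and> (\<forall>x y. D (x + y) = D x + D y) \<and> (\<forall>c x. D (c *s x) = c * D x)"
    using has_derivative_linear[OF D(1)] by (intro exI[of _ D]) (auto simp: linear_iff)
qed

lemma holomorphic_C4_continuous_on: "holomorphic_C4 U g \<Longrightarrow> continuous_on U g"
  by (meson continuous_at_imp_continuous_on has_derivative_continuous holomorphic_C4D(1))

lemma holomorphic_C4_subset: "holomorphic_C4 U g \<Longrightarrow> W \<subseteq> U \<Longrightarrow> holomorphic_C4 W g"
  unfolding holomorphic_C4_def by blast

lemma holomorphic_C4_const: "holomorphic_C4 U (\<lambda>t. a)"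
  by (intro holomorphic_C4I exI[of _ "\<lambda>_. 0"]) simp

lemma holomorphic_C4_add:
  assumes "holomorphic_C4 U f" "holomorphic_C4 U g"
  shows "holomorphic_C4 U (\<lambda>t. f t + g t)"
proof (rule holomorphic_C4I, intro exI conjI allI)
  fix t assume "t \<in> U"
  note f = holomorphic_C4D[OF assms(1) this] and g = holomorphic_C4D[OF assms(2) this]
  show "((\<lambda>t. f t + g t) has_derivative (\<lambda>\<xi>. dird f \<xi> t + dird g \<xi> t)) (at t)"
    using f(1) g(1) by (rule has_derivative_add)
  show "dird f (c *s \<xi>) t + dird g (c *s \<xi>) t = c * (dird f \<xi> t + dird g \<xi> t)" for c \<xi>
    by (simp add: f(3) g(3) algebra_simps)
qed

lemma holomorphic_C4_mult:
  assumes "holomorphic_C4 U f" "holomorphic_C4 U g"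
  shows "holomorphic_C4 U (\<lambda>t. f t * g t)"
proof (rule holomorphic_C4I, intro exI conjI allI)
  fix t assume "t \<in> U"
  note f = holomorphic_C4D[OF assms(1) this] and g = holomorphic_C4D[OF assms(2) this]
  show "((\<lambda>t. f t * g t) has_derivative (\<lambda>\<xi>. f t * dird g \<xi> t + dird f \<xi> t * g t)) (at t)"
    using f(1) g(1) by (rule has_derivative_mult)
  show "f t * dird g (c *s \<xi>) t + dird f (c *s \<xi>) t * g t = c * (f t * dird g \<xi> t + dird f \<xi> t * g t)" for c \<xi>
    by (simp add: f(3) g(3) algebra_simps)
qed

lemma holomorphic_C4_diff:
  assumes "holomorphic_C4 U f" "holomorphic_C4 U g"
  shows "holomorphic_C4 U (\<lambda>t. f t - g t)"
  using holomorphic_C4_add[OF assms(1) holomorphic_C4_mult[OF holomorphic_C4_const[of U "-1"] assms(2)]] by simp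

lemma holomorphic_C4_divide:
  assumes "holomorphic_C4 U f" "holomorphic_C4 U g" "\<And>t. t \<in> U \<Longrightarrow> g t \<noteq> 0"
  shows "holomorphic_C4 U (\<lambda>t. f t / g t)"
proof (rule holomorphic_C4I, intro exI conjI allI)
  fix t assume t: "t \<in> U"
  note f = holomorphic_C4D[OF assms(1) this] and g = holomorphic_C4D[OF assms(2) this]
  show "((\<lambda>t. f t / g t) has_derivative (\<lambda>\<xi>. (dird f \<xi> t * g t - f t * dird g \<xi> t) / (g t * g t))) (at t)"
    using f(1) g(1) assms(3)[OF t] by (rule has_derivative_divide')
  show "(dird f (c *s \<xi>) t * g t - f t * dird g (c *s \<xi>) t) / (g t * g t) =
      c * ((dird f \<xi> t * g t - f t * dird g \<xi> t) / (g t * g t))" for c \<xi>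
    by (simp add: f(3) g(3) algebra_simps)
qed

lemma holomorphic_C4_local:
  assumes "\<And>t. t \<in> U \<Longrightarrow> \<exists>W h. open W \<and> t \<in> W \<and> W \<subseteq> U \<and> holomorphic_C4 W h \<and> (\<forall>s\<in>W. g s = h s)"
  shows "holomorphic_C4 U g"
proof (rule holomorphic_C4I)
  fix t assume "t \<in> U"
  then obtain W h where W: "open W" "t \<in> W" "holomorphic_C4 W h" "\<And>s. s \<in> W \<Longrightarrow> g s = h s"
    using assms[OF \<open>t \<in> U\<close>] by blast
  have "(g has_derivative frechet_derivative h (at t)) (at t)"
    using holomorphic_C4D(1)[OF W(3,2)] W(1,2)
    by (rule has_derivative_transform_within_open) (simp add: W(4))
  then show "\<exists>D. (g has_derivative D) (at t) \<and> (\<forall>c \<xi>. D (c *s \<xi>) = c * D \<xi>)"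
    using holomorphic_C4D(3)[OF W(3,2)] by blast
qed

section \<open>Cauchy's formula along a direction and its consequences\<close>

definition circ :: "real \<Rightarrow> real \<Rightarrow> complex" where
  "circ r s = of_real r * exp (2 * of_real pi * \<i> * of_real s)"

lemma circ_simps: "norm (circ r s) = \<bar>r\<bar>" "circ r s = 0 \<longleftrightarrow> r = 0"
  by (simp_all add: circ_def norm_mult)

lemma continuous_on_circ [continuous_intros]: "continuous_on S f \<Longrightarrow> continuous_on S (\<lambda>x. circ r (f x))"
  unfolding circ_def by (intro continuous_intros)

text \<open>Cauchy's formula for the derivative at 0 of the one-variable function
  \<open>\<lambda>z. g (t + z *s \<xi>)\<close>. The contour integral is rewritten over the fixed
  interval from 0 to 1, so that \<open>t\<close> can vary under the integral sign.\<close>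

lemma dird_cauchy:
  assumes "open U" "holomorphic_C4 U g" "0 < r" "\<And>z. norm z \<le> r \<Longrightarrow> t + z *s \<xi> \<in> U"
  shows "dird g \<xi> t = integral {0..1} (\<lambda>s. g (t + circ r s *s \<xi>) / circ r s)"
proof -
  define f where "f = (\<lambda>z. g (t + z *s \<xi>))"
  have aff: "((\<lambda>z. t + z *s \<xi>) has_derivative (\<lambda>h. h *s \<xi>)) (at z)" for z
    using has_derivative_add[OF has_derivative_const[of t] bounded_linear_imp_has_derivative[OF bounded_linear_scalar_mult_left]]
    by simp
  have f': "(f has_field_derivative dird g \<xi> (t + z *s \<xi>)) (at z)" if "norm z \<le> r" for z
  proof -
    have "(f has_derivative (\<lambda>h. dird g (h *s \<xi>) (t + z *s \<xi>))) (at z)"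
      unfolding f_def
      using has_derivative_compose[OF aff holomorphic_C4D(1)[OF assms(2) assms(4)[OF that]]] by simp
    then show ?thesis
      unfolding has_field_derivative_def
      by (rule has_derivative_eq_rhs)
         (auto simp: holomorphic_C4D(3)[OF assms(2) assms(4)[OF that]] mult.commute)
  qed
  have cont: "continuous_on (cball 0 r) f"
    by (intro continuous_at_imp_continuous_on ballI) (auto intro: DERIV_isCont f')
  have hol: "f holomorphic_on ball 0 r"
  proof (rule holomorphic_onI)
    fix z assume "z \<in> ball (0::complex) r"
    then show "f field_differentiable at z within ball 0 r"
      using f'[of z] unfolding field_differentiable_def by (auto intro: has_field_derivative_at_within)
  qed
  have "(f has_field_derivative (1 / (2 * of_real pi * \<i>) * contour_integral (circlepath 0 r) (\<lambda>u. f u / (u - 0)\<^sup>2))) (at 0)"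
    by (rule Cauchy_derivative_integral_circlepath[OF cont hol]) (use assms(3) in simp)
  with f'[of 0] assms(3) have "dird g \<xi> t = 1 / (2 * of_real pi * \<i>) * contour_integral (circlepath 0 r) (\<lambda>u. f u / u\<^sup>2)"
    by (auto dest: DERIV_unique)
  \<comment> \<open>The velocity of the circle is \<open>2 * of_real pi * \<i> * circ r s\<close>,
    which cancels one of the two powers of \<open>circ r s\<close> in the denominator.\<close>
  also have "contour_integral (circlepath 0 r) (\<lambda>u. f u / u\<^sup>2) =
      integral {0..1} (\<lambda>s. (2 * of_real pi * \<i>) * (f (circ r s) / circ r s))"
    unfolding contour_integral_integral
  proof (rule integral_cong)
    fix s :: real
    show "f (circlepath 0 r s) / (circlepath 0 r s)\<^sup>2 * vector_derivative (circlepath 0 r) (at s) =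
       2 * of_real pi * \<i> * (f (circ r s) / circ r s)"
    proof -
      have "circlepath 0 r s = circ r s" by (simp add: circlepath circ_def mult_ac)
      moreover have "vector_derivative (circlepath 0 r) (at s) = 2 * of_real pi * \<i> * circ r s"
        by (simp add: vector_derivative_circlepath circ_def mult_ac)
      ultimately show ?thesis using assms(3) by (simp add: power2_eq_square circ_simps)
    qed
  qed
  also have "\<dots> = 2 * of_real pi * \<i> * integral {0..1} (\<lambda>s. f (circ r s) / circ r s)"
    by (rule integral_mult_right)
  finally show ?thesis by (simp add: f_def)
qed

lemma circ_shift_in:
  assumes "open U" "t0 \<in> U"
  obtains \<delta> r where "0 < \<delta>" "0 < r" "ball t0 \<delta> \<subseteq> U"
    "\<And>t z. t \<in> ball t0 \<delta> \<Longrightarrow> norm z \<le> r \<Longrightarrow> t + z *s (\<xi> :: complex ^ 4) \<in> U"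
proof -
  obtain \<rho> where \<rho>: "0 < \<rho>" "ball t0 \<rho> \<subseteq> U" using assms open_contains_ball by blast
  \<comment> \<open>The summand 1 covers the direction \<open>\<xi> = 0\<close>.\<close>
  define r where "r = \<rho> / (2 * (norm \<xi> + 1))"
  have pos: "0 < norm \<xi> + 1" by (smt (verit) norm_ge_zero)
  then have r: "0 < r" "r * norm \<xi> < \<rho> / 2"
    using \<rho>(1) by (auto simp: r_def field_simps)
  show ?thesis
  proof (rule that[of "\<rho> / 2" r])
    show "0 < \<rho> / 2" "0 < r" "ball t0 (\<rho> / 2) \<subseteq> U" using \<rho> r by auto
    fix t and z :: complex assume *: "t \<in> ball t0 (\<rho> / 2)" "norm z \<le> r"
    have "norm (z *s \<xi>) \<le> r * norm \<xi>"
      unfolding norm_scalar_mult_vec using *(2) by (intro mult_right_mono) auto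
    then have "dist t0 (t + z *s \<xi>) < \<rho>"
      using * r(2) dist_triangle[of t0 "t + z *s \<xi>" t] by (auto simp: dist_norm)
    then show "t + z *s \<xi> \<in> U" using \<rho>(2) by auto
  qed
qed

lemma continuous_on_scalar_mult:
  fixes f :: "'a::topological_space \<Rightarrow> complex" and g :: "'a \<Rightarrow> complex ^ 'n"
  assumes "continuous_on S f" "continuous_on S g"
  shows "continuous_on S (\<lambda>x. f x *s g x)"
  unfolding vector_scalar_mult_def using assms by (intro continuous_intros)

lemma continuous_on_shift:
  assumes "continuous_on U h" "0 < r" "\<And>t z. t \<in> S \<Longrightarrow> norm z \<le> r \<Longrightarrow> t + z *s \<xi> \<in> U"
  shows "continuous_on (S \<times> cbox 0 1) (\<lambda>(t :: complex ^ 4, s). (h (t + circ r s *s \<xi>) :: complex) / circ r s)"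
proof -
  have "continuous_on (S \<times> cbox 0 1) (\<lambda>p. fst p + circ r (snd p) *s \<xi>)"
    by (intro continuous_intros continuous_on_scalar_mult)
  note cont = this
  have in_U: "fst p + circ r (snd p) *s \<xi> \<in> U" if "p \<in> S \<times> cbox 0 1" for p
    using assms(2,3) that by (auto simp: circ_simps)
  have "continuous_on (S \<times> cbox 0 1) (\<lambda>p. h (fst p + circ r (snd p) *s \<xi>))"
    by (rule continuous_on_compose2[OF assms(1) cont]) (use in_U in blast)
  then have "continuous_on (S \<times> cbox 0 1) (\<lambda>p. h (fst p + circ r (snd p) *s \<xi>) / circ r (snd p))"
    using assms(2) by (intro continuous_intros) (auto simp: circ_simps)
  then show ?thesis by (simp add: case_prod_beta')
qed

lemma continuous_on_slice:
  assumes "continuous_on (S \<times> T) (\<lambda>(t, s). F t s)" "t \<in> S"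
  shows "continuous_on T (\<lambda>s. F t s)"
proof -
  have "continuous_on T (\<lambda>s. case (t, s) of (t, s) \<Rightarrow> F t s)"
    by (rule continuous_on_compose2[OF assms(1)]) (use assms(2) in \<open>auto intro: continuous_on_Pair\<close>)
  then show ?thesis by simp
qed

text \<open>Holomorphy was defined by differentiability at each point, without continuity of the
  derivative. The latter follows because the Cauchy integral depends continuously on its
  centre.\<close>

lemma continuous_on_dird:
  assumes "open U" "holomorphic_C4 U g"
  shows "continuous_on U (dird g \<xi>)"
proof -
  have "continuous (at t0) (dird g \<xi>)" if t0: "t0 \<in> U" for t0
  proof -
    obtain \<delta> r where *: "0 < \<delta>" "0 < r" "ball t0 \<delta> \<subseteq> U"
      "\<And>t z. t \<in> ball t0 \<delta> \<Longrightarrow> norm z \<le> r \<Longrightarrow> t + z *s \<xi> \<in> U"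
      using circ_shift_in[OF assms(1) t0] by blast
    have "continuous_on (ball t0 \<delta>) (\<lambda>t. integral (cbox 0 1) (\<lambda>s. g (t + circ r s *s \<xi>) / circ r s))"
      by (intro integral_continuous_on_param continuous_on_shift[OF holomorphic_C4_continuous_on[OF assms(2)]] *) auto
    then have "continuous_on (ball t0 \<delta>) (dird g \<xi>)"
      by (rule continuous_on_eq) (use dird_cauchy[OF assms *(2,4)] in simp)
    then show ?thesis using *(1) by (simp add: continuous_on_eq_continuous_at)
  qed
  then show ?thesis by (simp add: continuous_at_imp_continuous_on)
qed

text \<open>Differentiation under the Cauchy integral. Leibniz's rule needs the derivative of the
  integrand to be jointly continuous, which \<open>continuous_on_dird\<close> supplies.\<close>

lemma dird_has_derivative_integral:
  assumes "open U" "holomorphic_C4 U g" "0 < \<delta>" "0 < r"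
    "\<And>t z. t \<in> ball t0 \<delta> \<Longrightarrow> norm z \<le> r \<Longrightarrow> t + z *s \<xi> \<in> U"
  shows "(dird g \<xi> has_derivative (\<lambda>\<eta>. integral {0..1} (\<lambda>s. dird g \<eta> (t0 + circ r s *s \<xi>) / circ r s))) (at t0)"
proof -
  define F where "F = (\<lambda>t s. Blinfun (\<lambda>\<eta>. dird g \<eta> (t + circ r s *s \<xi>) / circ r s))"
  have in_U: "t + circ r s *s \<xi> \<in> U" if "t \<in> ball t0 \<delta>" for t s
    using assms(4,5) that by (simp add: circ_simps)
  have F: "blinfun_apply (F t s) \<eta> = dird g \<eta> (t + circ r s *s \<xi>) / circ r s" if "t \<in> ball t0 \<delta>" for t s \<eta>
    unfolding F_def
    by (subst bounded_linear_Blinfun_apply)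
       (auto intro!: bounded_linear_divide[THEN bounded_linear_compose] has_derivative_bounded_linear[OF holomorphic_C4D(1)[OF assms(2) in_U[OF that]]])
  have "((\<lambda>t. integral (cbox 0 1) (\<lambda>s. g (t + circ r s *s \<xi>) / circ r s)) has_derivative
      blinfun_apply (integral (cbox 0 1) (F t0))) (at t0 within ball t0 \<delta>)"
  proof (rule leibniz_rule)
    show "((\<lambda>t. g (t + circ r s *s \<xi>) / circ r s) has_derivative blinfun_apply (F t s)) (at t within ball t0 \<delta>)"
      if t: "t \<in> ball t0 \<delta>" for t s
    proof -
      have "((\<lambda>t. g (t + circ r s *s \<xi>)) has_derivative (\<lambda>\<eta>. dird g \<eta> (t + circ r s *s \<xi>))) (at t)"
        by (rule has_derivative_compose[where f = "\<lambda>t. t + circ r s *s \<xi>", OF _ holomorphic_C4D(1)[OF assms(2) in_U[OF t]]])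
           (auto intro!: derivative_eq_intros)
      then have "((\<lambda>t. g (t + circ r s *s \<xi>) / circ r s) has_derivative (\<lambda>\<eta>. dird g \<eta> (t + circ r s *s \<xi>) / circ r s)) (at t)"
        by (rule bounded_linear.has_derivative[OF bounded_linear_divide])
      moreover have "(\<lambda>\<eta>. dird g \<eta> (t + circ r s *s \<xi>) / circ r s) = blinfun_apply (F t s)"
        by (simp add: F[OF t] fun_eq_iff)
      ultimately show ?thesis by (simp add: has_derivative_at_withinI)
    qed
    have cont: "continuous_on (ball t0 \<delta> \<times> cbox 0 1) (\<lambda>(t, s). h (t + circ r s *s \<xi>) / circ r s)"
      if "continuous_on U h" for h :: "complex ^ 4 \<Rightarrow> complex"
      by (rule continuous_on_shift[OF that assms(4,5)])
    show "(\<lambda>s. g (t + circ r s *s \<xi>) / circ r s) integrable_on cbox 0 1" if "t \<in> ball t0 \<delta>" for t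
      by (intro integrable_continuous continuous_on_slice[OF cont[OF holomorphic_C4_continuous_on[OF assms(2)]] that])
    show "continuous_on (ball t0 \<delta> \<times> cbox 0 1) (\<lambda>(t, s). F t s)"
    proof (rule continuous_on_blinfun_componentwise)
      fix \<eta> :: "complex ^ 4"
      show "continuous_on (ball t0 \<delta> \<times> cbox 0 1) (\<lambda>x. blinfun_apply (case x of (t, s) \<Rightarrow> F t s) \<eta>)"
        by (rule continuous_on_eq[OF cont[OF continuous_on_dird[OF assms(1,2), of \<eta>]]]) (auto simp: F)
    qed
  qed (use assms(3) in auto)
  moreover have "blinfun_apply (integral (cbox 0 1) (F t0)) = (\<lambda>\<eta>. integral {0..1} (\<lambda>s. dird g \<eta> (t0 + circ r s *s \<xi>) / circ r s))"
  proof
    fix \<eta>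
    have "F t0 integrable_on cbox 0 1"
    proof (rule integrable_continuous, rule continuous_on_blinfun_componentwise)
      fix \<eta> :: "complex ^ 4"
      have "continuous_on (cbox 0 1) (\<lambda>s. dird g \<eta> (t0 + circ r s *s \<xi>) / circ r s)"
        using continuous_on_slice[OF continuous_on_shift[where S = "ball t0 \<delta>" and \<xi> = \<xi> and U = U, OF continuous_on_dird[OF assms(1,2)] assms(4,5)], where t = t0] assms(3)
        by simp
      then show "continuous_on (cbox 0 1) (\<lambda>x. blinfun_apply (F t0 x) \<eta>)"
        using F assms(3) by simp
    qed
    then show "blinfun_apply (integral (cbox 0 1) (F t0)) \<eta> = integral {0..1} (\<lambda>s. dird g \<eta> (t0 + circ r s *s \<xi>) / circ r s)"
      using F assms(3) by (simp add: blinfun_apply_integral)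
  qed
  ultimately have "((\<lambda>t. integral (cbox 0 1) (\<lambda>s. g (t + circ r s *s \<xi>) / circ r s)) has_derivative
      (\<lambda>\<eta>. integral {0..1} (\<lambda>s. dird g \<eta> (t0 + circ r s *s \<xi>) / circ r s))) (at t0)"
    using assms(3) by (simp add: at_within_open[of t0 "ball t0 \<delta>"])
  then show ?thesis
    by (rule has_derivative_transform_within_open[of _ _ _ _ "ball t0 \<delta>"])
       (use assms(3) dird_cauchy[OF assms(1,2,4,5)] in auto)
qed

text \<open>Osgood's lemma: complex differentiability at every point implies holomorphic derivatives.\<close>

lemma holomorphic_C4_dird:
  assumes "open U" "holomorphic_C4 U g"
  shows "holomorphic_C4 U (dird g \<xi>)"
proof (rule holomorphic_C4I)
  fix t0 assume t0: "t0 \<in> U"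
  obtain \<delta> r where *: "0 < \<delta>" "0 < r" "ball t0 \<delta> \<subseteq> U"
    "\<And>t z. t \<in> ball t0 \<delta> \<Longrightarrow> norm z \<le> r \<Longrightarrow> t + z *s \<xi> \<in> U"
    using circ_shift_in[OF assms(1) t0] by blast
  have "dird g (c *s \<eta>) (t0 + circ r s *s \<xi>) = c * dird g \<eta> (t0 + circ r s *s \<xi>)" for c \<eta> s
    by (intro holomorphic_C4D[OF assms(2)] *(4)) (use * in \<open>auto simp: circ_simps\<close>)
  then show "\<exists>D. (dird g \<xi> has_derivative D) (at t0) \<and> (\<forall>c \<eta>. D (c *s \<eta>) = c * D \<eta>)"
    using dird_has_derivative_integral[OF assms *(1,2,4)]
    by (intro exI conjI) (auto simp flip: times_divide_eq_right)
qed

text \<open>One and the same integral is the derivative of \<open>dird g \<xi>\<close> along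
  \<open>\<eta>\<close>, by differentiation under the integral sign, and that of
  \<open>dird g \<eta>\<close> along \<open>\<xi>\<close>, by Cauchy's formula.\<close>

lemma dird_commute:
  assumes "open U" "holomorphic_C4 U g" "t0 \<in> U"
  shows "dird (dird g \<xi>) \<eta> t0 = dird (dird g \<eta>) \<xi> t0"
proof -
  obtain \<delta> r where *: "0 < \<delta>" "0 < r" "ball t0 \<delta> \<subseteq> U"
    "\<And>t z. t \<in> ball t0 \<delta> \<Longrightarrow> norm z \<le> r \<Longrightarrow> t + z *s \<xi> \<in> U"
    using circ_shift_in[OF assms(1,3)] by blast
  have "dird (dird g \<xi>) \<eta> t0 = integral {0..1} (\<lambda>s. dird g \<eta> (t0 + circ r s *s \<xi>) / circ r s)"
    by (rule dird_eq[OF dird_has_derivative_integral[OF assms(1,2) *(1,2,4)]])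
  also have "\<dots> = dird (dird g \<eta>) \<xi> t0"
    by (rule dird_cauchy[OF assms(1) holomorphic_C4_dird[OF assms(1,2)] *(2), symmetric])
       (use * in auto)
  finally show ?thesis .
qed

section \<open>Holomorphic maps with values in a vector space\<close>

definition holomorphic_vec :: "(complex ^ 4) set \<Rightarrow> (complex ^ 4 \<Rightarrow> complex ^ 'n) \<Rightarrow> bool" where
  "holomorphic_vec U e \<longleftrightarrow> (\<forall>i. holomorphic_C4 U (\<lambda>t. e t $ i))"

lemma holomorphic_vec_has_derivative:
  assumes "holomorphic_vec U e" "t \<in> U"
  shows "(e has_derivative frechet_derivative e (at t)) (at t)"
    "dird e \<xi> t $ i = dird (\<lambda>t. e t $ i) \<xi> t"
proof -
  have "((\<lambda>t. \<Sum>i\<in>UNIV. e t $ i *s axis i 1) has_derivative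
      (\<lambda>\<xi>. \<Sum>i\<in>UNIV. dird (\<lambda>t. e t $ i) \<xi> t *s axis i 1)) (at t)"
    using assms unfolding holomorphic_vec_def
    by (intro has_derivative_sum bounded_linear.has_derivative[OF bounded_linear_scalar_mult_left] holomorphic_C4D(1)[where U = U]) auto
  then have D: "(e has_derivative (\<lambda>\<xi>. \<chi> i. dird (\<lambda>t. e t $ i) \<xi> t)) (at t)"
    using basis_expansion[of "\<chi> i. dird (\<lambda>t. e t $ i) _ t"] by (simp add: basis_expansion)
  then have "frechet_derivative e (at t) = (\<lambda>\<xi>. \<chi> i. dird (\<lambda>t. e t $ i) \<xi> t)"
    using frechet_derivative_at by metis
  with D show "(e has_derivative frechet_derivative e (at t)) (at t)"
    "dird e \<xi> t $ i = dird (\<lambda>t. e t $ i) \<xi> t" by simp_all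
qed

lemma dird_vec_linear:
  assumes "holomorphic_vec U e" "t \<in> U"
  shows "dird e (\<xi> + \<eta>) t = dird e \<xi> t + dird e \<eta> t" "dird e (c *s \<xi>) t = c *s dird e \<xi> t"
proof -
  have *: "holomorphic_C4 U (\<lambda>t. e t $ i)" for i using assms unfolding holomorphic_vec_def by blast
  show "dird e (\<xi> + \<eta>) t = dird e \<xi> t + dird e \<eta> t" "dird e (c *s \<xi>) t = c *s dird e \<xi> t"
    by (simp_all add: vec_eq_iff holomorphic_vec_has_derivative(2)[OF assms] holomorphic_C4D(2,3)[OF * assms(2)])
qed

lemma holomorphic_vec_dird:
  assumes "open U" "holomorphic_vec U e"
  shows "holomorphic_vec U (dird e \<xi>)"
  unfolding holomorphic_vec_def
proof
  fix i
  have "holomorphic_C4 U (dird (\<lambda>t. e t $ i) \<xi>)"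
    using assms unfolding holomorphic_vec_def by (intro holomorphic_C4_dird) auto
  then show "holomorphic_C4 U (\<lambda>t. dird e \<xi> t $ i)"
    by (intro holomorphic_C4_local exI[of _ U] exI[of _ "dird (\<lambda>t. e t $ i) \<xi>"])
       (auto simp: assms holomorphic_vec_has_derivative(2)[OF assms(2)])
qed

lemma dird_vec_commute:
  assumes "open U" "holomorphic_vec U e" "t \<in> U"
  shows "dird (dird e \<xi>) \<eta> t = dird (dird e \<eta>) \<xi> t"
proof -
  have *: "dird (dird e \<xi>) \<eta> t $ i = dird (dird (\<lambda>t. e t $ i) \<xi>) \<eta> t" for i \<xi> \<eta>
  proof -
    have hol: "holomorphic_C4 U (dird (\<lambda>t. e t $ i) \<xi>)"
      using assms(1,2) unfolding holomorphic_vec_def by (intro holomorphic_C4_dird) auto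
    have "((\<lambda>t. dird e \<xi> t $ i) has_derivative frechet_derivative (dird (\<lambda>t. e t $ i) \<xi>) (at t)) (at t)"
      using holomorphic_C4D(1)[OF hol assms(3)] assms(1,3)
      by (rule has_derivative_transform_within_open) (simp add: holomorphic_vec_has_derivative(2)[OF assms(2)])
    then show ?thesis
      unfolding holomorphic_vec_has_derivative(2)[OF holomorphic_vec_dird[OF assms(1,2)] assms(3)]
      by (rule dird_eq)
  qed
  have "holomorphic_C4 U (\<lambda>t. e t $ i)" for i using assms(2) unfolding holomorphic_vec_def by blast
  then show ?thesis by (simp add: vec_eq_iff * dird_commute[OF assms(1) _ assms(3)])
qed

lemma holomorphic_vec_const: "holomorphic_vec U (\<lambda>t. v)"
  unfolding holomorphic_vec_def by (simp add: holomorphic_C4_const)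

lemma holomorphic_vec_add:
  "holomorphic_vec U e \<Longrightarrow> holomorphic_vec U f \<Longrightarrow> holomorphic_vec U (\<lambda>t. e t + f t)"
  unfolding holomorphic_vec_def by (simp add: holomorphic_C4_add)

lemma holomorphic_vec_scale: "holomorphic_C4 U g \<Longrightarrow> holomorphic_vec U f \<Longrightarrow> holomorphic_vec U (\<lambda>t. g t *s f t)"
  unfolding holomorphic_vec_def by (simp add: holomorphic_C4_mult)

section \<open>Determinants and residues\<close>

lemma exhaust_6:
  fixes x :: 6
  shows "x = 1 \<or> x = 2 \<or> x = 3 \<or> x = 4 \<or> x = 5 \<or> x = 6"
proof (induct x)
  case (of_int z)
  then have "z = 0 \<or> z = 1 \<or> z = 2 \<or> z = 3 \<or> z = 4 \<or> z = 5" by auto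
  then show ?case by auto
qed

lemma forall_6: "(\<forall>i::6. Q i) \<longleftrightarrow> Q 1 \<and> Q 2 \<and> Q 3 \<and> Q 4 \<and> Q 5 \<and> Q 6"
  by (metis exhaust_6)

lemma UNIV_6: "UNIV = {1, 2, 3, 4, 5, 6 :: 6}"
  using exhaust_6 by auto

lemma sum_6: "sum f (UNIV :: 6 set) = f 1 + f 2 + f 3 + f 4 + f 5 + f 6"
  unfolding UNIV_6 by (simp add: ac_simps)

lemma vector_6 [simp]:
  "(vector [a, b, c, d, p, q] :: 'a::zero ^ 6) $ 1 = a"
  "(vector [a, b, c, d, p, q] :: 'a::zero ^ 6) $ 2 = b"
  "(vector [a, b, c, d, p, q] :: 'a::zero ^ 6) $ 3 = c"
  "(vector [a, b, c, d, p, q] :: 'a::zero ^ 6) $ 4 = d"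
  "(vector [a, b, c, d, p, q] :: 'a::zero ^ 6) $ 5 = p"
  "(vector [a, b, c, d, p, q] :: 'a::zero ^ 6) $ 6 = q"
  unfolding vector_def by simp_all

text \<open>The exterior product of six vectors, with det V trivialized by the standard basis;
  \<open>K_form e f u v\<close> is its value on \<open>e\<close>, \<open>f\<close>,
  \<open>u e\<close>, \<open>u f\<close>, \<open>v e\<close>, \<open>v f\<close>.\<close>

definition D6 :: "V \<Rightarrow> V \<Rightarrow> V \<Rightarrow> V \<Rightarrow> V \<Rightarrow> V \<Rightarrow> complex" where
  "D6 a b c d p q = det (vector [a, b, c, d, p, q] :: complex ^ 6 ^ 6)"

lemma vector_6_eq:
  fixes F :: "6 \<Rightarrow> 'a::zero"
  shows "vector [F 1, F 2, F 3, F 4, F 5, F 6] = (\<chi> i. F i)"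
  by (simp add: vec_eq_iff forall_6)

lemma D6_add:
  "D6 (x + y) b c d p q = D6 x b c d p q + D6 y b c d p q"
  "D6 a (x + y) c d p q = D6 a x c d p q + D6 a y c d p q"
  "D6 a b (x + y) d p q = D6 a b x d p q + D6 a b y d p q"
  "D6 a b c (x + y) p q = D6 a b c x p q + D6 a b c y p q"
  "D6 a b c d (x + y) q = D6 a b c d x q + D6 a b c d y q"
  "D6 a b c d p (x + y) = D6 a b c d p x + D6 a b c d p y"
  using det_row_add[of 1 "\<lambda>_. x" "\<lambda>_. y" "($) (vector [a, b, c, d, p, q])"]
    det_row_add[of 2 "\<lambda>_. x" "\<lambda>_. y" "($) (vector [a, b, c, d, p, q])"]
    det_row_add[of 3 "\<lambda>_. x" "\<lambda>_. y" "($) (vector [a, b, c, d, p, q])"]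
    det_row_add[of 4 "\<lambda>_. x" "\<lambda>_. y" "($) (vector [a, b, c, d, p, q])"]
    det_row_add[of 5 "\<lambda>_. x" "\<lambda>_. y" "($) (vector [a, b, c, d, p, q])"]
    det_row_add[of 6 "\<lambda>_. x" "\<lambda>_. y" "($) (vector [a, b, c, d, p, q])"]
  by (simp_all add: D6_def vector_6_eq[symmetric])

lemma D6_scale:
  "D6 (k *s x) b c d p q = k * D6 x b c d p q"
  "D6 a (k *s x) c d p q = k * D6 a x c d p q"
  "D6 a b (k *s x) d p q = k * D6 a b x d p q"
  "D6 a b c (k *s x) p q = k * D6 a b c x p q"
  "D6 a b c d (k *s x) q = k * D6 a b c d x q"
  "D6 a b c d p (k *s x) = k * D6 a b c d p x"
  using det_row_mul[of 1 k "\<lambda>_. x" "($) (vector [a, b, c, d, p, q])"]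
    det_row_mul[of 2 k "\<lambda>_. x" "($) (vector [a, b, c, d, p, q])"]
    det_row_mul[of 3 k "\<lambda>_. x" "($) (vector [a, b, c, d, p, q])"]
    det_row_mul[of 4 k "\<lambda>_. x" "($) (vector [a, b, c, d, p, q])"]
    det_row_mul[of 5 k "\<lambda>_. x" "($) (vector [a, b, c, d, p, q])"]
    det_row_mul[of 6 k "\<lambda>_. x" "($) (vector [a, b, c, d, p, q])"]
  by (simp_all add: D6_def vector_6_eq[symmetric])

lemma D6_zero [simp]:
  "D6 0 b c d p q = 0" "D6 a 0 c d p q = 0" "D6 a b 0 d p q = 0"
  "D6 a b c 0 p q = 0" "D6 a b c d 0 q = 0" "D6 a b c d p 0 = 0"
  using D6_scale[where k = 0 and x = 0] by simp_all

lemma D6_same [simp]: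
  "D6 x x c d p q = 0" "D6 x b x d p q = 0" "D6 x b c x p q = 0" "D6 x b c d x q = 0" "D6 x b c d p x = 0"
  "D6 a x x d p q = 0" "D6 a x c x p q = 0" "D6 a x c d x q = 0" "D6 a x c d p x = 0"
  "D6 a b x x p q = 0" "D6 a b x d x q = 0" "D6 a b x d p x = 0"
  "D6 a b c x x q = 0" "D6 a b c x p x = 0" "D6 a b c d x x = 0"
proof -
  have *: "det A = 0" if "i \<noteq> j" "A $ i = A $ j" for A :: "complex ^ 6 ^ 6" and i j
    using det_identical_rows[OF that(1), of A] that(2) by (simp add: row_def)
  show
  "D6 x x c d p q = 0" "D6 x b x d p q = 0" "D6 x b c x p q = 0" "D6 x b c d x q = 0" "D6 x b c d p x = 0"
  "D6 a x x d p q = 0" "D6 a x c x p q = 0" "D6 a x c d x q = 0" "D6 a x c d p x = 0"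
  "D6 a b x x p q = 0" "D6 a b x d x q = 0" "D6 a b x d p x = 0"
  "D6 a b c x x q = 0" "D6 a b c x p x = 0" "D6 a b c d x x = 0"
    unfolding D6_def
    by (rule *[of 1 2] *[of 1 3] *[of 1 4] *[of 1 5] *[of 1 6] *[of 2 3] *[of 2 4] *[of 2 5] *[of 2 6]
        *[of 3 4] *[of 3 5] *[of 3 6] *[of 4 5] *[of 4 6] *[of 5 6]; simp; fail)+
qed

lemma D6_swap:
  "D6 y x c d p q = - D6 x y c d p q"
  "D6 a y x d p q = - D6 a x y d p q"
  "D6 a b y x p q = - D6 a b x y p q"
  "D6 a b c y x q = - D6 a b c x y q"
  "D6 a b c d y x = - D6 a b c d x y"
  using D6_same(1)[of "x + y"] D6_same(6)[of _ "x + y"] D6_same(10)[of _ _ "x + y"]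
    D6_same(13)[of _ _ _ "x + y"] D6_same(15)[of _ _ _ _ "x + y"]
  by (simp_all add: D6_add add_eq_0_iff del: D6_same) (simp_all add: D6_add)

lemma D6_pair:
  "D6 (k *s x + l *s y) (m *s x + n *s y) c d p q = (k * n - l * m) * D6 x y c d p q"
  "D6 a b (k *s x + l *s y) (m *s x + n *s y) p q = (k * n - l * m) * D6 a b x y p q"
  "D6 a b c d (k *s x + l *s y) (m *s x + n *s y) = (k * n - l * m) * D6 a b c d x y"
  using D6_swap(1)[of y x] D6_swap(3)[of _ _ y x] D6_swap(5)[of _ _ _ _ y x]
  by (simp_all add: D6_add D6_scale algebra_simps)

lemma D6_basis_span:
  assumes "D6 m1 m2 m3 m4 m5 m6 \<noteq> 0"
  shows "\<exists>c1 c2 c3 c4 c5 c6. y = c1 *s m1 + c2 *s m2 + c3 *s m3 + c4 *s m4 + c5 *s m5 + c6 *s m6"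
proof -
  define M where "M = (vector [m1, m2, m3, m4, m5, m6] :: complex ^ 6 ^ 6)"
  have "invertible M" using assms unfolding invertible_det_nz M_def D6_def .
  then obtain N where N: "N ** M = mat 1" unfolding invertible_def by blast
  define c where "c = y v* N"
  have "c v* M = y" unfolding c_def vector_matrix_mul_assoc N by simp
  moreover have "c v* M = (\<Sum>i\<in>UNIV. c $ i *s M $ i)"
    by (simp add: vec_eq_iff vector_matrix_mult_def mult.commute)
  ultimately have "y = c $ 1 *s m1 + c $ 2 *s m2 + c $ 3 *s m3 + c $ 4 *s m4 + c $ 5 *s m5 + c $ 6 *s m6"
    by (simp add: sum_6 M_def)
  then show ?thesis by blast
qed

lemma D6_nonzero_iff_independent:
  assumes "vec.independent B" "B = {m1, m2, m3, m4, m5, m6}" "card B = 6"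
  shows "D6 m1 m2 m3 m4 m5 m6 \<noteq> 0"
proof -
  define M where "M = (vector [m1, m2, m3, m4, m5, m6] :: complex ^ 6 ^ 6)"
  have d: "distinct [m1, m2, m3, m4, m5, m6]"
    using assms(2,3) by (intro card_distinct) simp
  have "\<forall>i. c i = 0" if "sum (\<lambda>i. c i *s row i M) UNIV = 0" for c
  proof -
    define g where "g = (\<lambda>v. if v = m1 then c 1 else if v = m2 then c 2 else if v = m3 then c 3 else
        if v = m4 then c 4 else if v = m5 then c 5 else c 6)"
    have "(\<Sum>v\<in>B. g v *s v) = 0"
    proof -
      have "g m1 = c 1" "g m2 = c 2" "g m3 = c 3" "g m4 = c 4" "g m5 = c 5" "g m6 = c 6"
        using d by (auto simp: g_def)
      moreover have "(\<Sum>v\<in>B. h v) = h m1 + h m2 + h m3 + h m4 + h m5 + h m6" for h :: "V \<Rightarrow> V"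
        using d unfolding assms(2) by (simp add: add.assoc)
      moreover have "row i M = M $ i" for i by (simp add: row_def)
      ultimately show ?thesis using that by (simp add: sum_6 M_def)
    qed
    moreover have "finite B" using assms(2) by simp
    ultimately have "\<forall>v\<in>B. g v = 0"
      using vec.independentD[OF assms(1) _ subset_refl] by blast
    then show ?thesis using d unfolding assms(2) forall_6 by (auto simp: g_def)
  qed
  then have "\<exists>N. M ** N = mat 1" unfolding matrix_right_invertible_independent_rows by blast
  then have "invertible M" by (simp add: invertible_right_inverse)
  then show ?thesis unfolding invertible_det_nz M_def D6_def .
qed

lemma cramer_6:
  assumes "D6 m1 m2 m3 m4 m5 m6 \<noteq> 0"
  shows "y = (D6 y m2 m3 m4 m5 m6 / D6 m1 m2 m3 m4 m5 m6) *s m1 + (D6 m1 y m3 m4 m5 m6 / D6 m1 m2 m3 m4 m5 m6) *s m2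
    + (D6 m1 m2 y m4 m5 m6 / D6 m1 m2 m3 m4 m5 m6) *s m3 + (D6 m1 m2 m3 y m5 m6 / D6 m1 m2 m3 m4 m5 m6) *s m4
    + (D6 m1 m2 m3 m4 y m6 / D6 m1 m2 m3 m4 m5 m6) *s m5 + (D6 m1 m2 m3 m4 m5 y / D6 m1 m2 m3 m4 m5 m6) *s m6"
proof -
  obtain c1 c2 c3 c4 c5 c6 where
    y: "y = c1 *s m1 + c2 *s m2 + c3 *s m3 + c4 *s m4 + c5 *s m5 + c6 *s m6"
    using D6_basis_span[OF assms] by metis
  show ?thesis using assms by (simp add: y D6_add D6_scale)
qed

text \<open>Binary quadratic forms are given by their coefficients. The quotient of \<open>det3\<close> by \<open>resultant2\<close> is the
  Grothendieck residue of \<open>G / (A B)\<close>: the functional on binary quadratic forms \<open>G\<close> that vanishes on \<open>A\<close> and \<open>B\<close>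
  and is the \<open>xy\<close>-coefficient of \<open>G\<close> for \<open>A = x\<^sup>2\<close>, \<open>B = y\<^sup>2\<close>.\<close>

definition det3 :: "complex \<Rightarrow> complex \<Rightarrow> complex \<Rightarrow> complex \<Rightarrow> complex \<Rightarrow> complex \<Rightarrow> complex \<Rightarrow> complex \<Rightarrow> complex \<Rightarrow> complex" where
  "det3 a0 a1 a2 g0 g1 g2 b0 b1 b2 =
     a0 * (g1 * b2 - g2 * b1) - a1 * (g0 * b2 - g2 * b0) + a2 * (g0 * b1 - g1 * b0)"

definition resultant2 :: "complex \<Rightarrow> complex \<Rightarrow> complex \<Rightarrow> complex \<Rightarrow> complex \<Rightarrow> complex \<Rightarrow> complex" where
  "resultant2 a0 a1 a2 b0 b1 b2 = (a0 * b2 - a2 * b0)\<^sup>2 - (a0 * b1 - a1 * b0) * (a1 * b2 - a2 * b1)"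

text \<open>Here \<open>A\<close>, \<open>B\<close>, \<open>G\<close> are \<open>P X X w\<close>, \<open>P X X w'\<close> and \<open>X \<mapsto> e \<and> f \<and> u X \<and> v X \<and> w \<and> w'\<close> for \<open>X = x e + y f\<close>.\<close>

definition frame_res :: "(V \<Rightarrow> V \<Rightarrow> V \<Rightarrow> complex) \<Rightarrow> V \<Rightarrow> V \<Rightarrow> V \<Rightarrow> V \<Rightarrow> complex" where
  "frame_res P e f w w' =
     resultant2 (P e e w) (2 * P e f w) (P f f w) (P e e w') (2 * P e f w') (P f f w')"

definition frame_num :: "(V \<Rightarrow> V \<Rightarrow> V \<Rightarrow> complex) \<Rightarrow> V \<Rightarrow> V \<Rightarrow> V \<Rightarrow> V \<Rightarrow> V \<Rightarrow> V \<Rightarrow> V \<Rightarrow> V \<Rightarrow> complex" where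
  "frame_num P e f w w' ue uf ve vf = det3 (P e e w) (2 * P e f w) (P f f w)
     (D6 e f ue ve w w') (D6 e f ue vf w w' + D6 e f uf ve w w') (D6 e f uf vf w w')
     (P e e w') (2 * P e f w') (P f f w')"

definition frame_form :: "(V \<Rightarrow> V \<Rightarrow> V \<Rightarrow> complex) \<Rightarrow> V \<Rightarrow> V \<Rightarrow> V \<Rightarrow> V \<Rightarrow> V \<Rightarrow> V \<Rightarrow> V \<Rightarrow> V \<Rightarrow> complex" where
  "frame_form P e f w w' ue uf ve vf = frame_num P e f w w' ue uf ve vf / frame_res P e f w w'"

section \<open>Changes of basis of the line and of the pair \<open>(w, w')\<close>\<close>

text \<open>A substitution of determinant \<open>k * n - l * m\<close> acts on the three-dimensional
  space of binary quadratic forms with the cube of that determinant, and the resultant of two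
  quadratic forms has weight four.\<close>

lemma det3_substitution:
  fixes k l m n :: complex
  defines "q0 \<equiv> \<lambda>a0 a1 a2. a0 * k\<^sup>2 + a1 * k * l + a2 * l\<^sup>2"
    and "q1 \<equiv> \<lambda>a0 a1 a2. 2 * a0 * k * m + a1 * (k * n + l * m) + 2 * a2 * l * n"
    and "q2 \<equiv> \<lambda>a0 a1 a2. a0 * m\<^sup>2 + a1 * m * n + a2 * n\<^sup>2"
  shows "det3 (q0 a0 a1 a2) (q1 a0 a1 a2) (q2 a0 a1 a2) (q0 g0 g1 g2) (q1 g0 g1 g2) (q2 g0 g1 g2)
      (q0 b0 b1 b2) (q1 b0 b1 b2) (q2 b0 b1 b2) = (k * n - l * m) ^ 3 * det3 a0 a1 a2 g0 g1 g2 b0 b1 b2"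
    and "resultant2 (q0 a0 a1 a2) (q1 a0 a1 a2) (q2 a0 a1 a2) (q0 b0 b1 b2) (q1 b0 b1 b2) (q2 b0 b1 b2)
      = (k * n - l * m) ^ 4 * resultant2 a0 a1 a2 b0 b1 b2"
  unfolding det3_def resultant2_def q0_def q1_def q2_def by algebra+

lemma cubic_pairs:
  assumes "cubic P"
  shows "P (k *s e + l *s f) (k *s e + l *s f) y = P e e y * k\<^sup>2 + 2 * P e f y * k * l + P f f y * l\<^sup>2"
    "2 * P (k *s e + l *s f) (m *s e + n *s f) y =
      2 * P e e y * k * m + 2 * P e f y * (k * n + l * m) + 2 * P f f y * l * n"
  using cubicD(1)[OF assms, of f e]
  by (simp_all add: cubicD(3,4)[OF assms] cubic_linear[OF assms] power2_eq_square algebra_simps)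

lemma frame_res_change_frame:
  assumes "cubic P"
  shows "frame_res P (k *s e + l *s f) (m *s e + n *s f) w w' = (k * n - l * m) ^ 4 * frame_res P e f w w'"
  unfolding frame_res_def cubic_pairs[OF assms] det3_substitution(2) ..

text \<open>Three factors come from \<open>det3\<close> and one from the wedge of \<open>e\<close>
  and \<open>f\<close> in every coefficient of G. The total weight four is that of the resultant,
  which is why the quotient is invariant.\<close>

lemma frame_num_change_frame:
  assumes "cubic P"
  shows "frame_num P (k *s e + l *s f) (m *s e + n *s f) w w'
      (k *s ue + l *s uf) (m *s ue + n *s uf) (k *s ve + l *s vf) (m *s ve + n *s vf)
    = (k * n - l * m) ^ 4 * frame_num P e f w w' ue uf ve vf"
proof -
  define g0 g1 g2 where "g0 = D6 e f ue ve w w'" and "g1 = D6 e f ue vf w w' + D6 e f uf ve w w'"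
    and "g2 = D6 e f uf vf w w'"
  have G0: "D6 (k *s e + l *s f) (m *s e + n *s f) (k *s ue + l *s uf) (k *s ve + l *s vf) w w' =
      (k * n - l * m) * (g0 * k\<^sup>2 + g1 * k * l + g2 * l\<^sup>2)"
    unfolding D6_pair(1) by (simp add: D6_add D6_scale g0_def g1_def g2_def power2_eq_square algebra_simps)
  have G1: "D6 (k *s e + l *s f) (m *s e + n *s f) (k *s ue + l *s uf) (m *s ve + n *s vf) w w' +
      D6 (k *s e + l *s f) (m *s e + n *s f) (m *s ue + n *s uf) (k *s ve + l *s vf) w w' =
      (k * n - l * m) * (2 * g0 * k * m + g1 * (k * n + l * m) + 2 * g2 * l * n)"
    unfolding D6_pair(1) by (simp add: D6_add D6_scale g0_def g1_def g2_def algebra_simps)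
  have G2: "D6 (k *s e + l *s f) (m *s e + n *s f) (m *s ue + n *s uf) (m *s ve + n *s vf) w w' =
      (k * n - l * m) * (g0 * m\<^sup>2 + g1 * m * n + g2 * n\<^sup>2)"
    unfolding D6_pair(1) by (simp add: D6_add D6_scale g0_def g1_def g2_def power2_eq_square algebra_simps)
  have hom: "det3 a0 a1 a2 (d * g0) (d * g1) (d * g2) b0 b1 b2 = d * det3 a0 a1 a2 g0 g1 g2 b0 b1 b2"
    for a0 a1 a2 g0 g1 g2 b0 b1 b2 d by (simp add: det3_def algebra_simps)
  show ?thesis
    unfolding frame_num_def G0 G1 G2 cubic_pairs[OF assms] hom det3_substitution(1)
    by (simp add: g0_def g1_def g2_def power4_eq_xxxx power3_eq_cube)
qed

lemma frame_form_change_frame: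
  assumes "cubic P" "k * n - l * m \<noteq> 0"
  shows "frame_form P (k *s e + l *s f) (m *s e + n *s f) w w'
      (k *s ue + l *s uf) (m *s ue + n *s uf) (k *s ve + l *s vf) (m *s ve + n *s vf)
    = frame_form P e f w w' ue uf ve vf"
  unfolding frame_form_def frame_num_change_frame[OF assms(1)] frame_res_change_frame[OF assms(1)]
  using assms(2) by simp

text \<open>The resultant is quadratic in the Pluecker coordinates of the pair A, B. The numerator
  has the same weight: one factor from A, B and one from the wedge of \<open>w\<close> and
  \<open>w'\<close>.\<close>

lemma frame_res_change_pencil:
  assumes "cubic P"
  shows "frame_res P e f (k *s w + l *s w') (m *s w + n *s w') = (k * n - l * m)\<^sup>2 * frame_res P e f w w'"
  unfolding frame_res_def resultant2_def cubic_linear[OF assms] by algebra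

lemma frame_form_change_pencil:
  assumes "cubic P" "k * n - l * m \<noteq> 0"
  shows "frame_form P e f (k *s w + l *s w') (m *s w + n *s w') ue uf ve vf = frame_form P e f w w' ue uf ve vf"
proof -
  have "frame_num P e f (k *s w + l *s w') (m *s w + n *s w') ue uf ve vf =
      (k * n - l * m)\<^sup>2 * frame_num P e f w w' ue uf ve vf"
    unfolding frame_num_def det3_def D6_pair(3) cubic_linear[OF assms(1)] by algebra
  then show ?thesis unfolding frame_form_def frame_res_change_pencil[OF assms(1)] using assms(2) by simp
qed

text \<open>One factor for each of the three pairs \<open>e, f\<close>, \<open>u e, u f\<close> and
  \<open>v e, v f\<close>; this is the twist by O(3).\<close>

lemma K_form_change_frame:
  assumes "Vector_Spaces.linear (*s) (*s) u" "Vector_Spaces.linear (*s) (*s) v"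
  shows "K_form (k *s e + l *s f) (m *s e + n *s f) u v = (k * n - l * m) ^ 3 * K_form e f u v"
proof -
  interpret u: Vector_Spaces.linear "(*s)" "(*s)" u by fact
  interpret v: Vector_Spaces.linear "(*s)" "(*s)" v by fact
  show ?thesis
    unfolding K_form_def D6_def[symmetric] u.add u.scale v.add v.scale D6_pair by (simp add: power3_eq_cube)
qed

text \<open>The tangency relations leave \<open>P e f (u e)\<close> and \<open>P e f (u f)\<close>
  as the only free values of \<open>u\<close>, and likewise for \<open>v\<close>. Each of the three
  pairs of terms of \<open>omega\<close> then contributes four times the same 2 by 2
  determinant.\<close>

lemma omega_reduced:
  assumes "P e e (u f) = - 2 * P e f (u e)" "P f f (u e) = - 2 * P e f (u f)"
    "P e e (v f) = - 2 * P e f (v e)" "P f f (v e) = - 2 * P e f (v f)"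
  shows "omega P e f u v = 12 * (P e f (u e) * P e f (v f) - P e f (u f) * P e f (v e))"
  unfolding omega_def assms by algebra

section \<open>Adapted frames\<close>

lemma span_pair: "x \<in> vec.span {a, b} \<longleftrightarrow> (\<exists>k l. x = k *s a + l *s b)" for a b :: "'a::field ^ 'n"
proof
  assume "x \<in> vec.span {a, b}"
  then obtain k where "x - k *s a \<in> vec.span {b}" unfolding vec.span_insert by blast
  then obtain l where "x - k *s a = l *s b" unfolding vec.span_singleton by blast
  then have "x = k *s a + l *s b" by (simp add: algebra_simps)
  then show "\<exists>k l. x = k *s a + l *s b" by blast
next
  assume "\<exists>k l. x = k *s a + l *s b"
  moreover have "a \<in> vec.span {a, b}" "b \<in> vec.span {a, b}" by (simp_all add: vec.span_base)
  ultimately show "x \<in> vec.span {a, b}" by (auto intro: vec.span_add vec.span_scale)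
qed

text \<open>For \<open>X = k e + l f\<close> the value \<open>P X X (u X)\<close> is a binary cubic
  in \<open>k\<close>, \<open>l\<close>. Its four coefficients are the conditions on the right, and
  they are recovered from the values at (1,0), (0,1), (1,1) and (1,-1).\<close>

lemma tangent_fano_span:
  assumes "cubic P" "Vector_Spaces.linear (*s) (*s) u"
  shows "u \<in> tangent_fano P (vec.span {e, f}) \<longleftrightarrow>
    P e e (u e) = 0 \<and> P e e (u f) = - 2 * P e f (u e) \<and> P f f (u e) = - 2 * P e f (u f) \<and> P f f (u f) = 0"
    (is "?L \<longleftrightarrow> ?R")
proof -
  interpret u: Vector_Spaces.linear "(*s)" "(*s)" u by fact
  have ex: "P (k *s e + l *s f) (k *s e + l *s f) (u (k *s e + l *s f)) =
     k ^ 3 * P e e (u e) + k\<^sup>2 * l * (P e e (u f) + 2 * P e f (u e)) + k * l\<^sup>2 * (P f f (u e) + 2 * P e f (u f))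
     + l ^ 3 * P f f (u f)" for k l
    unfolding u.add u.scale cubic_linear(3,4)[OF assms(1)] unfolding cubic_pairs(1)[OF assms(1)] by algebra
  show ?thesis
  proof
    assume ?L
    then have *: "P (k *s e + l *s f) (k *s e + l *s f) (u (k *s e + l *s f)) = 0" for k l
      unfolding tangent_fano_def using span_pair by blast
    have "P e e (u e) = 0" "P f f (u f) = 0" using *[of 1 0] *[of 0 1] by (simp_all add: ex)
    moreover have "2 * (P e e (u f) + 2 * P e f (u e)) = P (1 *s e + 1 *s f) (1 *s e + 1 *s f) (u (1 *s e + 1 *s f))
        - P (1 *s e + (-1) *s f) (1 *s e + (-1) *s f) (u (1 *s e + (-1) *s f)) - 2 * P f f (u f)"
      "2 * (P f f (u e) + 2 * P e f (u f)) = P (1 *s e + 1 *s f) (1 *s e + 1 *s f) (u (1 *s e + 1 *s f))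
        + P (1 *s e + (-1) *s f) (1 *s e + (-1) *s f) (u (1 *s e + (-1) *s f)) - 2 * P e e (u e)"
      unfolding ex by (simp_all add: algebra_simps)
    ultimately have "2 * (P e e (u f) + 2 * P e f (u e)) = 0" "2 * (P f f (u e) + 2 * P e f (u f)) = 0"
      unfolding * by simp_all
    then have "P e e (u f) = - (2 * P e f (u e))" "P f f (u e) = - (2 * P e f (u f))"
      unfolding mult_eq_0_iff by (simp_all add: add_eq_0_iff2)
    then show ?R using \<open>P e e (u e) = 0\<close> \<open>P f f (u f) = 0\<close> by simp
  next
    assume ?R
    then have "P (k *s e + l *s f) (k *s e + l *s f) (u (k *s e + l *s f)) = 0" for k l
      unfolding ex by simp
    then show ?L using assms(2) unfolding tangent_fano_def by (auto simp: span_pair)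
  qed
qed

text \<open>Done in the reduced form, where \<open>omega\<close> is a 2 by 2 determinant: modulo the
  tangency relations every entry acquires one factor \<open>k * n - l * m\<close>, and the
  determinant itself a third one.\<close>

lemma omega_change_frame:
  assumes "cubic P" "u \<in> tangent_fano P (vec.span {e, f})" "v \<in> tangent_fano P (vec.span {e, f})"
  shows "omega P (k *s e + l *s f) (m *s e + n *s f) u v = (k * n - l * m) ^ 3 * omega P e f u v"
proof -
  have lin: "Vector_Spaces.linear (*s) (*s) u" "Vector_Spaces.linear (*s) (*s) v"
    using assms(2,3) unfolding tangent_fano_def by auto
  have sub: "vec.span {k *s e + l *s f, m *s e + n *s f} \<subseteq> vec.span {e, f}"
    by (intro vec.span_minimal vec.subspace_span) (auto simp: span_pair)
  have "u \<in> tangent_fano P (vec.span {k *s e + l *s f, m *s e + n *s f})"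
    "v \<in> tangent_fano P (vec.span {k *s e + l *s f, m *s e + n *s f})"
    using assms(2,3) sub unfolding tangent_fano_def by auto
  note u' = this(1)[unfolded tangent_fano_span[OF assms(1) lin(1)]] and v' = this(2)[unfolded tangent_fano_span[OF assms(1) lin(2)]]
  note u = assms(2)[unfolded tangent_fano_span[OF assms(1) lin(1)]]
    and v = assms(3)[unfolded tangent_fano_span[OF assms(1) lin(2)]]
  have *: "P (k *s e + l *s f) (m *s e + n *s f) (x (k *s e + l *s f)) = (k * n - l * m) * (k * P e f (x e) - l * P e f (x f))"
    "P (k *s e + l *s f) (m *s e + n *s f) (x (m *s e + n *s f)) = (k * n - l * m) * (n * P e f (x f) - m * P e f (x e))"
    if x: "Vector_Spaces.linear (*s) (*s) x" "P e e (x e) = 0 \<and> P e e (x f) = - 2 * P e f (x e) \<and> P f f (x e) = - 2 * P e f (x f) \<and> P f f (x f) = 0" for x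
  proof -
    interpret x: Vector_Spaces.linear "(*s)" "(*s)" x by fact
    show "P (k *s e + l *s f) (m *s e + n *s f) (x (k *s e + l *s f)) = (k * n - l * m) * (k * P e f (x e) - l * P e f (x f))"
      "P (k *s e + l *s f) (m *s e + n *s f) (x (m *s e + n *s f)) = (k * n - l * m) * (n * P e f (x f) - m * P e f (x e))"
      unfolding x.add x.scale using x(2) cubicD(1)[OF assms(1), of f e]
      by (simp_all add: cubicD(3,4)[OF assms(1)] cubic_linear[OF assms(1)] algebra_simps)
  qed
  have "omega P (k *s e + l *s f) (m *s e + n *s f) u v = 12 *
    (P (k *s e + l *s f) (m *s e + n *s f) (u (k *s e + l *s f)) * P (k *s e + l *s f) (m *s e + n *s f) (v (m *s e + n *s f))
     - P (k *s e + l *s f) (m *s e + n *s f) (u (m *s e + n *s f)) * P (k *s e + l *s f) (m *s e + n *s f) (v (k *s e + l *s f)))"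
    by (rule omega_reduced) (use u' v' in auto)
  also have "\<dots> = (k * n - l * m) ^ 3 * (12 * (P e f (u e) * P e f (v f) - P e f (u f) * P e f (v e)))"
    unfolding *[OF lin(1) u] *[OF lin(2) v] by algebra
  also have "12 * (P e f (u e) * P e f (v f) - P e f (u f) * P e f (v e)) = omega P e f u v"
    by (rule omega_reduced[symmetric]) (use u v in auto)
  finally show ?thesis .
qed

text \<open>Adapted frames: for \<open>X = x e + y f\<close> we have \<open>P X X w = x\<^sup>2\<close> and \<open>P X X w' = y\<^sup>2\<close>, so that residues of \<open>G / (A B)\<close>
  are \<open>xy\<close>-coefficients.\<close>

locale normal_frame =
  fixes P :: "V \<Rightarrow> V \<Rightarrow> V \<Rightarrow> complex" and e f n1 n2 w w' :: V
  assumes cubic: "cubic P"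
    and line: "P e e e = 0" "P e e f = 0" "P e f f = 0" "P f f f = 0"
    and w: "P e e w = 1" "P e f w = 0" "P f f w = 0"
    and w': "P e e w' = 0" "P e f w' = 0" "P f f w' = 1"
    and n: "P e e n1 = 0" "P f f n1 = 0" "P e e n2 = 0" "P f f n2 = 0"
    and basis: "D6 e f n1 n2 w w' \<noteq> 0"
begin

abbreviation "D0 \<equiv> D6 e f n1 n2 w w'"

text \<open>Coordinates by Cramer's rule. Those along \<open>w\<close> and \<open>w'\<close> need no
  name: by the normalization they are \<open>P e e y\<close> and \<open>P f f y\<close>.\<close>

definition "co1 y = D6 y f n1 n2 w w' / D0"
definition "co2 y = D6 e y n1 n2 w w' / D0"
definition "co3 y = D6 e f y n2 w w' / D0"
definition "co4 y = D6 e f n1 y w w' / D0"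

lemma P_coords:
  assumes "y = c1 *s e + c2 *s f + c3 *s n1 + c4 *s n2 + c5 *s w + c6 *s w'"
  shows "P e e y = c5" "P f f y = c6" "P e f y = P e f n1 * c3 + P e f n2 * c4"
  unfolding assms cubic_linear[OF cubic] using line w w' n cubicD(1,2)[OF cubic]
  by (simp_all add: mult.commute)

lemma coords: "y = co1 y *s e + co2 y *s f + co3 y *s n1 + co4 y *s n2 + P e e y *s w + P f f y *s w'"
proof -
  note c = cramer_6[OF basis, of y]
  show ?thesis
    unfolding P_coords(1)[OF c] P_coords(2)[OF c] co1_def co2_def co3_def co4_def by (rule c)
qed

text \<open>\<open>P e f\<close> vanishes on \<open>e\<close>, \<open>f\<close>, \<open>w\<close>,
  \<open>w'\<close>, so these two numbers are all that is left of it. Both are zero exactly when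
  \<open>omega\<close> vanishes identically on the tangent space of the line.\<close>

definition "beta1 = P e f n1"
definition "beta2 = P e f n2"

lemma P_e_f: "P e f y = beta1 * co3 y + beta2 * co4 y"
  unfolding beta1_def beta2_def by (rule P_coords(3)[OF coords])

lemma co_linear:
  "co1 (x + y) = co1 x + co1 y" "co1 (k *s x) = k * co1 x"
  "co2 (x + y) = co2 x + co2 y" "co2 (k *s x) = k * co2 x"
  "co3 (x + y) = co3 x + co3 y" "co3 (k *s x) = k * co3 x"
  "co4 (x + y) = co4 x + co4 y" "co4 (k *s x) = k * co4 x"
  by (simp_all add: co1_def co2_def co3_def co4_def D6_add D6_scale add_divide_distrib)

lemma co_basis [simp]:
  "co1 e = 1" "co1 f = 0" "co1 n1 = 0" "co1 n2 = 0" "co1 w = 0" "co1 w' = 0"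
  "co2 e = 0" "co2 f = 1" "co2 n1 = 0" "co2 n2 = 0" "co2 w = 0" "co2 w' = 0"
  "co3 e = 0" "co3 f = 0" "co3 n1 = 1" "co3 n2 = 0" "co3 w = 0" "co3 w' = 0"
  "co4 e = 0" "co4 f = 0" "co4 n1 = 0" "co4 n2 = 1" "co4 w = 0" "co4 w' = 0"
  using basis by (simp_all add: co1_def co2_def co3_def co4_def)

lemma D6_co:
  "D6 e f p q w w' = D0 * (co3 p * co4 q - co4 p * co3 q)"
  "D6 p f q r w w' = D0 * (co1 p * (co3 q * co4 r - co4 q * co3 r) - co3 p * (co1 q * co4 r - co4 q * co1 r)
     + co4 p * (co1 q * co3 r - co3 q * co1 r))"
  "D6 e p q r w w' = D0 * (co2 p * (co3 q * co4 r - co4 q * co3 r) - co3 p * (co2 q * co4 r - co4 q * co2 r)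
     + co4 p * (co2 q * co3 r - co3 q * co2 r))"
proof -
  have *: "D6 e f n2 n1 w w' = - D0" by (rule D6_swap(3))
  have far: "D6 c b a d p q = - D6 a b c d p q" "D6 a d c b p q = - D6 a b c d p q" "D6 d b c a p q = - D6 a b c d p q"
    for a b c d p q
    using D6_swap(1)[of c b a d p q] D6_swap(2)[of b c a d p q] D6_swap(1)[of b a c d p q]
      D6_swap(2)[of a d c b p q] D6_swap(3)[of a c d b p q] D6_swap(2)[of a c b d p q]
      D6_swap(1)[of d b c a p q] D6_swap(2)[of b d c a p q] D6_swap(3)[of b c d a p q]
      D6_swap(2)[of b c a d p q] by simp_all
  have e: "D6 n1 f e n2 w w' = - D0" "D6 n2 f n1 e w w' = - D0" "D6 n1 f n2 e w w' = D0" "D6 n2 f e n1 w w' = D0"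
    using far(1)[of n1 f e n2] far(3)[of n2 f n1 e] far(3)[of n1 f n2 e] far(1)[of n2 f e n1] by (simp_all add: *)
  have f: "D6 e n1 f n2 w w' = - D0" "D6 e n2 n1 f w w' = - D0" "D6 e n1 n2 f w w' = D0" "D6 e n2 f n1 w w' = D0"
    using D6_swap(2)[of e n1 f n2] far(2)[of e n2 n1 f] far(2)[of e n1 n2 f] D6_swap(2)[of e n2 f n1] by (simp_all add: *)
  show "D6 e f p q w w' = D0 * (co3 p * co4 q - co4 p * co3 q)"
    by (subst coords[of p], subst coords[of q]) (simp add: D6_add D6_scale * algebra_simps)
  show "D6 p f q r w w' = D0 * (co1 p * (co3 q * co4 r - co4 q * co3 r) - co3 p * (co1 q * co4 r - co4 q * co1 r)
     + co4 p * (co1 q * co3 r - co3 q * co1 r))"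
    by (subst coords[of p], subst coords[of q], subst coords[of r]) (simp add: D6_add D6_scale e * algebra_simps)
  show "D6 e p q r w w' = D0 * (co2 p * (co3 q * co4 r - co4 q * co3 r) - co3 p * (co2 q * co4 r - co4 q * co2 r)
     + co4 p * (co2 q * co3 r - co3 q * co2 r))"
    by (subst coords[of p], subst coords[of q], subst coords[of r]) (simp add: D6_add D6_scale f * algebra_simps)
qed

text \<open>The conditions of \<open>tangent_fano_span\<close>, imposed on the values
  \<open>p = u e\<close> and \<open>q = u f\<close> alone.\<close>

definition tangent_pair :: "V \<Rightarrow> V \<Rightarrow> bool" where
  "tangent_pair p q \<longleftrightarrow> P e e p = 0 \<and> P e e q = - 2 * P e f p \<and> P f f p = - 2 * P e f q \<and> P f f q = 0"

lemma frame_res_normal: "frame_res P e f w w' = 1"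
  unfolding frame_res_def resultant2_def using w w' by simp

lemma frame_form_normal:
  "frame_form P e f w w' p q p' q' = D0 * (co3 p * co4 q' - co4 p * co3 q' + co3 q * co4 p' - co4 q * co3 p')"
proof -
  have "frame_num P e f w w' p q p' q' = D6 e f p q' w w' + D6 e f q p' w w'"
    unfolding frame_num_def det3_def w w' by simp
  then show ?thesis unfolding frame_form_def frame_res_normal by (simp add: D6_co(1)[of p q'] D6_co(1)[of q p'] algebra_simps)
qed

text \<open>Modulo \<open>e\<close> and \<open>f\<close>, the vectors \<open>p\<close>,
  \<open>p'\<close> have no component along \<open>w\<close>, and \<open>q\<close>,
  \<open>q'\<close> none along \<open>w'\<close>. The determinant therefore expands into products of
  a \<open>w'\<close>-coordinate, a \<open>w\<close>-coordinate and a 2 by 2 minor in the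
  coordinates along \<open>n1\<close>, \<open>n2\<close>.\<close>

lemma D6_tangent:
  assumes "tangent_pair p q" "tangent_pair p' q'"
  shows "D6 e f p q p' q' = 2 * D0 * (co3 p * co4 q' - co4 p * co3 q' + co3 q * co4 p' - co4 q * co3 p')
     * 2 * (P e f p * P e f q' - P e f q * P e f p')"
proof -
  have swaps: "D6 e f a b c d = - D6 e f b a c d" "D6 e f a b c d = - D6 e f a c b d" "D6 e f a b c d = - D6 e f a b d c" for a b c d
    by (rule D6_swap)+
  have perms: "D6 e f w' w n1 n2 = - D0" "D6 e f w' w n2 n1 = D0" "D6 e f w' n1 n2 w = - D0"
    "D6 e f w' n2 n1 w = D0" "D6 e f n1 w w' n2 = D0" "D6 e f n2 w w' n1 = - D0"
    "D6 e f n1 n2 w' w = - D0" "D6 e f n2 n1 w' w = D0"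
  proof -
    show 1: "D6 e f n1 n2 w' w = - D0" by (rule D6_swap)
    show 2: "D6 e f n2 n1 w' w = D0" using swaps(1)[of n2 n1 w' w] 1 by simp
    show "D6 e f n1 w w' n2 = D0" using swaps(3)[of n1 w w' n2] swaps(2)[of n1 w n2 w'] by simp
    show "D6 e f n2 w w' n1 = - D0"
      using swaps(3)[of n2 w w' n1] swaps(2)[of n2 w n1 w'] swaps(1)[of n2 n1 w w'] by simp
    show "D6 e f w' n1 n2 w = - D0" using swaps(1)[of w' n1 n2 w] swaps(2)[of n1 w' n2 w] 1 by simp
    show "D6 e f w' n2 n1 w = D0" using swaps(1)[of w' n2 n1 w] swaps(2)[of n2 w' n1 w] 2 by simp
    show "D6 e f w' w n1 n2 = - D0"
      using swaps(2)[of w' w n1 n2] swaps(3)[of w' n1 w n2] swaps(1)[of w' n1 n2 w] swaps(2)[of n1 w' n2 w] 1 by simp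
    show "D6 e f w' w n2 n1 = D0"
      using swaps(2)[of w' w n2 n1] swaps(3)[of w' n2 w n1] swaps(1)[of w' n2 n1 w] swaps(2)[of n2 w' n1 w] 2 by simp
  qed
  have expand: "D6 e f (a1 *s e + a2 *s f + a3 *s n1 + a4 *s n2 + 0 *s w + a6 *s w') (b1 *s e + b2 *s f + b3 *s n1 + b4 *s n2 + b5 *s w + 0 *s w')
     (c1 *s e + c2 *s f + c3 *s n1 + c4 *s n2 + 0 *s w + c6 *s w') (d1 *s e + d2 *s f + d3 *s n1 + d4 *s n2 + d5 *s w + 0 *s w')
     = D0 * (- a6 * b5 * (c3 * d4 - c4 * d3) - a6 * d5 * (b3 * c4 - b4 * c3) + c6 * b5 * (a3 * d4 - a4 * d3) - c6 * d5 * (a3 * b4 - a4 * b3))"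
    for a1 a2 a3 a4 a6 b1 b2 b3 b4 b5 c1 c2 c3 c4 c6 d1 d2 d3 d4 d5
    by (simp only: D6_add D6_scale D6_same perms mult_zero_left mult_zero_right add_0 add_0_right) algebra
  have "P e e p = 0" "P f f q = 0" "P e e p' = 0" "P f f q' = 0" using assms unfolding tangent_pair_def by auto
  from coords[of p] coords[of q] coords[of p'] coords[of q'] this
  have eq: "D6 e f p q p' q' = D0 * (- P f f p * P e e q * (co3 p' * co4 q' - co4 p' * co3 q') - P f f p * P e e q' * (co3 q * co4 p' - co4 q * co3 p')
      + P f f p' * P e e q * (co3 p * co4 q' - co4 p * co3 q') - P f f p' * P e e q' * (co3 p * co4 q - co4 p * co3 q))"
    using expand[of "co1 p" "co2 p" "co3 p" "co4 p" "P f f p" "co1 q" "co2 q" "co3 q" "co4 q" "P e e q"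
      "co1 p'" "co2 p'" "co3 p'" "co4 p'" "P f f p'" "co1 q'" "co2 q'" "co3 q'" "co4 q'" "P e e q'"] by metis
  have h: "P f f p = - 2 * P e f q" "P e e q = - 2 * P e f p" "P f f p' = - 2 * P e f q'" "P e e q' = - 2 * P e f p'"
    using assms unfolding tangent_pair_def by auto
  \<comment> \<open>The factorization appears only after the coordinates along \<open>w\<close> and
    \<open>w'\<close> have been expressed by those along \<open>n1\<close>, \<open>n2\<close>
    through the tangency relations.\<close>
  show ?thesis unfolding eq h P_e_f by algebra
qed

text \<open>In adapted coordinates K is 4 times, and \<open>omega\<close> is 12 times, an expression
  in the same 2 by 2 determinant; the quotient of these constants is the factor 3.\<close>

lemma K_normal:
  assumes "tangent_pair (u e) (u f)" "tangent_pair (v e) (v f)"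
  shows "3 * K_form e f u v = omega P e f u v * frame_form P e f w w' (u e) (u f) (v e) (v f)"
proof -
  have "omega P e f u v = 12 * (P e f (u e) * P e f (v f) - P e f (u f) * P e f (v e))"
    by (rule omega_reduced) (use assms in \<open>simp_all add: tangent_pair_def\<close>)
  then show ?thesis
    unfolding K_form_def D6_def[symmetric] D6_tangent[OF assms] frame_form_normal by simp
qed

text \<open>\<open>t u v z\<close> is the derivative in direction \<open>u\<close> of the residue form evaluated on \<open>v\<close>, \<open>z\<close>, up to second derivatives
  of the frame. The cyclic sum is the residue of a total derivative.\<close>

lemma closedness_identity:
  assumes "tangent_pair u1 u2" "tangent_pair v1 v2" "tangent_pair z1 z2"
  defines "t \<equiv> \<lambda>u1 u2 v1 v2 z1 z2.
     D6 u1 f v1 z2 w w' + D6 e u2 v1 z2 w w' + D6 u1 f v2 z1 w w' + D6 e u2 v2 z1 w w'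
     - 2 * P u1 e w * (D6 e f v1 z2 w w' + D6 e f v2 z1 w w')
     - 2 * (P u1 f w + P e u2 w) * D6 e f v1 z1 w w'
     - 2 * P u2 f w' * (D6 e f v1 z2 w w' + D6 e f v2 z1 w w')
     - 2 * (P u1 f w' + P e u2 w') * D6 e f v2 z2 w w'"
  shows "t u1 u2 v1 v2 z1 z2 + t v1 v2 z1 z2 u1 u2 + t z1 z2 u1 u2 v1 v2 = 0"
proof -
  \<comment> \<open>The values of \<open>P\<close> that enter through the derivatives of A and B, in
    coordinates. The claim thereby becomes a polynomial identity in the coordinates of the three
    tangent vectors, with the remaining values of \<open>P\<close> on frame vectors as free
    parameters.\<close>
  have c: "P y e w = co1 y + co3 y * P n1 e w + co4 y * P n2 e w + P e e y * P w e w + P f f y * P w' e w"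
    "P y f w = co3 y * P n1 f w + co4 y * P n2 f w + P e e y * P w f w + P f f y * P w' f w"
    "P e y w = co1 y + co3 y * P n1 e w + co4 y * P n2 e w + P e e y * P w e w + P f f y * P w' e w"
    "P y f w' = co2 y + co3 y * P n1 f w' + co4 y * P n2 f w' + P e e y * P w f w' + P f f y * P w' f w'"
    "P e y w' = co3 y * P n1 e w' + co4 y * P n2 e w' + P e e y * P w e w' + P f f y * P w' e w'" for y
  proof -
    have s: "P x w' w = P x w w'" "P w e y = P e w y" "P w f y = P f w y" "P w' e y = P e w' y" "P w' f y = P f w' y"
      "P n1 e y = P e n1 y" "P n1 f y = P f n1 y" "P n2 e y = P e n2 y" "P n2 f y = P f n2 y" for x y
      using cubicD(1,2)[OF cubic] by auto
    have v: "P f e x = P e f x" for x using cubicD(1)[OF cubic] .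
    have "P x y z = co1 x * P e y z + co2 x * P f y z + co3 x * P n1 y z + co4 x * P n2 y z + P e e x * P w y z + P f f x * P w' y z" for x y z
      by (subst coords[of x]) (simp add: cubicD(3,4)[OF cubic])
    from this[of y e w] this[of y f w] this[of y e w'] this[of y f w']
    show "P y e w = co1 y + co3 y * P n1 e w + co4 y * P n2 e w + P e e y * P w e w + P f f y * P w' e w"
    "P y f w = co3 y * P n1 f w + co4 y * P n2 f w + P e e y * P w f w + P f f y * P w' f w"
    "P e y w = co1 y + co3 y * P n1 e w + co4 y * P n2 e w + P e e y * P w e w + P f f y * P w' e w"
    "P y f w' = co2 y + co3 y * P n1 f w' + co4 y * P n2 f w' + P e e y * P w f w' + P f f y * P w' f w'"
    "P e y w' = co3 y * P n1 e w' + co4 y * P n2 e w' + P e e y * P w e w' + P f f y * P w' e w'"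
      using cubicD(1)[OF cubic, of e y] by (simp_all add: w w' v)
  qed
  \<comment> \<open>These symmetries tie the terms coming from the derivative of A to those coming
    from the derivative of B.\<close>
  have s: "P w' e w = P w e w'" "P w' f w = P w f w'"
    using cubicD(1,2)[OF cubic] by metis+
  have "P e e u1 = 0" "P f f u2 = 0" "P e e v1 = 0" "P f f v2 = 0" "P e e z1 = 0" "P f f z2 = 0"
    "P e e u2 = - 2 * (beta1 * co3 u1 + beta2 * co4 u1)" "P f f u1 = - 2 * (beta1 * co3 u2 + beta2 * co4 u2)"
    "P e e v2 = - 2 * (beta1 * co3 v1 + beta2 * co4 v1)" "P f f v1 = - 2 * (beta1 * co3 v2 + beta2 * co4 v2)"
    "P e e z2 = - 2 * (beta1 * co3 z1 + beta2 * co4 z1)" "P f f z1 = - 2 * (beta1 * co3 z2 + beta2 * co4 z2)"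
    using assms(1-3) unfolding tangent_pair_def P_e_f by auto
  note h = this
  define d where "d = D0"
  note D6_d = D6_co[folded d_def]
  note c' = c(1)[of u1] c(2)[of u1] c(4)[of u1] c(3)[of u2] c(4)[of u2] c(5)[of u2] c(1)[of v1] c(2)[of v1] c(4)[of v1] c(3)[of v2] c(4)[of v2] c(5)[of v2] c(1)[of z1] c(2)[of z1] c(4)[of z1] c(3)[of z2] c(4)[of z2] c(5)[of z2]
  show ?thesis
    unfolding t_def D6_d c' s h co_basis by algebra
qed

end

section \<open>Existence of adapted frames\<close>

lemma vanishing_on_line:
  assumes P: "cubic P" and van: "\<And>x. x \<in> vec.span {e, f} \<Longrightarrow> P x x x = 0"
  shows "P e e e = 0" "P e e f = 0" "P e f f = 0" "P f f f = 0"
proof -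
  have ex: "P (k *s e + l *s f) (k *s e + l *s f) (k *s e + l *s f) = k ^ 3 * P e e e + 3 * k\<^sup>2 * l * P e e f + 3 * k * l\<^sup>2 * P e f f + l ^ 3 * P f f f" for k l
    unfolding cubic_linear(3,4)[OF P] unfolding cubic_pairs(1)[OF P] using cubicD(2)[OF P, of e f e] cubicD(2)[OF P, of f f e]
      cubicD(1)[OF P, of f e f] by (simp add: algebra_simps power2_eq_square power3_eq_cube)
  have z: "P (k *s e + l *s f) (k *s e + l *s f) (k *s e + l *s f) = 0" for k l
    using van span_pair by blast
  show e: "P e e e = 0" and f: "P f f f = 0" using z[of 1 0] z[of 0 1] by (simp_all add: ex)
  have "6 * P e e f = P (1 *s e + 1 *s f) (1 *s e + 1 *s f) (1 *s e + 1 *s f)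
      - P (1 *s e + (-1) *s f) (1 *s e + (-1) *s f) (1 *s e + (-1) *s f) - 2 * P f f f"
    "6 * P e f f = P (1 *s e + 1 *s f) (1 *s e + 1 *s f) (1 *s e + 1 *s f)
      + P (1 *s e + (-1) *s f) (1 *s e + (-1) *s f) (1 *s e + (-1) *s f) - 2 * P e e e"
    unfolding ex by (simp_all add: algebra_simps)
  then show "P e e f = 0" "P e f f = 0" unfolding z e f by simp_all
qed

text \<open>\<open>P e e\<close> and \<open>P f f\<close> vanish on the line and separate
  \<open>w\<close> from \<open>w'\<close>, so \<open>e\<close>, \<open>f\<close>, \<open>w\<close>,
  \<open>w'\<close> are independent. Completing them to a basis and subtracting multiples of
  \<open>w\<close> and \<open>w'\<close> from the two new vectors puts these in the kernels of both
  functionals, without changing the determinant.\<close>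

lemma normal_frame_exists:
  assumes P: "cubic P" and ind: "vec.independent {e, f}" "e \<noteq> f" and van: "\<And>x. x \<in> vec.span {e, f} \<Longrightarrow> P x x x = 0"
    and w: "P e e w = 1" "P e f w = 0" "P f f w = 0" "P e e w' = 0" "P e f w' = 0" "P f f w' = 1"
  shows "\<exists>n1 n2. normal_frame P e f n1 n2 w w'"
proof -
  note line = vanishing_on_line[OF P van]
  have sp: "P e e y = 0 \<and> P f f y = 0" if "y \<in> vec.span {e, f}" for y
    using that line cubicD(2)[OF P, of f f e] cubicD(1)[OF P, of f e] by (auto simp: span_pair cubic_linear[OF P])
  have w_sp: "w \<notin> vec.span {e, f}" using sp w by force
  have w'_sp: "w' \<notin> vec.span {w, e, f}"
  proof
    assume "w' \<in> vec.span {w, e, f}"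
    then obtain k where k: "w' - k *s w \<in> vec.span {e, f}" unfolding vec.span_insert by blast
    have "P e e w' = P e e (w' - k *s w) + k * P e e w" "P f f w' = P f f (w' - k *s w) + k * P f f w"
      unfolding cubic_linear(4)[OF P, symmetric] cubic_linear(3)[OF P, symmetric] by simp_all
    then show False using sp[OF k] w by simp
  qed
  have i3: "vec.independent {w, e, f}" using ind w_sp by (simp add: vec.independent_insert)
  have i4: "vec.independent {w', w, e, f}" using i3 w'_sp by (simp add: vec.independent_insert)
  have c4: "card {w', w, e, f} = 4"
  proof -
    have "w \<notin> {e, f}" "w' \<notin> {w, e, f}" using vec.span_base[of w "{e, f}"] vec.span_base[of w' "{w, e, f}"] w_sp w'_sp by metis+
    then show ?thesis using ind(2) by simp
  qed
  obtain B where B: "{w', w, e, f} \<subseteq> B" "vec.independent B" "UNIV \<subseteq> vec.span B"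
    by (rule vec.maximal_independent_subset_extend[OF subset_UNIV i4]) blast
  have cB: "finite B" "card B = 6"
    using vec.finiteI_independent[OF B(2)] vec.basis_card_eq_dim[OF subset_UNIV B(3,2)] by (simp_all add: vec_dim_card del: vec.dim_UNIV)
  have "card (B - {w', w, e, f}) = 2" using cB B(1) c4 by (simp add: card_Diff_subset)
  then obtain m1 m2 where m: "B - {w', w, e, f} = {m1, m2}" "m1 \<noteq> m2" by (auto simp: card_2_iff)
  have "B = {e, f, m1, m2, w, w'}" using m(1) B(1) by auto
  then have D: "D6 e f m1 m2 w w' \<noteq> 0" using D6_nonzero_iff_independent[OF B(2)] cB(2) by blast
  define n1 n2 where "n1 = m1 + (- P e e m1) *s w + (- P f f m1) *s w'" and "n2 = m2 + (- P e e m2) *s w + (- P f f m2) *s w'"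
  have "D6 e f n1 n2 w w' = D6 e f m1 m2 w w'" unfolding n1_def n2_def by (simp only: D6_add D6_scale D6_same mult_zero_right add_0_right)
  moreover have "P e e (m + (- P e e m) *s w + (- P f f m) *s w') = 0" "P f f (m + (- P e e m) *s w + (- P f f m) *s w') = 0" for m
    by (simp_all only: cubic_linear[OF P] w) simp_all
  ultimately have "normal_frame P e f n1 n2 w w'"
    using P line w D unfolding n1_def n2_def by unfold_locales simp_all
  then show ?thesis by blast
qed

text \<open>Splits the form with coefficients \<open>l0\<close>, \<open>2 * l1\<close>,
  \<open>l2\<close> into the linear factors \<open>(k, l)\<close> and \<open>(m, n)\<close>. Only
  for the zero form may the second factor be zero.\<close>

lemma binary_quadratic_factor:
  fixes l0 l1 l2 :: complex
  obtains k l m n where "l0 = k * m" "2 * l1 = k * n + l * m" "l2 = l * n" "(k, l) \<noteq> (0, 0)" "(m, n) \<noteq> (0, 0) \<or> (l0, l1, l2) = (0, 0, 0)"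
proof (cases "l0 = 0")
  case True
  show ?thesis by (rule that[where k = 0 and l = 1 and m = "2 * l1" and n = l2]) (use True in auto)
next
  case False
  define r where "r = csqrt (l1\<^sup>2 - l0 * l2)"
  have r: "r\<^sup>2 = l1\<^sup>2 - l0 * l2" by (simp add: r_def)
  show ?thesis
    by (rule that[where k = l0 and l = "l1 + r" and m = 1 and n = "(l1 - r) / l0"]) (use False r in \<open>auto simp: field_simps power2_eq_square\<close>)
qed

lemma is_basis_iff:
  "is_basis T e f \<longleftrightarrow> (\<forall>k l. k *s e + l *s f = 0 \<longrightarrow> k = 0 \<and> l = 0) \<and> T = vec.span {e, f}"
proof -
  have "e \<noteq> f \<and> vec.independent {e, f} \<longleftrightarrow> (\<forall>k l. k *s e + l *s f = 0 \<longrightarrow> k = 0 \<and> l = 0)" (is "?L \<longleftrightarrow> ?R")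
  proof
    assume L: ?L
    show ?R
    proof (intro allI impI)
      fix k l assume "k *s e + l *s f = 0"
      then have "(\<Sum>v\<in>{e, f}. (if v = e then k else l) *s v) = 0" using L by auto
      then have "\<forall>v\<in>{e, f}. (if v = e then k else l) = 0"
        using vec.independentD[of "{e, f}" "{e, f}" "\<lambda>v. if v = e then k else l"] L by blast
      then show "k = 0 \<and> l = 0" using L by auto
    qed
  next
    assume R: ?R
    have ne: "e \<noteq> f" using R[rule_format, of 1 "-1"] by auto
    have "f \<noteq> 0" using R[rule_format, of 0 1] by auto
    moreover have "e \<notin> vec.span {f}"
    proof
      assume "e \<in> vec.span {f}"
      then obtain l where "e = l *s f" unfolding vec.span_singleton by blast
      then show False using R[rule_format, of 1 "- l"] by auto
    qed
    ultimately show ?L using ne by (simp add: vec.independent_insert)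
  qed
  then show ?thesis unfolding is_basis_def by auto
qed

lemma is_basis_change:
  assumes "is_basis T e f" "k * n - l * m \<noteq> 0"
  shows "is_basis T (k *s e + l *s f) (m *s e + n *s f)"
proof -
  have ind: "\<And>k l. k *s e + l *s f = 0 \<Longrightarrow> k = 0 \<and> l = 0" and T: "T = vec.span {e, f}"
    using assms(1) unfolding is_basis_iff by auto
  have "a = 0 \<and> b = 0" if "a *s (k *s e + l *s f) + b *s (m *s e + n *s f) = 0" for a b
  proof -
    have "(a * k + b * m) *s e + (a * l + b * n) *s f = 0"
      using that by (simp add: vec.scale_right_distrib vec.scale_left_distrib ac_simps)
    from ind[OF this] have "a * k + b * m = 0" "a * l + b * n = 0" by auto
    then have "a * (k * n - l * m) = 0" "b * (k * n - l * m) = 0" by algebra+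
    then show ?thesis using assms(2) by simp
  qed
  moreover have "vec.span {k *s e + l *s f, m *s e + n *s f} = vec.span {e, f}"
  proof (rule vec.span_eq[THEN iffD2], intro conjI)
    show "{k *s e + l *s f, m *s e + n *s f} \<subseteq> vec.span {e, f}" by (auto simp: span_pair)
    define d where "d = k * n - l * m"
    have d: "d \<noteq> 0" using assms(2) by (simp add: d_def)
    have "e = (n / d) *s (k *s e + l *s f) + (- l / d) *s (m *s e + n *s f)"
      "f = (- m / d) *s (k *s e + l *s f) + (k / d) *s (m *s e + n *s f)"
    proof -
      have "(n / d) *s (k *s e + l *s f) + (- l / d) *s (m *s e + n *s f) = ((n * k - l * m) / d) *s e + ((n * l - l * n) / d) *s f"
        "(- m / d) *s (k *s e + l *s f) + (k / d) *s (m *s e + n *s f) = ((k * m - m * k) / d) *s e + ((k * n - m * l) / d) *s f"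
        by (simp_all add: vec_eq_iff field_simps d)
      then show "e = (n / d) *s (k *s e + l *s f) + (- l / d) *s (m *s e + n *s f)"
        "f = (- m / d) *s (k *s e + l *s f) + (k / d) *s (m *s e + n *s f)"
        using d by (simp_all add: d_def mult.commute)
    qed
    then show "{e, f} \<subseteq> vec.span {k *s e + l *s f, m *s e + n *s f}"
      using span_pair by blast
  qed
  ultimately show ?thesis unfolding is_basis_iff T by simp
qed

lemma is_basis_unique:
  assumes "is_basis T e f" "is_basis T e' f'"
  obtains k l m n where "e' = k *s e + l *s f" "f' = m *s e + n *s f" "k * n - l * m \<noteq> 0"
proof -
  have "e' \<in> vec.span {e, f}" "f' \<in> vec.span {e, f}"
    using assms vec.span_base[of _ "{e', f'}"] unfolding is_basis_def by auto
  then obtain k l m n where *: "e' = k *s e + l *s f" "f' = m *s e + n *s f" unfolding span_pair by blast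
  have ind: "\<And>k l. k *s e' + l *s f' = 0 \<Longrightarrow> k = 0 \<and> l = 0" using assms(2) unfolding is_basis_iff by auto
  have "k * n - l * m \<noteq> 0"
  proof
    assume d: "k * n - l * m = 0"
    have "n *s e' + (- l) *s f' = (k * n - l * m) *s e" "(- m) *s e' + k *s f' = (k * n - l * m) *s f"
      by (simp_all add: * vec_eq_iff algebra_simps)
    then have "n *s e' + (- l) *s f' = 0" "(- m) *s e' + k *s f' = 0" unfolding d by simp_all
    then have "n = 0 \<and> - l = 0" "- m = 0 \<and> k = 0" by (blast dest: ind)+
    then have "e' = 0" by (simp add: *)
    then show False using ind[of 1 0] by simp
  qed
  with * that show ?thesis by blast
qed

text \<open>Independent functionals form a matrix of full row rank; the columns of a right inverse
  are the dual vectors.\<close>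

lemma dual_vectors:
  fixes F :: "'n::finite \<Rightarrow> V \<Rightarrow> complex"
  assumes "\<And>i x y. F i (x + y) = F i x + F i y" "\<And>i c x. F i (c *s x) = c * F i x"
    and ind: "\<And>c. (\<And>y. (\<Sum>i\<in>UNIV. c i * F i y) = 0) \<Longrightarrow> \<forall>i. c i = 0"
  shows "\<exists>w. \<forall>i j. F i (w j) = (if i = j then 1 else 0)"
proof -
  define A :: "complex ^ 6 ^ 'n" where "A = (\<chi> i j. F i (axis j 1))"
  have Fsum: "F i (\<Sum>j\<in>S. g j) = (\<Sum>j\<in>S. F i (g j))" for i and S :: "6 set" and g
    using assms(2)[of i 0 0] by (induction S rule: infinite_finite_induct) (auto simp: assms(1))
  have F: "F i y = (\<Sum>j\<in>UNIV. A $ i $ j * y $ j)" for i y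
  proof -
    have "F i y = F i (\<Sum>j\<in>UNIV. y $ j *s axis j 1)" by (simp add: basis_expansion)
    then show ?thesis by (simp add: Fsum assms(2) A_def mult.commute)
  qed
  have "\<forall>i. c i = 0" if "sum (\<lambda>i. c i *s row i A) UNIV = 0" for c
  proof (rule ind)
    fix y
    have z: "(\<Sum>i\<in>UNIV. c i * A $ i $ j) = 0" for j
      using that by (auto simp: vec_eq_iff row_def)
    have "(\<Sum>i\<in>UNIV. c i * F i y) = (\<Sum>j\<in>UNIV. (\<Sum>i\<in>UNIV. c i * A $ i $ j) * y $ j)"
      unfolding F sum_distrib_left sum_distrib_right by (subst sum.swap) (simp add: mult.assoc)
    then show "(\<Sum>i\<in>UNIV. c i * F i y) = 0" by (simp add: z)
  qed
  then have "\<exists>N. A ** N = mat 1" unfolding matrix_right_invertible_independent_rows by blast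
  then obtain N where N: "A ** N = mat 1" by blast
  have "F i (\<chi> k. N $ k $ j) = (if i = j then 1 else 0)" for i j
  proof -
    have "F i (\<chi> k. N $ k $ j) = (A ** N) $ i $ j" by (simp add: F matrix_matrix_mult_def)
    then show ?thesis by (simp add: N mat_def)
  qed
  then show ?thesis by (intro exI[of _ "\<lambda>j. \<chi> k. N $ k $ j"]) simp
qed

lemma fanoD:
  assumes "T \<in> fano P" "is_basis T e f"
  shows "T = vec.span {e, f}" "vec.independent {e, f}" "e \<noteq> f" "\<And>x. x \<in> vec.span {e, f} \<Longrightarrow> P x x x = 0"
  using assms unfolding fano_def is_basis_def by auto

lemma fano_is_basis:
  assumes "T \<in> fano P"
  obtains e f where "is_basis T e f"
proof -
  have T: "vec.subspace T" "vec.dim T = 2" using assms unfolding fano_def grassmannian2_def by auto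
  obtain B where B: "B \<subseteq> T" "vec.independent B" "T \<subseteq> vec.span B" "card B = vec.dim T"
    using vec.basis_exists by blast
  then obtain e f where ef: "B = {e, f}" "e \<noteq> f" using T(2) by (auto simp: card_2_iff)
  then have "vec.span {e, f} = T" using B T(1) by (metis subset_antisym vec.span_minimal)
  then show ?thesis using that B(2) ef unfolding is_basis_def by blast
qed

text \<open>Some quadratic form is apolar to both A and B: its coefficients are the cross product of
  theirs. Its two linear factors are taken as basis vectors \<open>e1\<close>, \<open>f1\<close>,
  and apolarity says that \<open>P e1 f1\<close> vanishes on \<open>w\<close> and \<open>w'\<close>.
  Then A and B are combinations of the two squares, and inverting a 2 by 2 matrix makes them equal
  to these squares.\<close>

lemma frame_normalize:
  assumes P: "cubic P" and T: "T \<in> fano P" "is_basis T e f" and R: "frame_res P e f w w' \<noteq> 0"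
  obtains k l m n k' l' m' n' n1 n2 where "k * n - l * m \<noteq> 0" "k' * n' - l' * m' \<noteq> 0"
    "normal_frame P (k *s e + l *s f) (m *s e + n *s f) n1 n2 (k' *s w + l' *s w') (m' *s w + n' *s w')"
proof -
  define a0 a1 a2 where "a0 = P e e w" and "a1 = 2 * P e f w" and "a2 = P f f w"
  define b0 b1 b2 where "b0 = P e e w'" and "b1 = 2 * P e f w'" and "b2 = P f f w'"
  obtain k m n l where fac: "a1 * b2 - a2 * b1 = k * m" "2 * (a2 * b0 - a0 * b2) = k * n + l * m" "a0 * b1 - a1 * b0 = l * n"
    by (rule binary_quadratic_factor[of "a1 * b2 - a2 * b1" "a2 * b0 - a0 * b2" "a0 * b1 - a1 * b0"])
  define d where "d = k * n - l * m"
  \<comment> \<open>The discriminant of the apolar form is four times the resultant of A and B, so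
    its two factors are independent.\<close>
  have "d\<^sup>2 = (k * n + l * m)\<^sup>2 - 4 * (k * m) * (l * n)" unfolding d_def by algebra
  also have "\<dots> = 4 * frame_res P e f w w'"
    unfolding fac[symmetric] frame_res_def resultant2_def a0_def a1_def a2_def b0_def b1_def b2_def by algebra
  finally have d: "d \<noteq> 0" using R by auto
  define e1 f1 where "e1 = k *s e + l *s f" and "f1 = m *s e + n *s f"
  have b1: "is_basis T e1 f1" unfolding e1_def f1_def using T(2) d unfolding d_def by (rule is_basis_change)
  have "2 * P e1 f1 w = 2 * a0 * k * m + a1 * (k * n + l * m) + 2 * a2 * l * n"
    "2 * P e1 f1 w' = 2 * b0 * k * m + b1 * (k * n + l * m) + 2 * b2 * l * n"
    unfolding e1_def f1_def cubic_pairs(2)[OF P] a0_def a1_def a2_def b0_def b1_def b2_def by simp_all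
  moreover have "2 * a0 * k * m + a1 * (k * n + l * m) + 2 * a2 * l * n = 2 * a0 * (k * m) + a1 * (k * n + l * m) + 2 * a2 * (l * n)"
    "2 * b0 * k * m + b1 * (k * n + l * m) + 2 * b2 * l * n = 2 * b0 * (k * m) + b1 * (k * n + l * m) + 2 * b2 * (l * n)"
    by simp_all
  ultimately have "2 * P e1 f1 w = 0" "2 * P e1 f1 w' = 0" unfolding fac[symmetric] by algebra+
  then have z: "P e1 f1 w = 0" "P e1 f1 w' = 0" by simp_all
  define D where "D = P e1 e1 w * P f1 f1 w' - P f1 f1 w * P e1 e1 w'"
  have "frame_res P e1 f1 w w' = D\<^sup>2" unfolding frame_res_def resultant2_def z D_def by simp
  moreover have "frame_res P e1 f1 w w' \<noteq> 0"
    unfolding e1_def f1_def frame_res_change_frame[OF P] using R d by (simp add: d_def)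
  ultimately have D: "D \<noteq> 0" by auto
  define w1 w1' where "w1 = (P f1 f1 w' / D) *s w + (- P f1 f1 w / D) *s w'"
    and "w1' = (- P e1 e1 w' / D) *s w + (P e1 e1 w / D) *s w'"
  have "P e1 e1 w1 = 1" "P e1 f1 w1 = 0" "P f1 f1 w1 = 0" "P e1 e1 w1' = 0" "P e1 f1 w1' = 0" "P f1 f1 w1' = 1"
    unfolding w1_def w1'_def cubic_linear[OF P] z using D by (simp_all add: field_simps) (simp_all add: D_def algebra_simps)
  then obtain n1 n2 where "normal_frame P e1 f1 n1 n2 w1 w1'"
    using normal_frame_exists[OF P fanoD(2-4)[OF T(1) b1]] by blast
  moreover have "(P f1 f1 w' / D) * (P e1 e1 w / D) - (- P f1 f1 w / D) * (- P e1 e1 w' / D) \<noteq> 0"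
  proof -
    have "(P f1 f1 w' / D) * (P e1 e1 w / D) - (- P f1 f1 w / D) * (- P e1 e1 w' / D) = D / (D * D)"
      unfolding D_def[symmetric] by (simp add: diff_divide_distrib[symmetric] D_def mult.commute)
    then show ?thesis using D by simp
  qed
  ultimately show ?thesis using that d unfolding e1_def f1_def w1_def w1'_def d_def by blast
qed

text \<open>If the functionals \<open>P e e\<close>, \<open>P e f\<close>, \<open>P f f\<close> are
  independent, dual vectors serve as \<open>w\<close>, \<open>w'\<close>. Otherwise a linear
  relation among them factors as \<open>P e1 f1 = 0\<close>. Proportional \<open>e1\<close>,
  \<open>f1\<close> would be singular points, so they form a basis of T; a further relation between
  \<open>P e1 e1\<close> and \<open>P f1 f1\<close> would again produce a singular point.\<close>

lemma smooth_normal_frame: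
  assumes P: "cubic P" and sm: "\<not> singular_cubic P" and T: "T \<in> fano P"
  obtains e f n1 n2 w w' where "is_basis T e f" "normal_frame P e f n1 n2 w w'"
proof -
  obtain e f where b: "is_basis T e f" using fano_is_basis[OF T] by blast
  define F where "F = (\<lambda>i::3. if i = 1 then P e e else if i = 2 then P e f else P f f)"
  have F: "F 1 = P e e" "F 2 = P e f" "F 3 = P f f" by (simp_all add: F_def)
  have Flin: "F i (x + y) = F i x + F i y" "F i (c *s x) = c * F i x" for i x y c
    unfolding F_def by (simp_all add: cubic_linear[OF P])
  show ?thesis
  proof (cases "\<forall>c. (\<forall>y. (\<Sum>i\<in>UNIV. c i * F i y) = 0) \<longrightarrow> (\<forall>i. c i = 0)")
    case True
    have "\<exists>w. \<forall>i j. F i (w j) = (if i = j then 1 else 0)"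
    proof (rule dual_vectors)
      show "\<forall>i. c i = 0" if "\<And>y. (\<Sum>i\<in>UNIV. c i * F i y) = 0" for c using True that by blast
    qed (rule Flin)+
    then obtain w where w: "\<And>i j. F i (w j) = (if i = j then 1 else 0)" by blast
    have "P e e (w 1) = 1" "P e f (w 1) = 0" "P f f (w 1) = 0" "P e e (w 3) = 0" "P e f (w 3) = 0" "P f f (w 3) = 1"
      unfolding F[symmetric] w by simp_all
    then show ?thesis using normal_frame_exists[OF P fanoD(2-4)[OF T b]] that[OF b] by blast
  next
    case False
    then obtain c where c: "\<And>y. c 1 * P e e y + c 2 * P e f y + c 3 * P f f y = 0" "\<not> (\<forall>i::3. c i = 0)"
      by (auto simp: sum_3 F)
    obtain k m n l where fac: "c 1 = k * m" "2 * (c 2 / 2) = k * n + l * m" "c 3 = l * n" "(k, l) \<noteq> (0, 0)"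
       "(m, n) \<noteq> (0, 0) \<or> (c 1, c 2 / 2, c 3) = (0, 0, 0)"
      by (rule binary_quadratic_factor[of "c 1" "c 2 / 2" "c 3"])
    have mn: "(m, n) \<noteq> (0, 0)" using fac(5) c(2) by (auto simp: forall_3)
    define e1 f1 where "e1 = k *s e + l *s f" and "f1 = m *s e + n *s f"
    have ind: "k *s e + l *s f = 0 \<Longrightarrow> k = 0 \<and> l = 0" for k l using b unfolding is_basis_iff by blast
    have z: "P e1 f1 y = 0" for y
    proof -
      have "2 * P e1 f1 y = 2 * (P e e y * (k * m) + P e f y * (k * n + l * m) + P f f y * (l * n))"
        unfolding e1_def f1_def cubic_pairs(2)[OF P] by simp
      also have "\<dots> = 2 * (c 1 * P e e y + c 2 * P e f y + c 3 * P f f y)"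
        unfolding fac(1,3) fac(2)[symmetric] by simp
      finally show ?thesis using c(1) by simp
    qed
    have nz: "e1 \<noteq> 0" "f1 \<noteq> 0" using ind fac(4) mn by (auto simp: e1_def f1_def)
    have d: "k * n - l * m \<noteq> 0"
    proof
      assume d: "k * n - l * m = 0"
      obtain s where s: "f1 = s *s e1"
      proof (cases "k = 0")
        case True
        then have "m = 0" "l \<noteq> 0" using d fac(4) by auto
        then show ?thesis using True by (intro that[of "n / l"]) (simp add: e1_def f1_def)
      next
        case False
        then have "n = m / k * l" using d by (simp add: field_simps)
        then show ?thesis using False
          by (intro that[of "m / k"]) (simp add: e1_def f1_def vec.scale_right_distrib)
      qed
      then have "s \<noteq> 0" using nz by auto
      then have "P e1 e1 y = 0" for y using z[of y] unfolding s cubic_linear[OF P] by simp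
      then show False using sm nz unfolding singular_cubic_def by blast
    qed
    have b1: "is_basis T e1 f1" unfolding e1_def f1_def by (rule is_basis_change[OF b d])
    have ind1: "k *s e1 + l *s f1 = 0 \<Longrightarrow> k = 0 \<and> l = 0" for k l using b1 unfolding is_basis_iff by blast
    define G where "G = (\<lambda>i::2. if i = 1 then P e1 e1 else P f1 f1)"
    have G: "G 1 = P e1 e1" "G 2 = P f1 f1" by (simp_all add: G_def)
    have Glin: "G i (x + y) = G i x + G i y" "G i (c *s x) = c * G i x" for i x y c
      unfolding G_def by (simp_all add: cubic_linear[OF P])
    have Gind: "\<forall>i. c i = 0" if c: "\<And>y. (\<Sum>i\<in>UNIV. c i * G i y) = 0" for c
    proof (rule ccontr)
      assume nc: "\<not> (\<forall>i. c i = 0)"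
      \<comment> \<open>As \<open>P e1 f1 = 0\<close>, the mixed term drops out and
        \<open>P x x\<close> is exactly the given vanishing combination of \<open>P e1 e1\<close>
        and \<open>P f1 f1\<close>.\<close>
      define x where "x = csqrt (c 1) *s e1 + csqrt (c 2) *s f1"
      have "x \<noteq> 0"
      proof
        assume "x = 0"
        then have "csqrt (c 1) = 0 \<and> csqrt (c 2) = 0" unfolding x_def by (rule ind1)
        then show False using nc by (simp add: forall_2)
      qed
      moreover have "P x x y = 0" for y
        unfolding x_def cubic_pairs(1)[OF P] z using c[of y] by (simp add: sum_2 G mult.commute)
      ultimately show False using sm unfolding singular_cubic_def by blast
    qed
    have "\<exists>w. \<forall>i j. G i (w j) = (if i = j then 1 else 0)"
      by (rule dual_vectors) (use Glin Gind in blast)+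
    then obtain w where w: "\<And>i j. G i (w j) = (if i = j then 1 else 0)" by blast
    have "P e1 e1 (w 1) = 1" "P f1 f1 (w 1) = 0" "P e1 e1 (w 2) = 0" "P f1 f1 (w 2) = 1"
      unfolding G[symmetric] w by simp_all
    then show ?thesis using normal_frame_exists[OF P fanoD(2-4)[OF T b1]] z that[OF b1] by blast
  qed
qed

section \<open>The identity for K and omega in an arbitrary frame\<close>

lemma tangent_fanoD:
  assumes "u \<in> tangent_fano P T"
  shows "Vector_Spaces.linear (*s) (*s) u" "u (x + y) = u x + u y" "u (c *s x) = c *s u x"
proof -
  show l: "Vector_Spaces.linear (*s) (*s) u" using assms unfolding tangent_fano_def by auto
  then interpret u: Vector_Spaces.linear "(*s)" "(*s)" u .
  show "u (x + y) = u x + u y" "u (c *s x) = c *s u x" by (rule u.add u.scale)+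
qed

text \<open>K and \<open>omega\<close> scale by the same cube under a change of the basis of T, and
  the residue form is invariant; so the identity may be checked in the adapted frame that a nonzero
  resultant provides.\<close>

lemma K_omega_frame_form:
  assumes P: "cubic P" and T: "T \<in> fano P" "is_basis T e f" and R: "frame_res P e f w w' \<noteq> 0"
    and u: "u \<in> tangent_fano P T" and v: "v \<in> tangent_fano P T"
  shows "3 * K_form e f u v = omega P e f u v * frame_form P e f w w' (u e) (u f) (v e) (v f)"
proof -
  obtain k l m n k' l' m' n' n1 n2 where d: "k * n - l * m \<noteq> 0" "k' * n' - l' * m' \<noteq> 0"
    and nf: "normal_frame P (k *s e + l *s f) (m *s e + n *s f) n1 n2 (k' *s w + l' *s w') (m' *s w + n' *s w')"
    by (rule frame_normalize[OF P T R])
  define e1 f1 w1 w1' where "e1 = k *s e + l *s f" and "f1 = m *s e + n *s f" and "w1 = k' *s w + l' *s w'" and "w1' = m' *s w + n' *s w'"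
  interpret normal_frame P e1 f1 n1 n2 w1 w1' using nf unfolding e1_def f1_def w1_def w1'_def .
  have b1: "is_basis T e1 f1" unfolding e1_def f1_def by (rule is_basis_change[OF T(2) d(1)])
  have "3 * K_form e1 f1 u v = omega P e1 f1 u v * frame_form P e1 f1 w1 w1' (u e1) (u f1) (v e1) (v f1)"
    using u v tangent_fano_span[OF P, of u e1 f1] tangent_fano_span[OF P, of v e1 f1]
      tangent_fanoD(1)[OF u] tangent_fanoD(1)[OF v] fanoD(1)[OF T(1) b1]
    by (intro K_normal) (auto simp: tangent_pair_def)
  moreover have "K_form e1 f1 u v = (k * n - l * m) ^ 3 * K_form e f u v"
    unfolding e1_def f1_def by (rule K_form_change_frame[OF tangent_fanoD(1)[OF u] tangent_fanoD(1)[OF v]])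
  moreover have "omega P e1 f1 u v = (k * n - l * m) ^ 3 * omega P e f u v"
    using u v fanoD(1)[OF T] unfolding e1_def f1_def by (intro omega_change_frame[OF P]) auto
  moreover have "frame_form P e1 f1 w1 w1' (u e1) (u f1) (v e1) (v f1) = frame_form P e f w w' (u e) (u f) (v e) (v f)"
    unfolding e1_def f1_def w1_def w1'_def tangent_fanoD(2,3)[OF u] tangent_fanoD(2,3)[OF v]
      frame_form_change_pencil[OF P d(2)] by (rule frame_form_change_frame[OF P d(1)])
  ultimately show ?thesis using d(1) by simp
qed

lemma frame_form_skew: "frame_form P e f w w' ue uf ve vf = - frame_form P e f w w' ve vf ue uf"
proof -
  have sw: "D6 e f ue ve w w' = - D6 e f ve ue w w'" "D6 e f ue vf w w' = - D6 e f vf ue w w'"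
    "D6 e f uf ve w w' = - D6 e f ve uf w w'" "D6 e f uf vf w w' = - D6 e f vf uf w w'"
    by (rule D6_swap(3))+
  have "frame_num P e f w w' ue uf ve vf = - frame_num P e f w w' ve vf ue uf"
    unfolding frame_num_def det3_def sw by algebra
  then show ?thesis unfolding frame_form_def by simp
qed

lemma frame_form_linear:
  "frame_form P e f w w' (ue + xe) (uf + xf) ve vf = frame_form P e f w w' ue uf ve vf + frame_form P e f w w' xe xf ve vf"
  "frame_form P e f w w' (c *s ue) (c *s uf) ve vf = c * frame_form P e f w w' ue uf ve vf"
proof -
  have "frame_num P e f w w' (ue + xe) (uf + xf) ve vf = frame_num P e f w w' ue uf ve vf + frame_num P e f w w' xe xf ve vf"
    "frame_num P e f w w' (c *s ue) (c *s uf) ve vf = c * frame_num P e f w w' ue uf ve vf"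
    unfolding frame_num_def D6_add D6_scale det3_def by algebra+
  then show
    "frame_form P e f w w' (ue + xe) (uf + xf) ve vf = frame_form P e f w w' ue uf ve vf + frame_form P e f w w' xe xf ve vf"
    "frame_form P e f w w' (c *s ue) (c *s uf) ve vf = c * frame_form P e f w w' ue uf ve vf"
    unfolding frame_form_def by (simp_all add: add_divide_distrib)
qed

lemma frame_form_span:
  assumes "xe \<in> vec.span {e, f}" "xf \<in> vec.span {e, f}"
  shows "frame_form P e f w w' xe xf ve vf = 0"
proof -
  have "D6 e f x y w w' = 0" if "x \<in> vec.span {e, f}" for x y
    using that by (auto simp: span_pair D6_add D6_scale)
  with assms show ?thesis unfolding frame_form_def frame_num_def det3_def by simp
qed

lemma frame_form_cong:
  assumes "ue - xe \<in> vec.span {e, f}" "uf - xf \<in> vec.span {e, f}" "ve - ye \<in> vec.span {e, f}" "vf - yf \<in> vec.span {e, f}"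
  shows "frame_form P e f w w' ue uf ve vf = frame_form P e f w w' xe xf ye yf"
proof -
  have *: "frame_form P e f w w' ue uf ve vf = frame_form P e f w w' xe xf ve vf"
    if "ue - xe \<in> vec.span {e, f}" "uf - xf \<in> vec.span {e, f}" for ue xe uf xf ve vf
    using frame_form_linear(1)[of P e f w w' "ue - xe" xe "uf - xf" xf ve vf] frame_form_span[OF that] by simp
  show ?thesis
    using *[OF assms(1,2)] *[OF assms(3,4), of xe xf] frame_form_skew[of P e f w w' xe xf ve vf]
      frame_form_skew[of P e f w w' xe xf ye yf] by simp
qed

lemma linear_extension_pair:
  assumes "is_basis T e f"
  shows "\<exists>u. Vector_Spaces.linear (*s) (*s) u \<and> u e = p \<and> u f = (q :: V)"
proof -
  have ind: "vec.independent {e, f}" "e \<noteq> f" using assms unfolding is_basis_def by auto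
  obtain u where "Vector_Spaces.linear (*s) (*s) u" "\<forall>x\<in>{e, f}. u x = (if x = e then p else q)"
    using vec.linear_independent_extend[OF ind(1), of "\<lambda>x. if x = e then p else q"] by blast
  then show ?thesis using ind(2) by (intro exI[of _ u]) auto
qed

section \<open>Tangent vectors in an adapted frame\<close>

context normal_frame
begin

lemma is_basis_normal: "is_basis (vec.span {e, f}) e f"
proof -
  have "k = 0 \<and> l = 0" if "k *s e + l *s f = 0" for k l
    using arg_cong[OF that, of co1] arg_cong[OF that, of co2] by (simp add: co_linear) (simp add: co1_def co2_def)
  then show ?thesis unfolding is_basis_iff by blast
qed

lemma span_frame_iff: "y \<in> vec.span {e, f} \<longleftrightarrow> co3 y = 0 \<and> co4 y = 0 \<and> P e e y = 0 \<and> P f f y = 0"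
proof
  assume "y \<in> vec.span {e, f}"
  then obtain k l where y: "y = k *s e + l *s f" unfolding span_pair by blast
  show "co3 y = 0 \<and> co4 y = 0 \<and> P e e y = 0 \<and> P f f y = 0"
    using line cubicD(1,2)[OF cubic] unfolding y by (simp add: co_linear cubic_linear[OF cubic])
next
  assume "co3 y = 0 \<and> co4 y = 0 \<and> P e e y = 0 \<and> P f f y = 0"
  then have "y = co1 y *s e + co2 y *s f" using coords[of y] by simp
  then show "y \<in> vec.span {e, f}" unfolding span_pair by blast
qed

lemma tangent_fano_iff:
  assumes "Vector_Spaces.linear (*s) (*s) u"
  shows "u \<in> tangent_fano P (vec.span {e, f}) \<longleftrightarrow> tangent_pair (u e) (u f)"
  unfolding tangent_fano_span[OF cubic assms] tangent_pair_def ..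

text \<open>The coordinates of tangent vectors along \<open>n1\<close>, \<open>n2\<close> are free, and determine the others.\<close>

definition "par x3 x4 y3 y4 = x3 *s n1 + x4 *s n2 + (- 2 * (beta1 * y3 + beta2 * y4)) *s w'"
definition "par' x3 x4 y3 y4 = y3 *s n1 + y4 *s n2 + (- 2 * (beta1 * x3 + beta2 * x4)) *s w"

lemma par_coords:
  "co3 (par x3 x4 y3 y4) = x3" "co4 (par x3 x4 y3 y4) = x4" "co3 (par' x3 x4 y3 y4) = y3" "co4 (par' x3 x4 y3 y4) = y4"
  "co1 (par x3 x4 y3 y4) = 0" "co2 (par x3 x4 y3 y4) = 0" "co1 (par' x3 x4 y3 y4) = 0" "co2 (par' x3 x4 y3 y4) = 0"
  unfolding par_def par'_def by (simp_all only: co_linear co_basis) simp_all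

lemma tangent_pair_par: "tangent_pair (par x3 x4 y3 y4) (par' x3 x4 y3 y4)"
  unfolding tangent_pair_def P_e_f par_coords unfolding par_def par'_def cubic_linear[OF cubic]
  using w w' n by simp

lemma tangent_pair_eq_span:
  assumes "tangent_pair p q" "tangent_pair p' q'" "co3 p = co3 p'" "co4 p = co4 p'" "co3 q = co3 q'" "co4 q = co4 q'"
  shows "p - p' \<in> vec.span {e, f}" "q - q' \<in> vec.span {e, f}"
proof -
  have *: "y - z \<in> vec.span {e, f}" if "co3 y = co3 z" "co4 y = co4 z" "P e e y = P e e z" "P f f y = P f f z" for y z
  proof -
    have "y - z = co1 y *s e + co2 y *s f - (co1 z *s e + co2 z *s f)"
      using coords[of y] coords[of z] that by (metis add_diff_cancel_right)
    also have "\<dots> = (co1 y - co1 z) *s e + (co2 y - co2 z) *s f" by (simp add: vec_eq_iff algebra_simps)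
    finally show ?thesis unfolding span_pair by blast
  qed
  have "P e f p = P e f p'" "P e f q = P e f q'" unfolding P_e_f using assms by simp_all
  then show "p - p' \<in> vec.span {e, f}" "q - q' \<in> vec.span {e, f}"
    using assms unfolding tangent_pair_def by (auto intro!: *)
qed

text \<open>In the four free coordinates the residue form is \<open>D0\<close> times a standard
  symplectic form on a four-dimensional space; testing against the four coordinate vectors isolates
  each coordinate.\<close>

lemma frame_form_nondegenerate:
  assumes "tangent_pair p q" "\<And>p' q'. tangent_pair p' q' \<Longrightarrow> frame_form P e f w w' p q p' q' = 0"
  shows "p \<in> vec.span {e, f}" "q \<in> vec.span {e, f}"
proof -
  have *: "D0 * (co3 p * y4 - co4 p * y3 + co3 q * x4 - co4 q * x3) = 0" for x3 x4 y3 y4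
    using assms(2)[OF tangent_pair_par[of x3 x4 y3 y4]] unfolding frame_form_normal par_coords .
  have "co3 p = 0" "co4 p = 0" "co3 q = 0" "co4 q = 0"
    using *[of 0 0 0 1] *[of 0 0 1 0] *[of 0 1 0 0] *[of 1 0 0 0] basis by simp_all
  moreover have "tangent_pair 0 0" unfolding tangent_pair_def using cubic_zero[OF cubic] by simp
  moreover have "co3 0 = 0" "co4 0 = 0" by (simp_all add: co3_def co4_def)
  ultimately show "p \<in> vec.span {e, f}" "q \<in> vec.span {e, f}"
    using tangent_pair_eq_span[OF assms(1), of 0 0] by auto
qed

text \<open>Two pairs of coordinate tangent vectors turn the reduced form of \<open>omega\<close>
  into 12 times the square of \<open>beta1\<close>, respectively of \<open>beta2\<close>.\<close>

lemma omega_zero_imp: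
  assumes "\<And>u v. u \<in> tangent_fano P (vec.span {e, f}) \<Longrightarrow> v \<in> tangent_fano P (vec.span {e, f}) \<Longrightarrow> omega P e f u v = 0"
  shows "P e f y = 0"
proof -
  have *: "P e f p * P e f q' - P e f q * P e f p' = 0" if t: "tangent_pair p q" "tangent_pair p' q'" for p q p' q'
  proof -
    obtain u v where u: "Vector_Spaces.linear (*s) (*s) u" "u e = p" "u f = q" and v: "Vector_Spaces.linear (*s) (*s) v" "v e = p'" "v f = q'"
      using linear_extension_pair[OF is_basis_normal] by metis
    have "omega P e f u v = 12 * (P e f (u e) * P e f (v f) - P e f (u f) * P e f (v e))"
      by (rule omega_reduced) (use t u v in \<open>auto simp: tangent_pair_def\<close>)
    moreover have "omega P e f u v = 0"
      using assms u v t by (simp add: tangent_fano_iff)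
    ultimately show ?thesis by (simp add: u v)
  qed
  have "beta1 * beta1 = 0"
    using *[OF tangent_pair_par[of 1 0 0 0] tangent_pair_par[of 0 0 1 0]] unfolding P_e_f par_coords by simp
  moreover have "beta2 * beta2 = 0"
    using *[OF tangent_pair_par[of 0 1 0 0] tangent_pair_par[of 0 0 0 1]] unfolding P_e_f par_coords by simp
  ultimately show ?thesis unfolding P_e_f by simp
qed

end

section \<open>Charts of the Fano variety\<close>

lemma has_derivative_det:
  fixes A :: "'a::real_normed_vector \<Rightarrow> complex ^ 'n ^ 'n"
  assumes "\<And>i j. ((\<lambda>t. A t $ i $ j) has_derivative (\<lambda>h. A' h $ i $ j)) (at t)"
  shows "((\<lambda>t. det (A t)) has_derivative (\<lambda>h. \<Sum>i\<in>UNIV. det (\<chi> k. if k = i then A' h $ k else A t $ k))) (at t)"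
proof -
  have "((\<lambda>t. \<Sum>p\<in>{p. p permutes UNIV}. of_int (sign p) * (\<Prod>i\<in>UNIV. A t $ i $ p i)) has_derivative
     (\<lambda>h. \<Sum>p\<in>{p. p permutes UNIV}. of_int (sign p) * (\<Sum>i\<in>UNIV. A' h $ i $ p i * (\<Prod>j\<in>UNIV - {i}. A t $ j $ p j)))) (at t)"
    by (intro has_derivative_sum has_derivative_mult_right has_derivative_prod assms)
  moreover have "(\<Sum>p\<in>{p. p permutes UNIV}. of_int (sign p) * (\<Sum>i\<in>UNIV. A' h $ i $ p i * (\<Prod>j\<in>UNIV - {i}. A t $ j $ p j)))
     = (\<Sum>i\<in>UNIV. det (\<chi> k. if k = i then A' h $ k else A t $ k))" for h
  proof -
    have "(\<Prod>k\<in>UNIV. (\<chi> k. if k = i then A' h $ k else A t $ k) $ k $ p k) = A' h $ i $ p i * (\<Prod>j\<in>UNIV - {i}. A t $ j $ p j)"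
      for i and p :: "'n \<Rightarrow> 'n"
      by (subst prod.remove[of _ i]) (auto intro!: prod.cong)
    then have "(\<Sum>i\<in>UNIV. det (\<chi> k. if k = i then A' h $ k else A t $ k)) =
       (\<Sum>i\<in>UNIV. \<Sum>p\<in>{p. p permutes UNIV}. of_int (sign p) * (A' h $ i $ p i * (\<Prod>j\<in>UNIV - {i}. A t $ j $ p j)))"
      unfolding det_def by (simp only:)
    then show ?thesis by (simp add: sum_distrib_left sum.swap[of _ _ UNIV])
  qed
  ultimately show ?thesis unfolding det_def by simp
qed

lemma has_derivative_D6:
  fixes a :: "'a::real_normed_vector \<Rightarrow> V"
  assumes "(a has_derivative a') (at t)" "(b has_derivative b') (at t)" "(c has_derivative c') (at t)"
    "(d has_derivative d') (at t)" "(p has_derivative p') (at t)" "(q has_derivative q') (at t)"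
  shows "((\<lambda>t. D6 (a t) (b t) (c t) (d t) (p t) (q t)) has_derivative (\<lambda>h.
    D6 (a' h) (b t) (c t) (d t) (p t) (q t) + D6 (a t) (b' h) (c t) (d t) (p t) (q t) +
    D6 (a t) (b t) (c' h) (d t) (p t) (q t) + D6 (a t) (b t) (c t) (d' h) (p t) (q t) +
    D6 (a t) (b t) (c t) (d t) (p' h) (q t) + D6 (a t) (b t) (c t) (d t) (p t) (q' h))) (at t)"
proof -
  define A :: "'a \<Rightarrow> complex ^ 6 ^ 6" where "A = (\<lambda>t. vector [a t, b t, c t, d t, p t, q t])"
  define A' :: "'a \<Rightarrow> complex ^ 6 ^ 6" where "A' = (\<lambda>h. vector [a' h, b' h, c' h, d' h, p' h, q' h])"
  have comp: "((\<lambda>t. x t $ j) has_derivative (\<lambda>h. x' h $ j)) (at t)" if "(x has_derivative x') (at t)"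
    for x x' :: "'a \<Rightarrow> V" and j
    using bounded_linear.has_derivative[OF bounded_linear_vec_nth that] .
  have "\<forall>i. \<forall>j. ((\<lambda>t. A t $ i $ j) has_derivative (\<lambda>h. A' h $ i $ j)) (at t)"
    unfolding forall_6[where Q = "\<lambda>i. \<forall>j. ((\<lambda>t. A t $ i $ j) has_derivative (\<lambda>h. A' h $ i $ j)) (at t)"]
    by (simp only: A_def A'_def vector_6 comp[OF assms(1)] comp[OF assms(2)] comp[OF assms(3)] comp[OF assms(4)] comp[OF assms(5)] comp[OF assms(6)] simp_thms)
  then have "((\<lambda>t. det (A t)) has_derivative (\<lambda>h. \<Sum>i\<in>UNIV. det (\<chi> k. if k = i then A' h $ k else A t $ k))) (at t)"
    by (intro has_derivative_det) blast
  moreover have "(\<chi> k. if k = 1 then A' h $ k else A t $ k) = vector [a' h, b t, c t, d t, p t, q t]"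
    "(\<chi> k. if k = 2 then A' h $ k else A t $ k) = vector [a t, b' h, c t, d t, p t, q t]"
    "(\<chi> k. if k = 3 then A' h $ k else A t $ k) = vector [a t, b t, c' h, d t, p t, q t]"
    "(\<chi> k. if k = 4 then A' h $ k else A t $ k) = vector [a t, b t, c t, d' h, p t, q t]"
    "(\<chi> k. if k = 5 then A' h $ k else A t $ k) = vector [a t, b t, c t, d t, p' h, q t]"
    "(\<chi> k. if k = 6 then A' h $ k else A t $ k) = vector [a t, b t, c t, d t, p t, q' h]" for h
    unfolding vec_eq_iff[of "\<chi> k. _ k"] forall_6 by (simp_all add: A_def A'_def)
  ultimately show ?thesis unfolding sum_6 D6_def by (simp add: A_def)
qed

lemma has_derivative_cubic:
  fixes x :: "'a::real_normed_vector \<Rightarrow> V"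
  assumes P: "cubic P" and "(x has_derivative x') (at t)" "(y has_derivative y') (at t)" "(z has_derivative z') (at t)"
  shows "((\<lambda>t. P (x t) (y t) (z t)) has_derivative (\<lambda>h. P (x' h) (y t) (z t) + P (x t) (y' h) (z t) + P (x t) (y t) (z' h))) (at t)"
proof -
  have comp: "((\<lambda>t. x t $ j) has_derivative (\<lambda>h. x' h $ j)) (at t)" if "(x has_derivative x') (at t)"
    for x x' :: "'a \<Rightarrow> V" and j
    using bounded_linear.has_derivative[OF bounded_linear_vec_nth that] .
  have "((\<lambda>t. \<Sum>i\<in>UNIV. \<Sum>j\<in>UNIV. \<Sum>k\<in>UNIV. x t $ i * y t $ j * z t $ k * cubic_coeff P {#i, j, k#}) has_derivative
    (\<lambda>h. \<Sum>i\<in>UNIV. \<Sum>j\<in>UNIV. \<Sum>k\<in>UNIV. ((x t $ i * y t $ j) * z' h $ k + (x t $ i * y' h $ j + x' h $ i * y t $ j) * z t $ k) * cubic_coeff P {#i, j, k#})) (at t)"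
    by (intro has_derivative_sum has_derivative_mult_left has_derivative_mult comp assms)
  moreover have "(\<Sum>i\<in>UNIV. \<Sum>j\<in>UNIV. \<Sum>k\<in>UNIV. ((x t $ i * y t $ j) * z' h $ k + (x t $ i * y' h $ j + x' h $ i * y t $ j) * z t $ k) * cubic_coeff P {#i, j, k#})
     = P (x' h) (y t) (z t) + P (x t) (y' h) (z t) + P (x t) (y t) (z' h)" for h
  proof -
    note ex = cubic_expand[OF P, of "x' h" "y t" "z t"] cubic_expand[OF P, of "x t" "y' h" "z t"] cubic_expand[OF P, of "x t" "y t" "z' h"]
    show ?thesis unfolding ex sum.distrib[symmetric] by (intro sum.cong refl) algebra
  qed
  moreover have "(\<lambda>t. P (x t) (y t) (z t)) = (\<lambda>t. \<Sum>i\<in>UNIV. \<Sum>j\<in>UNIV. \<Sum>k\<in>UNIV. x t $ i * y t $ j * z t $ k * cubic_coeff P {#i, j, k#})"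
    by (rule ext) (rule cubic_expand[OF P])
  ultimately show ?thesis by (simp only:)
qed

lemma holomorphic_C4_D6:
  assumes "holomorphic_vec U a" "holomorphic_vec U b" "holomorphic_vec U c" "holomorphic_vec U d" "holomorphic_vec U p" "holomorphic_vec U q"
  shows "holomorphic_C4 U (\<lambda>t. D6 (a t) (b t) (c t) (d t) (p t) (q t))"
proof (rule holomorphic_C4I, intro exI conjI allI)
  fix t assume t: "t \<in> U"
  show "((\<lambda>t. D6 (a t) (b t) (c t) (d t) (p t) (q t)) has_derivative (\<lambda>h.
    D6 (dird a h t) (b t) (c t) (d t) (p t) (q t) + D6 (a t) (dird b h t) (c t) (d t) (p t) (q t) +
    D6 (a t) (b t) (dird c h t) (d t) (p t) (q t) + D6 (a t) (b t) (c t) (dird d h t) (p t) (q t) +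
    D6 (a t) (b t) (c t) (d t) (dird p h t) (q t) + D6 (a t) (b t) (c t) (d t) (p t) (dird q h t))) (at t)"
    by (rule has_derivative_D6; rule holomorphic_vec_has_derivative(1)[OF _ t]; fact)
qed (simp add: dird_vec_linear(2)[OF assms(1)] dird_vec_linear(2)[OF assms(2)] dird_vec_linear(2)[OF assms(3)]
    dird_vec_linear(2)[OF assms(4)] dird_vec_linear(2)[OF assms(5)] dird_vec_linear(2)[OF assms(6)] D6_scale algebra_simps)

lemma holomorphic_C4_cubic:
  assumes P: "cubic P" and "holomorphic_vec U x" "holomorphic_vec U y" "holomorphic_vec U z"
  shows "holomorphic_C4 U (\<lambda>t. P (x t) (y t) (z t))"
proof (rule holomorphic_C4I, intro exI conjI allI)
  fix t assume t: "t \<in> U"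
  show "((\<lambda>t. P (x t) (y t) (z t)) has_derivative (\<lambda>h. P (dird x h t) (y t) (z t) + P (x t) (dird y h t) (z t) + P (x t) (y t) (dird z h t))) (at t)"
    by (rule has_derivative_cubic[OF P]; rule holomorphic_vec_has_derivative(1)[OF _ t]; fact)
qed (simp add: dird_vec_linear(2)[OF assms(2)] dird_vec_linear(2)[OF assms(3)] dird_vec_linear(2)[OF assms(4)]
    cubicD(4)[OF P] cubic_linear[OF P] algebra_simps)

lemma frame_num_holomorphic:
  assumes P: "cubic P" and "holomorphic_vec U e" "holomorphic_vec U f" "holomorphic_vec U ue" "holomorphic_vec U uf" "holomorphic_vec U ve" "holomorphic_vec U vf"
  shows "holomorphic_C4 U (\<lambda>t. frame_num P (e t) (f t) w w' (ue t) (uf t) (ve t) (vf t))"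
  unfolding frame_num_def det3_def
  by (intro holomorphic_C4_add holomorphic_C4_diff holomorphic_C4_mult holomorphic_C4_const holomorphic_C4_cubic[OF P]
      holomorphic_C4_D6 holomorphic_vec_const assms)

lemma frame_res_holomorphic:
  assumes P: "cubic P" and "holomorphic_vec U e" "holomorphic_vec U f"
  shows "holomorphic_C4 U (\<lambda>t. frame_res P (e t) (f t) w w')"
  unfolding frame_res_def resultant2_def power2_eq_square
  by (intro holomorphic_C4_add holomorphic_C4_diff holomorphic_C4_mult holomorphic_C4_const holomorphic_C4_cubic[OF P]
      holomorphic_vec_const assms)

lemma frame_form_holomorphic:
  assumes P: "cubic P" and "holomorphic_vec U e" "holomorphic_vec U f" "holomorphic_vec U ue" "holomorphic_vec U uf" "holomorphic_vec U ve" "holomorphic_vec U vf"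
    and "\<And>t. t \<in> U \<Longrightarrow> frame_res P (e t) (f t) w w' \<noteq> 0"
  shows "holomorphic_C4 U (\<lambda>t. frame_form P (e t) (f t) w w' (ue t) (uf t) (ve t) (vf t))"
  unfolding frame_form_def by (intro holomorphic_C4_divide frame_num_holomorphic frame_res_holomorphic assms)

lemma hom_eq_iff:
  assumes "is_basis T e f" "Vector_Spaces.linear (*s) (*s) u" "Vector_Spaces.linear (*s) (*s) v"
  shows "hom_eq T u v \<longleftrightarrow> u e - v e \<in> T \<and> u f - v f \<in> T"
proof -
  interpret u: Vector_Spaces.linear "(*s)" "(*s)" u by fact
  interpret v: Vector_Spaces.linear "(*s)" "(*s)" v by fact
  have T: "T = vec.span {e, f}" using assms(1) unfolding is_basis_def by auto
  have "u (k *s e + l *s f) - v (k *s e + l *s f) = k *s (u e - v e) + l *s (u f - v f)" for k l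
    by (simp add: u.add v.add u.scale v.scale vec_eq_iff algebra_simps)
  note lin = this
  have "u x - v x \<in> T" if uv: "u e - v e \<in> T" "u f - v f \<in> T" "x \<in> T" for x
  proof -
    obtain k l where x: "x = k *s e + l *s f" using uv(3) unfolding T span_pair by blast
    show ?thesis unfolding x lin using uv(1,2) unfolding T by (intro vec.span_add vec.span_scale)
  qed
  moreover have "e \<in> T" "f \<in> T" unfolding T by (simp_all add: vec.span_base)
  ultimately show ?thesis unfolding hom_eq_def by blast
qed

lemma line_deriv_spec:
  assumes "is_basis (line_at e f t) (e t) (f t)"
  shows "Vector_Spaces.linear (*s) (*s) (line_deriv e f t \<xi>)"
    "line_deriv e f t \<xi> (e t) = dird e \<xi> t" "line_deriv e f t \<xi> (f t) = dird f \<xi> t"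
proof -
  let ?Q = "\<lambda>u. Vector_Spaces.linear (*s) (*s) u \<and> u (e t) = dird e \<xi> t \<and> u (f t) = dird f \<xi> t"
  have "?Q (line_deriv e f t \<xi>)"
    unfolding line_deriv_def using linear_extension_pair[OF assms] by (rule someI_ex)
  then show "Vector_Spaces.linear (*s) (*s) (line_deriv e f t \<xi>)"
    "line_deriv e f t \<xi> (e t) = dird e \<xi> t" "line_deriv e f t \<xi> (f t) = dird f \<xi> t" by auto
qed

lemma tangent_fano_closed:
  assumes P: "cubic P" and "u \<in> tangent_fano P T" "v \<in> tangent_fano P T"
  shows "(\<lambda>x. u x + v x) \<in> tangent_fano P T" "(\<lambda>x. c *s u x) \<in> tangent_fano P T"
proof -
  have "Vector_Spaces.linear (*s) (*s) (\<lambda>x. u x + v x)" "Vector_Spaces.linear (*s) (*s) (\<lambda>x. c *s u x)"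
    unfolding complex_linear_vec_iff tangent_fanoD(2,3)[OF assms(2)] tangent_fanoD(2,3)[OF assms(3)]
    by (simp_all add: vec_eq_iff algebra_simps)
  then show "(\<lambda>x. u x + v x) \<in> tangent_fano P T" "(\<lambda>x. c *s u x) \<in> tangent_fano P T"
    using assms(2,3) unfolding tangent_fano_def by (auto simp: cubic_linear[OF P])
qed

lemma cubic_zero_on_span:
  assumes P: "cubic P" and "\<And>x y z. x \<in> B \<Longrightarrow> y \<in> B \<Longrightarrow> z \<in> B \<Longrightarrow> P x y z = 0"
    and "x \<in> vec.span B" "y \<in> vec.span B" "z \<in> vec.span B"
  shows "P x y z = 0"
proof -
  have sub: "vec.subspace {x. P x y z = 0}" "vec.subspace {y. P x y z = 0}" "vec.subspace {z. P x y z = 0}" for x y z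
    by (auto simp: vec.subspace_def cubic_zero[OF P] cubicD(3,4)[OF P] cubic_linear[OF P])
  have 1: "P x y z = 0" if "x \<in> vec.span B" "y \<in> B" "z \<in> B" for x y z
    using vec.span_minimal[OF _ sub(1), of B y z] assms(2) that by blast
  have 2: "P x y z = 0" if "x \<in> vec.span B" "y \<in> vec.span B" "z \<in> B" for x y z
    using vec.span_minimal[OF _ sub(2), of B x z] 1 that by blast
  show ?thesis using vec.span_minimal[OF _ sub(3), of B x y] 2 assms(3-5) by blast
qed

text \<open>The ingredients of the quotient rule at a point where A and B are the two squares. The
  normalization is required at that point only, while the derivatives of A and B there remain
  arbitrary.\<close>

lemma has_derivative_det3_normal:
  fixes a0 :: "'a::real_normed_vector \<Rightarrow> complex"
  assumes "(a0 has_derivative a0') (at t)" "(a1 has_derivative a1') (at t)" "(a2 has_derivative a2') (at t)"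
    "(g0 has_derivative g0') (at t)" "(g1 has_derivative g1') (at t)" "(g2 has_derivative g2') (at t)"
    "(b0 has_derivative b0') (at t)" "(b1 has_derivative b1') (at t)" "(b2 has_derivative b2') (at t)"
    and "a0 t = 1" "a1 t = 0" "a2 t = 0" "b0 t = 0" "b1 t = 0" "b2 t = 1"
  shows "((\<lambda>t. det3 (a0 t) (a1 t) (a2 t) (g0 t) (g1 t) (g2 t) (b0 t) (b1 t) (b2 t)) has_derivative
      (\<lambda>h. g1' h + a0' h * g1 t + b2' h * g1 t - a1' h * g0 t - b1' h * g2 t)) (at t)"
    and "((\<lambda>t. resultant2 (a0 t) (a1 t) (a2 t) (b0 t) (b1 t) (b2 t)) has_derivative (\<lambda>h. 2 * (a0' h + b2' h))) (at t)"
  unfolding det3_def resultant2_def power2_eq_square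
  by (auto intro!: derivative_eq_intros assms(1-9) simp: assms(10-15) algebra_simps)

section \<open>Charts and tangent spaces\<close>

locale fano_chart_locale =
  fixes P U e f
  assumes cubic: "cubic P" and smooth: "\<not> singular_cubic P" and chart: "fano_chart P U e f"
begin

lemma chartD:
  "open U" "holomorphic_vec U e" "holomorphic_vec U f"
  "t \<in> U \<Longrightarrow> is_basis (line_at e f t) (e t) (f t)" "t \<in> U \<Longrightarrow> line_at e f t \<in> fano P"
  "t \<in> U \<Longrightarrow> hom_eq (line_at e f t) (line_deriv e f t \<xi>) (\<lambda>x. 0) \<Longrightarrow> \<xi> = 0"
  using chart unfolding fano_chart_def holomorphic_vec_def by blast+

lemma line_deriv:
  assumes "t \<in> U"
  shows "Vector_Spaces.linear (*s) (*s) (line_deriv e f t \<xi>)"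
    "line_deriv e f t \<xi> (k *s e t + l *s f t) = k *s dird e \<xi> t + l *s dird f \<xi> t"
  using line_deriv_spec[OF chartD(4)[OF assms], of \<xi>] unfolding complex_linear_vec_iff by auto

lemma line_deriv_simps:
  assumes "t \<in> U"
  shows "line_deriv e f t \<xi> (e t) = dird e \<xi> t" "line_deriv e f t \<xi> (f t) = dird f \<xi> t"
  by (rule line_deriv_spec[OF chartD(4)[OF assms]])+

lemma vanishing:
  assumes "t \<in> U" "x \<in> line_at e f t"
  shows "P x x x = 0"
  using chartD(5)[OF assms(1)] assms(2) unfolding fano_def by blast

lemma vanishing_frame:
  assumes "t \<in> U"
  shows "P (e t) (e t) (e t) = 0" "P (e t) (e t) (f t) = 0" "P (e t) (f t) (f t) = 0" "P (f t) (f t) (f t) = 0"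
  using vanishing_on_line[OF cubic, of "e t" "f t"] vanishing[OF assms] unfolding line_at_def by auto

text \<open>Differentiating the four identities of \<open>vanishing_frame\<close> along the chart
  gives the four conditions of \<open>tangent_fano_span\<close>.\<close>

lemma line_deriv_tangent:
  assumes t: "t \<in> U"
  shows "line_deriv e f t \<xi> \<in> tangent_fano P (line_at e f t)"
proof -
  note De = holomorphic_vec_has_derivative(1)[OF chartD(2) t] and Df = holomorphic_vec_has_derivative(1)[OF chartD(3) t]
  have z: "D \<xi> = 0" if "(g has_derivative D) (at t)" "\<And>s. s \<in> U \<Longrightarrow> g s = 0" for g :: "complex ^ 4 \<Rightarrow> complex" and D
  proof -
    have "((\<lambda>_. 0) has_derivative D) (at t)"
      using that(1) chartD(1) t by (rule has_derivative_transform_within_open) (simp add: that(2))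
    then have "D = (\<lambda>_. 0)" using has_derivative_const has_derivative_unique by metis
    then show ?thesis by simp
  qed
  define u where "u = line_deriv e f t \<xi>"
  have u: "u (e t) = dird e \<xi> t" "u (f t) = dird f \<xi> t" unfolding u_def using line_deriv_simps[OF t] by auto
  note c = cubicD(1,2)[OF cubic]
  have "P (u (e t)) (e t) (e t) + P (e t) (u (e t)) (e t) + P (e t) (e t) (u (e t)) = 0"
    unfolding u by (rule z[OF has_derivative_cubic[OF cubic De De De]]) (rule vanishing_frame)
  moreover have "P (u (e t)) (e t) (e t) = P (e t) (e t) (u (e t))" "P (e t) (u (e t)) (e t) = P (e t) (e t) (u (e t))"
    using c by metis+
  ultimately have 1: "P (e t) (e t) (u (e t)) = 0" by simp
  have "P (u (e t)) (e t) (f t) + P (e t) (u (e t)) (f t) + P (e t) (e t) (u (f t)) = 0"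
    unfolding u by (rule z[OF has_derivative_cubic[OF cubic De De Df]]) (rule vanishing_frame)
  moreover have "P (u (e t)) (e t) (f t) = P (e t) (f t) (u (e t))" "P (e t) (u (e t)) (f t) = P (e t) (f t) (u (e t))"
    using c by metis+
  ultimately have 2: "P (e t) (e t) (u (f t)) = - 2 * P (e t) (f t) (u (e t))" by (simp add: add_eq_0_iff)
  have "P (u (e t)) (f t) (f t) + P (e t) (u (f t)) (f t) + P (e t) (f t) (u (f t)) = 0"
    unfolding u by (rule z[OF has_derivative_cubic[OF cubic De Df Df]]) (rule vanishing_frame)
  moreover have "P (u (e t)) (f t) (f t) = P (f t) (f t) (u (e t))" "P (e t) (u (f t)) (f t) = P (e t) (f t) (u (f t))"
    using c by metis+
  ultimately have 3: "P (f t) (f t) (u (e t)) = - 2 * P (e t) (f t) (u (f t))" by (simp add: add_eq_0_iff2)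
  have "P (u (f t)) (f t) (f t) + P (f t) (u (f t)) (f t) + P (f t) (f t) (u (f t)) = 0"
    unfolding u by (rule z[OF has_derivative_cubic[OF cubic Df Df Df]]) (rule vanishing_frame)
  moreover have "P (u (f t)) (f t) (f t) = P (f t) (f t) (u (f t))" "P (f t) (u (f t)) (f t) = P (f t) (f t) (u (f t))"
    using c by metis+
  ultimately have 4: "P (f t) (f t) (u (f t)) = 0" by simp
  have "u \<in> tangent_fano P (vec.span {e t, f t})"
    unfolding tangent_fano_span[OF cubic line_deriv(1)[OF t, of \<xi>, folded u_def]] using 1 2 3 4 by blast
  then show ?thesis unfolding u_def line_at_def .
qed

text \<open>A dimension count: in an adapted frame a tangent vector modulo T is given by four
  coordinates, so the derivative of the chart becomes a linear endomorphism of a four-dimensional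
  space. It is injective because the chart is an immersion, hence surjective.\<close>

lemma line_deriv_surj:
  assumes t: "t \<in> U" and u: "u \<in> tangent_fano P (line_at e f t)"
  shows "\<exists>\<xi>. hom_eq (line_at e f t) u (line_deriv e f t \<xi>)"
proof -
  obtain a b n1 n2 w w' where fr: "is_basis (line_at e f t) a b" "normal_frame P a b n1 n2 w w'"
    using smooth_normal_frame[OF cubic smooth chartD(5)[OF t]] .
  interpret N: normal_frame P a b n1 n2 w w' by fact
  have T: "line_at e f t = vec.span {a, b}" using fr(1) unfolding is_basis_def by simp
  obtain k l m n where ab: "a = k *s e t + l *s f t" "b = m *s e t + n *s f t"
    using is_basis_unique[OF chartD(4)[OF t] fr(1)] by metis
  define G :: "(V \<Rightarrow> V) \<Rightarrow> complex ^ 4" where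
    "G = (\<lambda>u. \<chi> i. if i = 1 then N.co3 (u a) else if i = 2 then N.co4 (u a) else if i = 3 then N.co3 (u b) else N.co4 (u b))"
  have G_iff: "hom_eq (line_at e f t) u v" if uv: "u \<in> tangent_fano P (line_at e f t)" "v \<in> tangent_fano P (line_at e f t)" "G u = G v" for u v
  proof -
    have g: "N.co3 (u a) = N.co3 (v a)" "N.co4 (u a) = N.co4 (v a)" "N.co3 (u b) = N.co3 (v b)" "N.co4 (u b) = N.co4 (v b)"
      using uv(3) unfolding G_def vec_eq_iff forall_4 by simp_all
    have "N.tangent_pair (u a) (u b)" "N.tangent_pair (v a) (v b)"
      using uv(1,2) N.tangent_fano_iff tangent_fanoD(1) unfolding T by blast+
    from N.tangent_pair_eq_span[OF this g] have "u a - v a \<in> line_at e f t" "u b - v b \<in> line_at e f t"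
      unfolding T .
    then show ?thesis
      using hom_eq_iff[OF fr(1) tangent_fanoD(1)[OF uv(1)] tangent_fanoD(1)[OF uv(2)]] by blast
  qed
  define L where "L = (\<lambda>\<xi>. G (line_deriv e f t \<xi>))"
  have ld: "line_deriv e f t \<xi> a = k *s dird e \<xi> t + l *s dird f \<xi> t" "line_deriv e f t \<xi> b = m *s dird e \<xi> t + n *s dird f \<xi> t" for \<xi>
    unfolding ab line_deriv(2)[OF t] by simp_all
  have lin: "Vector_Spaces.linear (*s) (*s) L"
    unfolding complex_linear_vec_iff L_def G_def ld dird_vec_linear[OF chartD(2) t] dird_vec_linear[OF chartD(3) t]
    by (simp add: vec_eq_iff forall_4 N.co_linear algebra_simps)
  have "inj L"
  proof (rule injI)
    fix \<xi> \<eta> assume "L \<xi> = L \<eta>"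
    then have "L (\<xi> - \<eta>) = 0"
      using lin vec.linear_diff[OF lin] by simp
    moreover have "G (\<lambda>x. 0) = 0" unfolding G_def vec_eq_iff forall_4 by (simp add: N.co3_def N.co4_def)
    moreover have "(\<lambda>x. 0) \<in> tangent_fano P (line_at e f t)"
      using tangent_fano_closed(2)[OF cubic u u, of 0] by simp
    ultimately have "hom_eq (line_at e f t) (line_deriv e f t (\<xi> - \<eta>)) (\<lambda>x. 0)"
      unfolding L_def by (intro G_iff line_deriv_tangent t) auto
    then show "\<xi> = \<eta>" using chartD(6)[OF t] by fastforce
  qed
  then have "surj L" by (rule vec.linear_inj_imp_surj[OF lin])
  then obtain \<xi> where "L \<xi> = G u" by (metis surjD)
  then show ?thesis unfolding L_def by (intro exI[of _ \<xi>] G_iff u line_deriv_tangent t) simp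
qed

end

section \<open>Lines with vanishing omega\<close>

text \<open>Three binary quadratic forms apolar to one nonzero quadratic form are dependent. The
  form with factors \<open>(k, l)\<close> and \<open>(m, n)\<close> is nonzero because its
  discriminant is the square of \<open>k * n - l * m\<close>.\<close>

lemma det3_zero_if_apolar:
  assumes "a0 * (k * m) + a1 / 2 * (k * n + l * m) + a2 * (l * n) = 0"
    "g0 * (k * m) + g1 / 2 * (k * n + l * m) + g2 * (l * n) = 0"
    "b0 * (k * m) + b1 / 2 * (k * n + l * m) + b2 * (l * n) = 0"
    and d: "k * n - l * m \<noteq> (0 :: complex)"
  shows "det3 a0 a1 a2 g0 g1 g2 b0 b1 b2 = 0"
proof -
  define x y z where "x = k * m" and "y = (k * n + l * m) / 2" and "z = l * n"
  have h: "a0 * x + a1 * y + a2 * z = 0" "g0 * x + g1 * y + g2 * z = 0" "b0 * x + b1 * y + b2 * z = 0"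
    using assms(1-3) by (simp_all add: x_def y_def z_def)
  have "det3 a0 a1 a2 g0 g1 g2 b0 b1 b2 * x = 0" "det3 a0 a1 a2 g0 g1 g2 b0 b1 b2 * y = 0" "det3 a0 a1 a2 g0 g1 g2 b0 b1 b2 * z = 0"
    using h unfolding det3_def by algebra+
  moreover have "x \<noteq> 0 \<or> y \<noteq> 0 \<or> z \<noteq> 0"
  proof (rule ccontr)
    assume "\<not> (x \<noteq> 0 \<or> y \<noteq> 0 \<or> z \<noteq> 0)"
    moreover have "(k * n - l * m)\<^sup>2 = 4 * (y\<^sup>2 - x * z)" unfolding x_def y_def z_def by (simp add: power2_eq_square field_simps)
    ultimately show False using d by simp
  qed
  ultimately show ?thesis by auto
qed

text \<open>On the span of \<open>e\<close>, \<open>f\<close>, \<open>n1\<close>, \<open>n2\<close>,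
  the form \<open>P\<close> vanishes as soon as one argument is \<open>e\<close> or
  \<open>f\<close>. What is left is a binary cubic in \<open>n1\<close>, \<open>n2\<close>; a zero
  \<open>r\<close> of it spans a plane in the hypersurface together with the line.\<close>

lemma contains_plane_if_radical:
  assumes nf: "normal_frame P e f n1 n2 w w'" and b: "\<And>y. P e f y = 0"
    and rad: "\<And>x y. x \<in> {n1, n2} \<Longrightarrow> y \<in> {n1, n2} \<Longrightarrow> P e x y = 0 \<and> P f x y = 0"
  shows "contains_plane P"
proof -
  interpret normal_frame P e f n1 n2 w w' by fact
  note sym = cubicD(1,2)[OF cubic]
  obtain x1 x2 where x: "P (x1 *s n1 + x2 *s n2) (x1 *s n1 + x2 *s n2) (x1 *s n1 + x2 *s n2) = 0" "x1 \<noteq> 0 \<or> x2 \<noteq> 0"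
  proof (cases "P n2 n2 n2 = 0")
    case True
    then show ?thesis by (intro that[of 0 1]) simp_all
  next
    case False
    \<comment> \<open>The binary cubic in an affine coordinate; the zero at infinity was the
      previous case.\<close>
    define p where "p = [:P n1 n1 n1, 3 * P n1 n1 n2, 3 * P n1 n2 n2, P n2 n2 n2:]"
    have "degree p \<noteq> 0" using False by (simp add: p_def)
    then have "\<not> constant (poly p)" by (simp add: constant_degree)
    then obtain z where z: "poly p z = 0" using fundamental_theorem_of_algebra by blast
    have s: "P n2 n1 n1 = P n1 n1 n2" "P n1 n2 n1 = P n1 n1 n2" "P n2 n1 n2 = P n1 n2 n2" "P n2 n2 n1 = P n1 n2 n2"
      using sym by metis+
    have "P (1 *s n1 + z *s n2) (1 *s n1 + z *s n2) (1 *s n1 + z *s n2) = poly p z"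
      by (simp add: cubicD(3,4)[OF cubic] cubic_linear[OF cubic] p_def s algebra_simps)
    with z show ?thesis by (intro that[of 1 z]) simp_all
  qed
  define r where "r = x1 *s n1 + x2 *s n2"
  have r: "P r r r = 0" "P e r r = 0" "P f r r = 0" "P e e r = 0" "P f f r = 0"
    using x rad n unfolding r_def by (simp_all add: cubicD(3,4)[OF cubic] cubic_linear[OF cubic])
  have z: "P e e e = 0" "P e e f = 0" "P e f f = 0" "P f f f = 0" "P e e r = 0" "P e f r = 0" "P f f r = 0"
    "P e r r = 0" "P f r r = 0" "P r r r = 0" using line r b by auto
  have all: "P x y z = 0" if "x \<in> {r, e, f}" "y \<in> {r, e, f}" "z \<in> {r, e, f}" for x y z
    using that z sym(1)[of f e e] sym(2)[of e f e] sym(1)[of f e f] sym(2)[of f f e] sym(1)[of r e e] sym(2)[of e r e]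
      sym(1)[of r e f] sym(2)[of e r f] sym(1)[of r f e] sym(2)[of f r e] sym(1)[of f e r] sym(1)[of r f f] sym(2)[of f r f]
      sym(1)[of r e r] sym(2)[of r r e] sym(1)[of r f r] sym(2)[of r r f] by auto
  have r_span: "r \<notin> vec.span {e, f}"
    using x(2) unfolding span_frame_iff r_def by (auto simp: co_linear)
  have ef: "vec.independent {e, f}" "e \<noteq> f" using is_basis_normal unfolding is_basis_def by auto
  have "r \<noteq> e" "r \<noteq> f" using r_span vec.span_base[of _ "{e, f}"] by auto
  then have "card {r, e, f} = 3" using ef by simp
  moreover have "vec.independent {r, e, f}" using ef r_span by (simp add: vec.independent_insert)
  ultimately have "vec.dim (vec.span {r, e, f}) = 3" using vec.dim_span_eq_card_independent by metis
  then show ?thesis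
    unfolding contains_plane_def using cubic_zero_on_span[OF cubic all] vec.subspace_span
    by (intro exI[of _ "vec.span {r, e, f}"]) blast
qed

lemma mult_cancel_2: "2 * x = 0 \<Longrightarrow> x = 0" for x :: complex
  by simp

context fano_chart_locale
begin

lemma frame_combination:
  "holomorphic_vec U (\<lambda>t. k *s e t + l *s f t)"
  "t \<in> U \<Longrightarrow> dird (\<lambda>t. k *s e t + l *s f t) \<xi> t = k *s dird e \<xi> t + l *s dird f \<xi> t"
proof -
  show hol: "holomorphic_vec U (\<lambda>t. k *s e t + l *s f t)"
    by (intro holomorphic_vec_add holomorphic_vec_scale holomorphic_C4_const chartD)
  assume t: "t \<in> U"
  have D: "((\<lambda>s. k * e s $ i + l * f s $ i) has_derivative (\<lambda>\<xi>. k * dird e \<xi> t $ i + l * dird f \<xi> t $ i)) (at t)" for i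
    using bounded_linear.has_derivative[OF bounded_linear_vec_nth holomorphic_vec_has_derivative(1)[OF chartD(2) t]]
      bounded_linear.has_derivative[OF bounded_linear_vec_nth holomorphic_vec_has_derivative(1)[OF chartD(3) t]]
    by (intro has_derivative_add has_derivative_mult_right)
  show "dird (\<lambda>t. k *s e t + l *s f t) \<xi> t = k *s dird e \<xi> t + l *s dird f \<xi> t"
    unfolding vec_eq_iff holomorphic_vec_has_derivative(2)[OF hol t] using dird_eq[OF D] by simp
qed

lemma open_frame_res:
  assumes "open W" "W \<subseteq> U" "holomorphic_vec U a" "holomorphic_vec U b"
  shows "open {t \<in> W. frame_res P (a t) (b t) w w' \<noteq> 0}"
proof -
  have c: "continuous_on W (\<lambda>t. frame_res P (a t) (b t) w w')"
    using holomorphic_C4_continuous_on[OF frame_res_holomorphic[OF cubic assms(3,4)]] continuous_on_subset assms(2) by blast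
  have "open ((\<lambda>t. frame_res P (a t) (b t) w w') -` (- {0}) \<inter> W)"
    using continuous_open_preimage[OF c assms(1), of "- {0}"] by (simp add: Int_commute open_Compl)
  moreover have "(\<lambda>t. frame_res P (a t) (b t) w w') -` (- {0}) \<inter> W = {t \<in> W. frame_res P (a t) (b t) w w' \<noteq> 0}" by auto
  ultimately show ?thesis by simp
qed

text \<open>If \<open>omega\<close> vanishes on an open set of lines, then \<open>P e f = 0\<close> in a moving frame, and the derivative of this
  relation at a line \<open>\<bbbP> T\<close> produces planes through \<open>\<bbbP> T\<close> inside the cubic.\<close>

lemma omega_nonzero_dense:
  assumes plane: "\<not> contains_plane P" and W: "open W" "W \<subseteq> U" "W \<noteq> {}"
  shows "\<exists>t\<in>W. \<exists>u\<in>tangent_fano P (line_at e f t). \<exists>v\<in>tangent_fano P (line_at e f t). omega P (e t) (f t) u v \<noteq> 0"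
proof (rule ccontr)
  assume "\<not> ?thesis"
  then have om: "omega P (e t) (f t) u v = 0" if "t \<in> W" "u \<in> tangent_fano P (line_at e f t)" "v \<in> tangent_fano P (line_at e f t)" for t u v
    using that by blast
  obtain t where t: "t \<in> W" "t \<in> U" using W by blast
  obtain a b n1 n2 w w' where fr: "is_basis (line_at e f t) a b" "normal_frame P a b n1 n2 w w'"
    using smooth_normal_frame[OF cubic smooth chartD(5)[OF t(2)]] .
  interpret N: normal_frame P a b n1 n2 w w' by fact
  have T: "line_at e f t = vec.span {a, b}" using fr(1) unfolding is_basis_def by simp
  obtain k l m n where ab: "a = k *s e t + l *s f t" "b = m *s e t + n *s f t" and d: "k * n - l * m \<noteq> 0"
    using is_basis_unique[OF chartD(4)[OF t(2)] fr(1)] by metis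
  define a' b' where "a' = (\<lambda>t. k *s e t + l *s f t)" and "b' = (\<lambda>t. m *s e t + n *s f t)"
  have a'b': "a' t = a" "b' t = b" by (simp_all add: a'_def b'_def ab)
  have hol: "holomorphic_vec U a'" "holomorphic_vec U b'" unfolding a'_def b'_def by (rule frame_combination)+
  have bas: "is_basis (line_at e f s) (a' s) (b' s)" if "s \<in> U" for s
    unfolding a'_def b'_def by (rule is_basis_change[OF chartD(4)[OF that] d])
  have om': "omega P x y u v = 0" if xy: "s \<in> W" "is_basis (line_at e f s) x y" and u: "u \<in> tangent_fano P (line_at e f s)" and v: "v \<in> tangent_fano P (line_at e f s)" for s x y u v
  proof -
    obtain k l m n where xy': "x = k *s e s + l *s f s" "y = m *s e s + n *s f s"
      using is_basis_unique[OF chartD(4) xy(2)] xy(1) W(2) by (metis subsetD)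
    have "omega P x y u v = (k * n - l * m) ^ 3 * omega P (e s) (f s) u v"
      unfolding xy' using u v unfolding line_at_def by (intro omega_change_frame[OF cubic])
    then show ?thesis using om[OF xy(1) u v] by simp
  qed
  have P0: "P x y z = 0" if xy: "s \<in> W" "is_basis (line_at e f s) x y" "normal_frame P x y m1 m2 v v'" for s x y m1 m2 v v' z
    using om'[OF xy(1,2)] xy(2) unfolding is_basis_def by (intro normal_frame.omega_zero_imp[OF xy(3)]) auto
  have ab0: "P a b y = 0" for y by (rule P0[OF t(1) fr])
  define S where "S = {s \<in> W. frame_res P (a' s) (b' s) w w' \<noteq> 0}"
  have S: "open S" "t \<in> S" "S \<subseteq> U"
    unfolding S_def using open_frame_res[OF W(1,2) hol] t W(2) N.frame_res_normal by (auto simp: a'b')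
  \<comment> \<open>The basis adapted at \<open>s\<close> is chosen for each \<open>s\<close>
    separately and need not be differentiable in \<open>s\<close>. The relation is therefore put in
    a form that makes sense in the given moving basis: A, B and the quadratic form of
    \<open>y\<close> are dependent for every \<open>y\<close>.\<close>
  define det where "det = (\<lambda>y s. det3 (P (a' s) (a' s) w) (2 * P (a' s) (b' s) w) (P (b' s) (b' s) w)
     (P (a' s) (a' s) y) (2 * P (a' s) (b' s) y) (P (b' s) (b' s) y)
     (P (a' s) (a' s) w') (2 * P (a' s) (b' s) w') (P (b' s) (b' s) w'))"
  have det0: "det y s = 0" if s: "s \<in> S" for y s
  proof -
    have sU: "s \<in> U" "s \<in> W" and R: "frame_res P (a' s) (b' s) w w' \<noteq> 0" using s unfolding S_def using W(2) by auto
    obtain k l m n k' l' m' n' m1 m2 where d: "k * n - l * m \<noteq> 0" and nf: "normal_frame P (k *s a' s + l *s b' s) (m *s a' s + n *s b' s) m1 m2 (k' *s w + l' *s w') (m' *s w + n' *s w')"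
      by (rule frame_normalize[OF cubic chartD(5)[OF sU(1)] bas[OF sU(1)] R])
    have "P (k *s a' s + l *s b' s) (m *s a' s + n *s b' s) z = 0" for z
      by (rule P0[OF sU(2) is_basis_change[OF bas[OF sU(1)] d] nf])
    then have *: "2 * (P (a' s) (a' s) z * (k * m) + 2 * P (a' s) (b' s) z / 2 * (k * n + l * m) + P (b' s) (b' s) z * (l * n)) = 0" for z
      using cubic_pairs(2)[OF cubic, of k "a' s" l "b' s" m n z] by (simp add: algebra_simps)
    show ?thesis unfolding det_def
      by (rule det3_zero_if_apolar[OF _ _ _ d]) (rule mult_cancel_2[OF *])+
  qed
  \<comment> \<open>For such \<open>y\<close> all three coefficients of the middle row vanish at
    \<open>t\<close>, by \<open>ab0\<close> and the two assumptions, so the derivative of the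
    determinant reduces to that of its middle coefficient.\<close>
  have key: "P (dird a' \<xi> t) b y + P a (dird b' \<xi> t) y = 0" if y: "P a a y = 0" "P b b y = 0" for \<xi> y
  proof -
    note Da = holomorphic_vec_has_derivative(1)[OF hol(1) t(2)] and Db = holomorphic_vec_has_derivative(1)[OF hol(2) t(2)]
    have A: "((\<lambda>s. P (a' s) (a' s) z) has_derivative (\<lambda>\<xi>. P (dird a' \<xi> t) (a' t) z + P (a' t) (dird a' \<xi> t) z + P (a' t) (a' t) 0)) (at t)"
      and AB: "((\<lambda>s. 2 * P (a' s) (b' s) z) has_derivative (\<lambda>\<xi>. 2 * (P (dird a' \<xi> t) (b' t) z + P (a' t) (dird b' \<xi> t) z + P (a' t) (b' t) 0))) (at t)"
      and B: "((\<lambda>s. P (b' s) (b' s) z) has_derivative (\<lambda>\<xi>. P (dird b' \<xi> t) (b' t) z + P (b' t) (dird b' \<xi> t) z + P (b' t) (b' t) 0)) (at t)" for z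
      by (intro has_derivative_mult_right has_derivative_cubic[OF cubic Da Da has_derivative_const] has_derivative_cubic[OF cubic Da Db has_derivative_const]
        has_derivative_cubic[OF cubic Db Db has_derivative_const])+
    have "(det y has_derivative (\<lambda>\<xi>. 2 * (P (dird a' \<xi> t) (b' t) y + P (a' t) (dird b' \<xi> t) y + P (a' t) (b' t) 0))) (at t)"
      unfolding det_def
      by (rule has_derivative_eq_rhs[OF has_derivative_det3_normal(1)[OF A AB B A AB B A AB B]])
         (use N.w N.w' y ab0 in \<open>simp_all add: a'b'\<close>)
    moreover have "(det y has_derivative (\<lambda>\<xi>. 0)) (at t)"
      by (rule has_derivative_transform_within_open[OF has_derivative_const[of 0] S(1,2)]) (simp add: det0)
    ultimately have "(\<lambda>\<xi>. 2 * (P (dird a' \<xi> t) (b' t) y + P (a' t) (dird b' \<xi> t) y + P (a' t) (b' t) 0)) = (\<lambda>\<xi>. 0)"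
      by (rule has_derivative_unique)
    from mult_cancel_2[OF fun_cong[OF this, of \<xi>]] show ?thesis by (simp add: a'b' cubic_zero[OF cubic])
  qed
  \<comment> \<open>Every tangent pair is a velocity of the chart up to vectors of T, and these
    contribute only \<open>P a a y\<close>, \<open>P a b y\<close> and \<open>P b b y\<close>, which
    are zero.\<close>
  have key2: "P p b y + P a q y = 0" if pq: "N.tangent_pair p q" and y: "P a a y = 0" "P b b y = 0" for p q y
  proof -
    obtain u where u: "Vector_Spaces.linear (*s) (*s) u" "u a = p" "u b = q"
      using linear_extension_pair[OF fr(1)] by metis
    have "u \<in> tangent_fano P (line_at e f t)" using u pq unfolding T by (simp add: N.tangent_fano_iff)
    then obtain \<xi> where \<xi>: "hom_eq (line_at e f t) u (line_deriv e f t \<xi>)" using line_deriv_surj[OF t(2)] by blast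
    have "a \<in> line_at e f t" "b \<in> line_at e f t" unfolding T by (simp_all add: vec.span_base)
    then have "u a - line_deriv e f t \<xi> a \<in> vec.span {a, b}" "u b - line_deriv e f t \<xi> b \<in> vec.span {a, b}"
      using \<xi> unfolding hom_eq_def T by auto
    moreover have "line_deriv e f t \<xi> a = dird a' \<xi> t" "line_deriv e f t \<xi> b = dird b' \<xi> t"
      unfolding a'_def b'_def frame_combination(2)[OF t(2)] by (simp_all add: ab line_deriv(2)[OF t(2)])
    ultimately obtain k1 l1 k2 l2 where eq: "p - dird a' \<xi> t = k1 *s a + l1 *s b" "q - dird b' \<xi> t = k2 *s a + l2 *s b"
      unfolding u span_pair by auto
    have "p = dird a' \<xi> t + (k1 *s a + l1 *s b)" "q = dird b' \<xi> t + (k2 *s a + l2 *s b)"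
      using eq by (simp_all add: algebra_simps)
    then show ?thesis
      using key[OF y, of \<xi>] y ab0[of y] cubicD(1)[OF cubic, of b a] by (simp add: cubicD(3,4)[OF cubic] cubic_linear[OF cubic])
  qed
  have beta: "N.beta1 = 0" "N.beta2 = 0" unfolding N.beta1_def N.beta2_def using ab0 by auto
  \<comment> \<open>With both betas zero the parametrized tangent vectors have no components along
    \<open>w\<close>, \<open>w'\<close>: \<open>p\<close> and \<open>q\<close> range independently
    over the span of \<open>n1\<close> and \<open>n2\<close>, and the relation splits into
    two.\<close>
  have par: "N.par x3 x4 0 0 = x3 *s n1 + x4 *s n2" "N.par' x3 x4 0 0 = 0" "N.par 0 0 x3 x4 = 0" "N.par' 0 0 x3 x4 = x3 *s n1 + x4 *s n2" for x3 x4
    unfolding N.par_def N.par'_def beta by (simp_all add: vec_eq_iff)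
  have k3: "P a (x3 *s n1 + x4 *s n2) y = 0 \<and> P b (x3 *s n1 + x4 *s n2) y = 0" if y: "P a a y = 0" "P b b y = 0" for x3 x4 y
    using key2[OF N.tangent_pair_par[of x3 x4 0 0] y] key2[OF N.tangent_pair_par[of 0 0 x3 x4] y] cubicD(1)[OF cubic, of b]
    unfolding par by (simp add: cubic_zero[OF cubic])
  have "P a x y = 0 \<and> P b x y = 0" if "x \<in> {n1, n2}" "y \<in> {n1, n2}" for x y
    using that k3[of y 1 0] k3[of y 0 1] N.n by auto
  then show False using contains_plane_if_radical[OF fr(2) ab0] plane by blast
qed

end

section \<open>Forms determined by their product with omega\<close>

definition bilinear_on :: "('v \<Rightarrow> complex ^ 'n) set \<Rightarrow> (('v \<Rightarrow> complex ^ 'n) \<Rightarrow> ('v \<Rightarrow> complex ^ 'n) \<Rightarrow> complex) \<Rightarrow> bool" where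
  "bilinear_on S F \<longleftrightarrow> (\<forall>u\<in>S. \<forall>v\<in>S. \<forall>w\<in>S. \<forall>c.
     F (\<lambda>x. u x + c *s w x) v = F u v + c * F w v \<and> F v (\<lambda>x. u x + c *s w x) = F v u + c * F v w)"

text \<open>Along \<open>u + s u0\<close>, \<open>v + s v0\<close> both forms are polynomials in
  \<open>s\<close>. Their product is zero, and the one of \<open>F\<close> is not, having the
  leading coefficient \<open>F u0 v0\<close>.\<close>

lemma bilinear_product_zero:
  assumes S: "\<And>u v c. u \<in> S \<Longrightarrow> v \<in> S \<Longrightarrow> (\<lambda>x. u x + c *s v x) \<in> S"
    and F: "bilinear_on S F" and G: "bilinear_on S G"
    and FG: "\<And>u v. u \<in> S \<Longrightarrow> v \<in> S \<Longrightarrow> F u v * G u v = 0"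
    and u0: "u0 \<in> S" "v0 \<in> S" "F u0 v0 \<noteq> 0" and uv: "u \<in> S" "v \<in> S"
  shows "G u v = 0"
proof -
  define us vs where "us = (\<lambda>s x. u x + s *s u0 x)" and "vs = (\<lambda>s x. v x + s *s v0 x)"
  define pol where "pol = (\<lambda>H. [:H u v, H u v0 + H u0 v, H u0 v0:] :: complex poly)"
  have pol: "H (us s) (vs s) = poly (pol H) s" if H: "bilinear_on S H" for H s
  proof -
    have "us s \<in> S" using S uv u0 by (simp add: us_def)
    then have "H (us s) (vs s) = H (us s) v + s * H (us s) v0"
      using H uv u0 unfolding bilinear_on_def vs_def by blast
    also have "H (us s) v = H u v + s * H u0 v" using H uv u0 unfolding bilinear_on_def us_def by blast
    also have "H (us s) v0 = H u v0 + s * H u0 v0" using H uv u0 unfolding bilinear_on_def us_def by blast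
    finally show ?thesis by (simp add: pol_def algebra_simps)
  qed
  have "poly (pol F * pol G) s = 0" for s
    using FG[of "us s" "vs s"] S uv u0 by (simp add: pol[OF F, symmetric] pol[OF G, symmetric] us_def vs_def)
  then have "pol F * pol G = 0" using poly_all_0_iff_0 by blast
  moreover have "pol F \<noteq> 0" using u0(3) by (simp add: pol_def)
  ultimately have "pol G = 0" by simp
  then show ?thesis by (simp add: pol_def)
qed

lemma tangent_fano_line: 
  assumes "cubic P" "u \<in> tangent_fano P T" "v \<in> tangent_fano P T"
  shows "(\<lambda>x. u x + c *s v x) \<in> tangent_fano P T"
  using tangent_fano_closed(1)[OF assms(1,2) tangent_fano_closed(2)[OF assms(1,3,3)]] .

lemma bilinear_on_omega:
  assumes P: "cubic P"
  shows "bilinear_on S (omega P e f)"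
  unfolding bilinear_on_def omega_def cubic_linear[OF P] by (simp add: algebra_simps)

lemma bilinear_on_frame_form:
  "bilinear_on S (\<lambda>u v. frame_form P e f w w' (u e) (u f) (v e) (v f))"
proof -
  have 1: "frame_form P e f w w' (ue + c *s xe) (uf + c *s xf) ve vf =
      frame_form P e f w w' ue uf ve vf + c * frame_form P e f w w' xe xf ve vf" for ue xe uf xf ve vf c
    unfolding frame_form_linear ..
  have "frame_form P e f w w' ve vf (ue + c *s xe) (uf + c *s xf) =
      frame_form P e f w w' ve vf ue uf + c * frame_form P e f w w' ve vf xe xf" for ue xe uf xf ve vf c
    using 1[of ue c xe uf xf ve vf] frame_form_skew[of P e f w w' ve vf] by simp
  with 1 show ?thesis unfolding bilinear_on_def by simp
qed

lemma bilinear_on_two_form: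
  assumes P: "cubic P" and "two_form_on_fano P \<Omega>" "T \<in> fano P"
  shows "bilinear_on (tangent_fano P T) (\<Omega> T)"
proof -
  have sk: "\<Omega> T u v = - \<Omega> T v u" and sc: "\<Omega> T (\<lambda>x. a *s u x) v = a * \<Omega> T u v"
    if "u \<in> tangent_fano P T" "v \<in> tangent_fano P T" for u v a
    using assms(2,3) that unfolding two_form_on_fano_def by blast+
  have ad: "\<Omega> T (\<lambda>x. u x + w x) v = \<Omega> T u v + \<Omega> T w v" 
    if "u \<in> tangent_fano P T" "v \<in> tangent_fano P T" "w \<in> tangent_fano P T" for u v w
    using assms(2,3) that unfolding two_form_on_fano_def by blast
  have 1: "\<Omega> T (\<lambda>x. u x + c *s w x) v = \<Omega> T u v + c * \<Omega> T w v"
    if "u \<in> tangent_fano P T" "v \<in> tangent_fano P T" "w \<in> tangent_fano P T" for u v w c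
    using ad[OF that(1,2) tangent_fano_closed(2)[OF P that(3,3)]] sc[OF that(3,2)] by simp
  have "\<Omega> T v (\<lambda>x. u x + c *s w x) = \<Omega> T v u + c * \<Omega> T v w"
    if "u \<in> tangent_fano P T" "v \<in> tangent_fano P T" "w \<in> tangent_fano P T" for u v w c
    unfolding sk[OF that(2) tangent_fano_line[OF P that(1,3)]] 1[OF that] sk[OF that(2,1)] sk[OF that(2,3)] by simp
  with 1 show ?thesis unfolding bilinear_on_def by blast
qed

lemma bilinear_on_diff:
  "bilinear_on S F \<Longrightarrow> bilinear_on S G \<Longrightarrow> bilinear_on S (\<lambda>u v. F u v - a * G u v)"
  unfolding bilinear_on_def by (simp add: algebra_simps)

context fano_chart_locale
begin

definition frame_pullback where
  "frame_pullback a b w w' \<xi> \<eta> t = frame_form P (a t) (b t) w w' (dird a \<xi> t) (dird b \<xi> t) (dird a \<eta> t) (dird b \<eta> t)"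

lemma frame_pullback_holomorphic:
  assumes "open S" "S \<subseteq> U" "holomorphic_vec U a" "holomorphic_vec U b" "\<And>t. t \<in> S \<Longrightarrow> frame_res P (a t) (b t) w w' \<noteq> 0"
  shows "holomorphic_C4 S (frame_pullback a b w w' \<xi> \<eta>)"
proof -
  have "holomorphic_vec S g" if "holomorphic_vec U g" for g :: "complex ^ 4 \<Rightarrow> V"
    using that assms(2) holomorphic_C4_subset unfolding holomorphic_vec_def by blast
  then show ?thesis
    unfolding frame_pullback_def using assms chartD(1)
    by (intro frame_form_holomorphic[OF cubic]) (auto intro: holomorphic_vec_dird)
qed

text \<open>A difference at \<open>t\<close> would persist near \<open>t\<close> by continuity.
  Somewhere in that neighbourhood \<open>omega\<close> is not identically zero on the tangent space,
  and there it can be cancelled by \<open>bilinear_product_zero\<close>.\<close>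

lemma form_unique:
  fixes F G :: "complex ^ 4 \<Rightarrow> (V \<Rightarrow> V) \<Rightarrow> (V \<Rightarrow> V) \<Rightarrow> complex"
  assumes plane: "\<not> contains_plane P" and S: "open S" "S \<subseteq> U" "t \<in> S"
    and bil: "\<And>s. s \<in> S \<Longrightarrow> bilinear_on (tangent_fano P (line_at e f s)) (F s)"
      "\<And>s. s \<in> S \<Longrightarrow> bilinear_on (tangent_fano P (line_at e f s)) (G s)"
    and eq: "\<And>s u v. s \<in> S \<Longrightarrow> u \<in> tangent_fano P (line_at e f s) \<Longrightarrow> v \<in> tangent_fano P (line_at e f s) \<Longrightarrow>
        omega P (e s) (f s) u v * F s u v = omega P (e s) (f s) u v * G s u v"
    and cont: "continuous_on S (\<lambda>s. F s (line_deriv e f s \<xi>) (line_deriv e f s \<eta>))"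
      "continuous_on S (\<lambda>s. G s (line_deriv e f s \<xi>) (line_deriv e f s \<eta>))"
  shows "F t (line_deriv e f t \<xi>) (line_deriv e f t \<eta>) = G t (line_deriv e f t \<xi>) (line_deriv e f t \<eta>)"
proof (rule ccontr)
  assume ne: "\<not> ?thesis"
  define D where "D = (\<lambda>s. F s (line_deriv e f s \<xi>) (line_deriv e f s \<eta>) - G s (line_deriv e f s \<xi>) (line_deriv e f s \<eta>))"
  have "continuous_on S D" unfolding D_def using cont by (intro continuous_intros)
  then have "open (S \<inter> D -` (- {0}))" using S(1) by (intro continuous_open_preimage) auto
  moreover have "t \<in> S \<inter> D -` (- {0})" using S(3) ne by (simp add: D_def)
  ultimately obtain s u0 v0 where s: "s \<in> S" "D s \<noteq> 0" and uv: "u0 \<in> tangent_fano P (line_at e f s)" "v0 \<in> tangent_fano P (line_at e f s)"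
    "omega P (e s) (f s) u0 v0 \<noteq> 0"
    using omega_nonzero_dense[OF plane, of "S \<inter> D -` (- {0})"] S(2) by blast
  have "F s u v - 1 * G s u v = 0" if u: "u \<in> tangent_fano P (line_at e f s)" "v \<in> tangent_fano P (line_at e f s)" for u v
  proof -
    let ?G = "\<lambda>u v. F s u v - 1 * G s u v"
    have G: "bilinear_on (tangent_fano P (line_at e f s)) ?G" by (rule bilinear_on_diff[OF bil[OF s(1)]])
    have prod: "omega P (e s) (f s) u v * ?G u v = 0" if "u \<in> tangent_fano P (line_at e f s)" "v \<in> tangent_fano P (line_at e f s)" for u v
      using eq[OF s(1) that] by (simp add: right_diff_distrib)
    have lin: "(\<lambda>x. u x + c *s v x) \<in> tangent_fano P (line_at e f s)"
      if "u \<in> tangent_fano P (line_at e f s)" "v \<in> tangent_fano P (line_at e f s)" for u v c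
      using that by (rule tangent_fano_line[OF cubic])
    have "?G u v = 0"
      using lin bilinear_on_omega[OF cubic] G prod uv u
      by (rule bilinear_product_zero[of "tangent_fano P (line_at e f s)" "omega P (e s) (f s)" ?G u0 v0 u v])
    then show ?thesis .
  qed
  moreover have "s \<in> U" using s(1) S(2) by blast
  ultimately have "D s = 0" unfolding D_def by (simp add: line_deriv_tangent)
  with s(2) show False by simp
qed

end

section \<open>Smoothness of the Fano variety\<close>

lemma vector_4 [simp]:
  "(vector [a, b, c, d] :: 'a::zero ^ 4) $ 1 = a"
  "(vector [a, b, c, d] :: 'a::zero ^ 4) $ 2 = b"
  "(vector [a, b, c, d] :: 'a::zero ^ 4) $ 3 = c"
  "(vector [a, b, c, d] :: 'a::zero ^ 4) $ 4 = d"
  unfolding vector_def by simp_all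

lemma continuous_on_cubic:
  assumes P: "cubic P" and "continuous_on S x" "continuous_on S y" "continuous_on S z"
  shows "continuous_on S (\<lambda>s. P (x s) (y s) (z s))"
proof -
  have "continuous_on S (\<lambda>s. \<Sum>i\<in>UNIV. \<Sum>j\<in>UNIV. \<Sum>k\<in>UNIV. x s $ i * y s $ j * z s $ k * cubic_coeff P {#i, j, k#})"
    by (intro continuous_intros assms)
  moreover have "(\<lambda>s. P (x s) (y s) (z s)) = (\<lambda>s. \<Sum>i\<in>UNIV. \<Sum>j\<in>UNIV. \<Sum>k\<in>UNIV. x s $ i * y s $ j * z s $ k * cubic_coeff P {#i, j, k#})"
    by (rule ext) (rule cubic_expand[OF P])
  ultimately show ?thesis by (simp only:)
qed

lemma fano_if_vanishing:
  assumes P: "cubic P" and b: "is_basis (vec.span {e, f}) e f"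
    and z: "P e e e = 0" "P e e f = 0" "P e f f = 0" "P f f f = 0"
  shows "vec.span {e, f} \<in> fano P"
proof -
  have "P x x x = 0" if "x \<in> vec.span {e, f}" for x
    by (rule cubic_zero_on_span[OF P _ that that that])
       (use z cubicD(1,2)[OF P, of f e] cubicD(2)[OF P, of e f e] cubicD(2)[OF P, of f f e] in auto)
  moreover have "vec.dim (vec.span {e, f}) = 2"
    using vec.dim_span_eq_card_independent[of "{e, f}"] b unfolding is_basis_def by simp
  ultimately show ?thesis unfolding fano_def grassmannian2_def using vec.subspace_span by blast
qed

context normal_frame
begin

text \<open>Affine coordinates on a neighbourhood of the line \<open>T = span {e, f}\<close> in \<open>G(2,V)\<close>: the coordinates along \<open>n1\<close>, \<open>n2\<close>
  and those along \<open>w\<close>, \<open>w'\<close>. The equations of the Fano variety can be solved for the latter.\<close>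

definition LE :: "(complex ^ 4) \<times> (complex ^ 4) \<Rightarrow> V" where
  "LE x = fst x $ 1 *s n1 + fst x $ 2 *s n2 + snd x $ 1 *s w + snd x $ 2 *s w'"
definition LF :: "(complex ^ 4) \<times> (complex ^ 4) \<Rightarrow> V" where
  "LF x = fst x $ 3 *s n1 + fst x $ 4 *s n2 + snd x $ 3 *s w + snd x $ 4 *s w'"
definition "EE x = e + LE x"
definition "FF x = f + LF x"
definition eqs :: "(complex ^ 4) \<times> (complex ^ 4) \<Rightarrow> complex ^ 4" where
  "eqs x = vector [P (EE x) (EE x) (EE x), P (EE x) (EE x) (FF x), P (EE x) (FF x) (FF x), P (FF x) (FF x) (FF x)]"
definition deqs :: "(complex ^ 4) \<times> (complex ^ 4) \<Rightarrow> (complex ^ 4) \<times> (complex ^ 4) \<Rightarrow> complex ^ 4" where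
  "deqs x h = vector [3 * P (EE x) (EE x) (LE h), 2 * P (EE x) (FF x) (LE h) + P (EE x) (EE x) (LF h),
     P (FF x) (FF x) (LE h) + 2 * P (EE x) (FF x) (LF h), 3 * P (FF x) (FF x) (LF h)]"

lemma bounded_linear_LE_LF: "bounded_linear LE" "bounded_linear LF"
  unfolding LE_def LF_def
  by (intro bounded_linear_add bounded_linear_compose[OF bounded_linear_scalar_mult_left]
      bounded_linear_compose[OF bounded_linear_vec_nth] bounded_linear_fst bounded_linear_snd)+

lemma EE_FF_derivative: "(EE has_derivative LE) (at x)" "(FF has_derivative LF) (at x)"
  using has_derivative_add[OF has_derivative_const[of e] bounded_linear_imp_has_derivative[OF bounded_linear_LE_LF(1)]]
    has_derivative_add[OF has_derivative_const[of f] bounded_linear_imp_has_derivative[OF bounded_linear_LE_LF(2)]]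
  unfolding EE_def FF_def by simp_all

lemma has_derivative_vector_4:
  fixes a :: "'x::real_normed_vector \<Rightarrow> complex"
  assumes "(a has_derivative a') F" "(b has_derivative b') F" "(c has_derivative c') F" "(d has_derivative d') F"
  shows "((\<lambda>x. vector [a x, b x, c x, d x] :: complex ^ 4) has_derivative (\<lambda>h. vector [a' h, b' h, c' h, d' h])) F"
proof -
  have *: "vector [p, q, r, s] = p *s axis 1 1 + q *s axis 2 1 + r *s axis 3 1 + s *s (axis 4 1 :: complex ^ 4)" for p q r s
    unfolding vec_eq_iff forall_4 by (simp add: axis_def)
  show ?thesis unfolding * by (intro has_derivative_add bounded_linear.has_derivative[OF bounded_linear_scalar_mult_left] assms)
qed

lemma eqs_derivative: "(eqs has_derivative deqs x) (at x)"
proof -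
  note s = cubicD(1,2)[OF cubic]
  have "P (LE h) (EE x) (EE x) = P (EE x) (EE x) (LE h)" "P (EE x) (LE h) (EE x) = P (EE x) (EE x) (LE h)"
    "P (LE h) (EE x) (FF x) = P (EE x) (FF x) (LE h)" "P (EE x) (LE h) (FF x) = P (EE x) (FF x) (LE h)"
    "P (LE h) (FF x) (FF x) = P (FF x) (FF x) (LE h)" "P (EE x) (LF h) (FF x) = P (EE x) (FF x) (LF h)"
    "P (LF h) (FF x) (FF x) = P (FF x) (FF x) (LF h)" "P (FF x) (LF h) (FF x) = P (FF x) (FF x) (LF h)" for h
    using s by metis+
  note r = this
  note D = EE_FF_derivative[of x]
  note d = has_derivative_cubic[OF cubic D(1) D(1) D(1)] has_derivative_cubic[OF cubic D(1) D(1) D(2)]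
     has_derivative_cubic[OF cubic D(1) D(2) D(2)] has_derivative_cubic[OF cubic D(2) D(2) D(2)]
  show ?thesis unfolding eqs_def
    by (rule has_derivative_eq_rhs[OF has_derivative_vector_4[OF d]]) (simp add: deqs_def r fun_eq_iff add.commute)
qed

lemma L_coords:
  "co1 (LE x) = 0" "co2 (LE x) = 0" "co3 (LE x) = fst x $ 1" "co4 (LE x) = fst x $ 2" "P e e (LE x) = snd x $ 1" "P f f (LE x) = snd x $ 2"
  "co1 (LF x) = 0" "co2 (LF x) = 0" "co3 (LF x) = fst x $ 3" "co4 (LF x) = fst x $ 4" "P e e (LF x) = snd x $ 3" "P f f (LF x) = snd x $ 4"
  unfolding LE_def LF_def co_linear cubic_linear[OF cubic] using w w' n by simp_all

lemma E_coords:
  "co1 (EE x) = 1" "co2 (EE x) = 0" "co3 (EE x) = fst x $ 1" "co4 (EE x) = fst x $ 2"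
  "co1 (FF x) = 0" "co2 (FF x) = 1" "co3 (FF x) = fst x $ 3" "co4 (FF x) = fst x $ 4"
  unfolding EE_def FF_def co_linear L_coords by simp_all

lemma EE_eqI:
  assumes "co1 y = 1" "co2 y = 0" "co3 y = fst x $ 1" "co4 y = fst x $ 2" "P e e y = snd x $ 1" "P f f y = snd x $ 2"
  shows "y = EE x"
  using coords[of y] unfolding assms EE_def LE_def by (simp add: add.assoc)

lemma FF_eqI:
  assumes "co1 y = 0" "co2 y = 1" "co3 y = fst x $ 3" "co4 y = fst x $ 4" "P e e y = snd x $ 3" "P f f y = snd x $ 4"
  shows "y = FF x"
  using coords[of y] unfolding assms FF_def LF_def by (simp add: add.assoc)

lemma continuous_on_co:
  fixes g :: "'x::topological_space \<Rightarrow> V"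
  assumes "continuous_on S g"
  shows "continuous_on S (\<lambda>x. co1 (g x))" "continuous_on S (\<lambda>x. co2 (g x))" "continuous_on S (\<lambda>x. co3 (g x))" "continuous_on S (\<lambda>x. co4 (g x))"
proof -
  have "bounded_linear co1" "bounded_linear co2" "bounded_linear co3" "bounded_linear co4"
    unfolding linear_conv_bounded_linear[symmetric] linear_iff by (simp_all add: co_linear scaleR_vec_complex scaleR_conv_of_real)
  then show "continuous_on S (\<lambda>x. co1 (g x))" "continuous_on S (\<lambda>x. co2 (g x))" "continuous_on S (\<lambda>x. co3 (g x))" "continuous_on S (\<lambda>x. co4 (g x))"
    using bounded_linear.continuous_on assms by blast+
qed

lemma EF_basis: "is_basis (vec.span {EE x, FF x}) (EE x) (FF x)"
proof -
  have "k = 0 \<and> l = 0" if "k *s EE x + l *s FF x = 0" for k l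
    using arg_cong[OF that, of co1] arg_cong[OF that, of co2] unfolding co_linear E_coords by (simp add: co1_def co2_def)
  then show ?thesis unfolding is_basis_iff by blast
qed

definition dPhi where "dPhi x = Blinfun (\<lambda>h. (fst h, deqs x h))"

lemma dPhi: "blinfun_apply (dPhi x) h = (fst h, deqs x h)"
proof -
  have "bounded_linear (\<lambda>h. (fst h, deqs x h))"
    by (intro bounded_linear_Pair bounded_linear_fst has_derivative_bounded_linear[OF eqs_derivative])
  then show ?thesis unfolding dPhi_def by (simp add: bounded_linear_Blinfun_apply)
qed

lemma Phi_derivative: "((\<lambda>x. (fst x, eqs x)) has_derivative blinfun_apply (dPhi x)) (at x)"
proof -
  have "blinfun_apply (dPhi x) = (\<lambda>h. (fst h, deqs x h))" by (rule ext) (rule dPhi)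
  then show ?thesis
    using has_derivative_Pair[OF bounded_linear_imp_has_derivative[OF bounded_linear_fst] eqs_derivative] by simp
qed

lemma continuous_dPhi: "continuous_on UNIV dPhi"
proof (rule continuous_on_blinfun_componentwise)
  fix h :: "(complex ^ 4) \<times> (complex ^ 4)"
  have c: "continuous_on UNIV EE" "continuous_on UNIV FF"
    using EE_FF_derivative has_derivative_continuous by (blast intro: continuous_at_imp_continuous_on)+
  have v4: "vector [p, q, r, s] = p *s axis 1 1 + q *s axis 2 1 + r *s axis 3 1 + s *s (axis 4 1 :: complex ^ 4)" for p q r s
    unfolding vec_eq_iff forall_4 by (simp add: axis_def)
  show "continuous_on UNIV (\<lambda>x. blinfun_apply (dPhi x) h)"
    unfolding dPhi deqs_def v4
    by (intro continuous_on_Pair continuous_on_add continuous_on_mult continuous_on_scalar_mult continuous_on_const continuous_on_cubic[OF cubic] c)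
qed

text \<open>If the coordinates along \<open>n1\<close>, \<open>n2\<close> of a vector in the kernel
  vanish, then so does \<open>P e f\<close> on \<open>LE h\<close> and \<open>LF h\<close>. The four
  linearized equations then are the four remaining coordinates up to the factors 3, 1, 1, 3.\<close>

lemma dPhi_zero_invertible: "\<exists>g. g o\<^sub>L dPhi 0 = id_blinfun"
proof -
  have z: "EE 0 = e" "FF 0 = f" unfolding EE_def FF_def LE_def LF_def by simp_all
  have lin: "linear (blinfun_apply (dPhi 0))" by (simp add: blinfun.bounded_linear_right bounded_linear.linear)
  have "h = 0" if h: "blinfun_apply (dPhi 0) h = 0" for h
  proof -
    have f0: "fst h = 0" and d: "deqs 0 h = 0" using h unfolding dPhi by (simp_all add: prod_eq_iff)
    have "3 * P e e (LE h) = 0" "2 * P e f (LE h) + P e e (LF h) = 0" "P f f (LE h) + 2 * P e f (LF h) = 0" "3 * P f f (LF h) = 0"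
      using d unfolding deqs_def z vec_eq_iff forall_4 by simp_all
    moreover have "P e f (LE h) = 0" "P e f (LF h) = 0" unfolding P_e_f L_coords f0 by simp_all
    ultimately have "snd h = 0" unfolding L_coords vec_eq_iff forall_4 by simp
    with f0 show ?thesis by (simp add: prod_eq_iff)
  qed
  then have "inj (blinfun_apply (dPhi 0))" using linear_injective_0[OF lin] by blast
  then obtain g where g: "linear g" "g \<circ> blinfun_apply (dPhi 0) = id" using linear_injective_left_inverse[OF lin] by blast
  have "g (blinfun_apply (dPhi 0) h) = h" for h using g(2) by (metis comp_apply id_apply)
  moreover have "bounded_linear g" using g(1) by (simp add: linear_conv_bounded_linear)
  ultimately have "Blinfun g o\<^sub>L dPhi 0 = id_blinfun"
    by (intro blinfun_eqI) (simp add: bounded_linear_Blinfun_apply del: split_paired_All)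
  then show ?thesis by blast
qed

text \<open>The inverse function theorem applied to the free coordinates together with the four
  equations; the chart is the local inverse on the slice where the equations vanish. The
  coefficients of \<open>EE\<close>, \<open>FF\<close> along \<open>e\<close>, \<open>f\<close> are
  fixed to the identity matrix, so different parameters give different lines and nonzero velocities
  leave T.\<close>

lemma chart_exists: "\<exists>U a b. fano_chart P U a b \<and> vec.span {e, f} \<in> line_at a b ` U"
proof -
  define Phi where "Phi = (\<lambda>x. (fst x, eqs x))"
  have Phi': "(Phi has_derivative blinfun_apply (dPhi x)) (at x)" for x unfolding Phi_def by (rule Phi_derivative)
  obtain invf where invf: "invf o\<^sub>L dPhi 0 = id_blinfun" using dPhi_zero_invertible by blast
  obtain W V G G' where W: "open W" "0 \<in> W" and V: "open V" "Phi 0 \<in> V" and hom: "homeomorphism W V Phi G"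
    and G: "\<And>y. y \<in> V \<Longrightarrow> (G has_derivative G' y) (at y)" "\<And>y. y \<in> V \<Longrightarrow> G' y = inv (blinfun_apply (dPhi (G y)))"
      "\<And>y. y \<in> V \<Longrightarrow> bij (blinfun_apply (dPhi (G y)))"
    by (rule inverse_function_theorem[OF open_UNIV Phi' continuous_dPhi UNIV_I invf]) (rule that; assumption)
  have z: "EE 0 = e" "FF 0 = f" unfolding EE_def FF_def LE_def LF_def by simp_all
  have Phi0: "Phi 0 = 0" unfolding Phi_def eqs_def z line by (simp add: prod_eq_iff vec_eq_iff forall_4)
  define U where "U = {t. (t, 0) \<in> V}"
  have U: "open U"
  proof -
    have "open ((\<lambda>t. (t, 0 :: complex ^ 4)) -` V)" by (rule open_vimage[OF V(1)]) (intro continuous_intros)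
    then show ?thesis by (simp add: U_def vimage_def)
  qed
  define \<sigma> where "\<sigma> = (\<lambda>t. G (t, 0))"
  define a b where "a = (\<lambda>t. EE (\<sigma> t))" and "b = (\<lambda>t. FF (\<sigma> t))"
  have PhiG: "Phi (\<sigma> t) = (t, 0)" and \<sigma>W: "\<sigma> t \<in> W" if "t \<in> U" for t
    using hom that unfolding homeomorphism_def U_def \<sigma>_def by auto
  have fst_\<sigma>: "fst (\<sigma> t) = t" and eqs_\<sigma>: "eqs (\<sigma> t) = 0" if "t \<in> U" for t using PhiG[OF that] unfolding Phi_def by auto
  define D where "D = (\<lambda>t \<xi>. G' (t, 0) (\<xi>, 0))"
  have D\<sigma>: "(\<sigma> has_derivative D t) (at t)" if t: "t \<in> U" for t
  proof -
    have "((\<lambda>t. (t, 0 :: complex ^ 4)) has_derivative (\<lambda>\<xi>. (\<xi>, 0))) (at t)" by (intro derivative_intros)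
    from has_derivative_compose[OF this G(1)] t show ?thesis unfolding \<sigma>_def D_def U_def by simp
  qed
  \<comment> \<open>The inverse function theorem gives a real derivative. Its complex homogeneity
    follows from that of \<open>deqs\<close>, since the differential being inverted is
    bijective.\<close>
  have dD: "fst (D t \<xi>) = \<xi>" "D t (c *s \<xi>) = (c *s fst (D t \<xi>), c *s snd (D t \<xi>))" if t: "t \<in> U" for t c \<xi>
  proof -
    have tV: "(t, 0) \<in> V" using t unfolding U_def by simp
    define A where "A = blinfun_apply (dPhi (\<sigma> t))"
    have A: "bij A" "D t \<xi> = inv A (\<xi>, 0)" for \<xi> using G(2,3)[OF tV] unfolding A_def D_def \<sigma>_def by simp_all
    have AD: "A (D t \<xi>) = (\<xi>, 0)" for \<xi> using A by (simp add: bij_is_surj surj_f_inv_f)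
    show f: "fst (D t \<xi>) = \<xi>" using AD[of \<xi>] unfolding A_def dPhi by simp
    have "deqs (\<sigma> t) (c *s fst (D t \<xi>), c *s snd (D t \<xi>)) = c *s deqs (\<sigma> t) (D t \<xi>)"
    proof -
      have sc: "LE (c *s fst h, c *s snd h) = c *s LE h" "LF (c *s fst h, c *s snd h) = c *s LF h" for h
        unfolding LE_def LF_def by (simp_all add: vec_eq_iff algebra_simps)
      show ?thesis unfolding deqs_def sc cubic_linear[OF cubic] by (simp add: vec_eq_iff forall_4 algebra_simps)
    qed
    moreover have "deqs (\<sigma> t) (D t \<xi>) = 0" using AD[of \<xi>] unfolding A_def dPhi by simp
    ultimately have "A (c *s fst (D t \<xi>), c *s snd (D t \<xi>)) = A (D t (c *s \<xi>))"
      unfolding AD unfolding A_def dPhi by (simp add: f)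
    then show "D t (c *s \<xi>) = (c *s fst (D t \<xi>), c *s snd (D t \<xi>))" using A(1) by (metis bij_is_inj injD)
  qed
  have Da: "(a has_derivative (\<lambda>\<xi>. LE (D t \<xi>))) (at t)" and Db: "(b has_derivative (\<lambda>\<xi>. LF (D t \<xi>))) (at t)" if t: "t \<in> U" for t
    unfolding a_def b_def using has_derivative_compose[OF D\<sigma>[OF t] EE_FF_derivative(1)] has_derivative_compose[OF D\<sigma>[OF t] EE_FF_derivative(2)] .
  have basis_ab: "is_basis (line_at a b t) (a t) (b t)" for t unfolding line_at_def a_def b_def by (rule EF_basis)
  have eqs0: "eqs x = 0 \<longleftrightarrow> P (EE x) (EE x) (EE x) = 0 \<and> P (EE x) (EE x) (FF x) = 0 \<and> P (EE x) (FF x) (FF x) = 0 \<and> P (FF x) (FF x) (FF x) = 0" for x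
    unfolding eqs_def vec_eq_iff forall_4 by simp
  have "fano_chart P U a b"
    unfolding fano_chart_def
  proof (intro conjI allI ballI impI)
    show "open U" by (rule U)
    show "holomorphic_C4 U (\<lambda>t. a t $ i)" for i
    proof (rule holomorphic_C4I, intro exI conjI allI)
      fix t assume t: "t \<in> U"
      show "((\<lambda>t. a t $ i) has_derivative (\<lambda>\<xi>. LE (D t \<xi>) $ i)) (at t)"
        by (rule bounded_linear.has_derivative[OF bounded_linear_vec_nth Da[OF t]])
      show "LE (D t (c *s \<xi>)) $ i = c * LE (D t \<xi>) $ i" for c \<xi>
        unfolding dD(2)[OF t] LE_def by (simp add: algebra_simps)
    qed
    show "holomorphic_C4 U (\<lambda>t. b t $ i)" for i
    proof (rule holomorphic_C4I, intro exI conjI allI)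
      fix t assume t: "t \<in> U"
      show "((\<lambda>t. b t $ i) has_derivative (\<lambda>\<xi>. LF (D t \<xi>) $ i)) (at t)"
        by (rule bounded_linear.has_derivative[OF bounded_linear_vec_nth Db[OF t]])
      show "LF (D t (c *s \<xi>)) $ i = c * LF (D t \<xi>) $ i" for c \<xi>
        unfolding dD(2)[OF t] LF_def by (simp add: algebra_simps)
    qed
    show "is_basis (line_at a b t) (a t) (b t)" for t by (rule basis_ab)
    show "line_at a b t \<in> fano P" if "t \<in> U" for t
      using eqs_\<sigma>[OF that] unfolding eqs0 line_at_def a_def b_def by (intro fano_if_vanishing[OF cubic EF_basis]) auto
    show "inj_on (line_at a b) U"
    proof (rule inj_onI)
      fix s t assume s: "s \<in> U" and t: "t \<in> U" and eq: "line_at a b s = line_at a b t"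
      have "a s \<in> vec.span {a t, b t}" "b s \<in> vec.span {a t, b t}"
        using eq vec.span_base[of _ "{a s, b s}"] unfolding line_at_def by auto
      then obtain k l m n where kl: "a s = k *s a t + l *s b t" "b s = m *s a t + n *s b t" unfolding span_pair by blast
      have "k = 1" "l = 0" "m = 0" "n = 1"
        using arg_cong[OF kl(1), of co1] arg_cong[OF kl(1), of co2] arg_cong[OF kl(2), of co1] arg_cong[OF kl(2), of co2]
        unfolding co_linear a_def b_def E_coords by simp_all
      then have "a s = a t" "b s = b t" using kl by simp_all
      then have "fst (\<sigma> s) = fst (\<sigma> t)"
        using E_coords(3,4,7,8)[of "\<sigma> s"] E_coords(3,4,7,8)[of "\<sigma> t"] unfolding a_def b_def vec_eq_iff[of "fst (\<sigma> s)"] forall_4 by simp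
      then show "s = t" unfolding fst_\<sigma>[OF s] fst_\<sigma>[OF t] .
    qed
    show "\<xi> = 0" if t: "t \<in> U" and h: "hom_eq (line_at a b t) (line_deriv a b t \<xi>) (\<lambda>x. 0)" for t \<xi>
    proof -
      have "a t \<in> line_at a b t" "b t \<in> line_at a b t" unfolding line_at_def by (simp_all add: vec.span_base)
      then have "LE (D t \<xi>) \<in> vec.span {a t, b t}" "LF (D t \<xi>) \<in> vec.span {a t, b t}"
        using h unfolding hom_eq_def line_deriv_spec(2,3)[OF basis_ab] dird_eq[OF Da[OF t]] dird_eq[OF Db[OF t]] line_at_def
        by (auto simp: line_deriv_spec(2,3)[OF basis_ab, unfolded line_at_def] dird_eq[OF Da[OF t]] dird_eq[OF Db[OF t]])
      then obtain k l m n where kl: "LE (D t \<xi>) = k *s a t + l *s b t" "LF (D t \<xi>) = m *s a t + n *s b t" unfolding span_pair by blast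
      have "k = 0" "l = 0" "m = 0" "n = 0"
        using arg_cong[OF kl(1), of co1] arg_cong[OF kl(1), of co2] arg_cong[OF kl(2), of co1] arg_cong[OF kl(2), of co2]
        unfolding co_linear a_def b_def E_coords L_coords by simp_all
      then have "LE (D t \<xi>) = 0" "LF (D t \<xi>) = 0" using kl by simp_all
      then have "fst (D t \<xi>) = 0"
        using L_coords(3,4,9,10)[of "D t \<xi>"] unfolding vec_eq_iff[of "fst (D t \<xi>)"] forall_4 by (simp add: co3_def co4_def)
      then show ?thesis unfolding dD(1)[OF t] .
    qed
    \<comment> \<open>For the openness of the image: a pair \<open>(p, q)\<close> with nonzero minor
      \<open>\<Delta>\<close> along \<open>e\<close>, \<open>f\<close> is replaced by the basis
      \<open>eh\<close>, \<open>fh\<close> of the same line whose components along \<open>e\<close>,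
      \<open>f\<close> form the identity matrix, and \<open>\<psi>\<close> reads off its affine
      coordinates.\<close>
    define \<Delta> where "\<Delta> = (\<lambda>(p, q). co1 p * co2 q - co2 p * co1 q)"
    define eh where "eh = (\<lambda>(p, q). (co2 q / \<Delta> (p, q)) *s p + (- co2 p / \<Delta> (p, q)) *s q)"
    define fh where "fh = (\<lambda>(p, q). (- co1 q / \<Delta> (p, q)) *s p + (co1 p / \<Delta> (p, q)) *s q)"
    define \<psi> :: "V \<times> V \<Rightarrow> (complex ^ 4) \<times> (complex ^ 4)" where
      "\<psi> = (\<lambda>z. (vector [co3 (eh z), co4 (eh z), co3 (fh z), co4 (fh z)], vector [P e e (eh z), P f f (eh z), P e e (fh z), P f f (fh z)]))"
    \<comment> \<open>On bases of lines in F(X), membership in this open set says that the affine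
      coordinates lie in \<open>W\<close>, where vanishing of the equations is the same as lying on
      the chart.\<close>
    define O' where "O' = {z. \<Delta> z \<noteq> 0} \<inter> \<psi> -` W"
    have norm: "EE (\<psi> (p, q)) = eh (p, q)" "FF (\<psi> (p, q)) = fh (p, q)" if d: "\<Delta> (p, q) \<noteq> 0" for p q
    proof -
      have "co1 (eh (p, q)) = 1" "co2 (eh (p, q)) = 0" "co1 (fh (p, q)) = 0" "co2 (fh (p, q)) = 1"
      proof -
        define \<delta> where "\<delta> = \<Delta> (p, q)"
        have "\<delta> \<noteq> 0" "co1 p * co2 q = \<delta> + co2 p * co1 q" using d by (simp_all add: \<delta>_def \<Delta>_def)
        then show "co1 (eh (p, q)) = 1" "co2 (eh (p, q)) = 0" "co1 (fh (p, q)) = 0" "co2 (fh (p, q)) = 1"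
          unfolding eh_def fh_def prod.case co_linear \<delta>_def[symmetric] by (simp_all add: field_simps)
      qed
      then show "EE (\<psi> (p, q)) = eh (p, q)" "FF (\<psi> (p, q)) = fh (p, q)"
        by (intro EE_eqI[symmetric] FF_eqI[symmetric]; simp add: \<psi>_def)+
    qed
    have "open O'"
    proof -
      have d: "continuous_on UNIV \<Delta>"
        unfolding \<Delta>_def case_prod_beta by (intro continuous_intros continuous_on_co)
      then have "open (\<Delta> -` (- {0}))" by (intro open_vimage) (auto simp: open_Compl)
      then have S: "open {z. \<Delta> z \<noteq> 0}" by (simp add: vimage_def)
      have d': "continuous_on {z. \<Delta> z \<noteq> 0} \<Delta>" by (rule continuous_on_subset[OF d subset_UNIV])
      have v4: "vector [p, q, r, s] = p *s axis 1 1 + q *s axis 2 1 + r *s axis 3 1 + s *s (axis 4 1 :: complex ^ 4)" for p q r s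
        unfolding vec_eq_iff forall_4 by (simp add: axis_def)
      have "continuous_on {z. \<Delta> z \<noteq> 0} eh" "continuous_on {z. \<Delta> z \<noteq> 0} fh"
        unfolding eh_def fh_def case_prod_beta prod.collapse
        by (intro continuous_on_add continuous_on_scalar_mult continuous_on_divide continuous_on_minus continuous_on_co
            continuous_on_fst continuous_on_snd continuous_on_id d'; simp)+
      then have "continuous_on {z. \<Delta> z \<noteq> 0} \<psi>"
        unfolding \<psi>_def v4
        by (intro continuous_on_Pair continuous_on_add continuous_on_scalar_mult continuous_on_const continuous_on_co continuous_on_cubic[OF cubic])
      from continuous_open_preimage[OF this S W(1)] show ?thesis unfolding O'_def .
    qed
    moreover have "{(p, q). \<exists>T\<in>line_at a b ` U. is_basis T p q} = {(p, q). \<exists>T\<in>fano P. is_basis T p q} \<inter> O'"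
    proof (intro set_eqI iffI)
      fix z assume "z \<in> {(p, q). \<exists>T\<in>line_at a b ` U. is_basis T p q}"
      then obtain p q t where z: "z = (p, q)" and t: "t \<in> U" and pq: "is_basis (line_at a b t) p q" by auto
      obtain k l m n where kl: "p = k *s a t + l *s b t" "q = m *s a t + n *s b t" and d: "k * n - l * m \<noteq> 0"
        using is_basis_unique[OF basis_ab pq] by metis
      have co: "co1 p = k" "co2 p = l" "co1 q = m" "co2 q = n"
        unfolding kl co_linear a_def b_def E_coords by simp_all
      then have \<Delta>: "\<Delta> (p, q) = k * n - l * m" by (simp add: \<Delta>_def)
      define \<delta> where "\<delta> = k * n - l * m"
      have \<delta>: "\<delta> \<noteq> 0" using d by (simp add: \<delta>_def)
      have "eh (p, q) = ((n * k - l * m) / \<delta>) *s a t + ((n * l - l * n) / \<delta>) *s b t"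
        "fh (p, q) = ((k * m - m * k) / \<delta>) *s a t + ((k * n - m * l) / \<delta>) *s b t"
        unfolding eh_def fh_def prod.case \<Delta> co \<delta>_def[symmetric] unfolding kl using \<delta> by (simp_all add: vec_eq_iff field_simps)
      then have eh: "eh (p, q) = EE (\<sigma> t)" "fh (p, q) = FF (\<sigma> t)"
        using \<delta> unfolding \<delta>_def by (simp_all add: mult.commute a_def b_def)
      have vv: "vector [x $ 1, x $ 2, x $ 3, x $ 4] = x" for x :: "complex ^ 4" unfolding vec_eq_iff forall_4 by simp
      have "P e e (EE x) = snd x $ 1" "P f f (EE x) = snd x $ 2" "P e e (FF x) = snd x $ 3" "P f f (FF x) = snd x $ 4" for x
        unfolding EE_def FF_def cubic_linear[OF cubic] L_coords using line cubicD(2)[OF cubic, of f f e] cubicD(1)[OF cubic, of f e f] by simp_all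
      then have "\<psi> (p, q) = \<sigma> t" unfolding \<psi>_def eh E_coords by (simp add: vv)
      then have "z \<in> O'" using \<Delta> d \<sigma>W[OF t] by (simp add: O'_def z)
      moreover have "line_at a b t \<in> fano P"
        using eqs_\<sigma>[OF t] unfolding eqs0 line_at_def a_def b_def by (intro fano_if_vanishing[OF cubic EF_basis]) auto
      ultimately show "z \<in> {(p, q). \<exists>T\<in>fano P. is_basis T p q} \<inter> O'" using pq z by auto
    next
      fix z assume zz: "z \<in> {(p, q). \<exists>T\<in>fano P. is_basis T p q} \<inter> O'"
      then obtain p q T where z: "z = (p, q)" and T: "T \<in> fano P" and pq: "is_basis T p q" by auto
      have d: "\<Delta> (p, q) \<noteq> 0" and W\<psi>: "\<psi> (p, q) \<in> W" using zz unfolding z O'_def by auto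
      define x where "x = \<psi> (p, q)"
      have ne: "(co2 q / \<Delta> (p, q)) * (co1 p / \<Delta> (p, q)) - (- co2 p / \<Delta> (p, q)) * (- co1 q / \<Delta> (p, q)) \<noteq> 0"
      proof -
        have "(co2 q / \<Delta> (p, q)) * (co1 p / \<Delta> (p, q)) - (- co2 p / \<Delta> (p, q)) * (- co1 q / \<Delta> (p, q)) = \<Delta> (p, q) / (\<Delta> (p, q) * \<Delta> (p, q))"
          by (simp add: diff_divide_distrib[symmetric]) (simp add: \<Delta>_def mult.commute)
        then show ?thesis using d by simp
      qed
      have bx: "is_basis T (EE x) (FF x)"
        unfolding x_def norm[OF d] eh_def fh_def prod.case by (rule is_basis_change[OF pq ne])
      have "eqs x = 0"
        unfolding eqs0 using vanishing_on_line[OF cubic, of "EE x" "FF x"] fanoD(4)[OF T bx] by blast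
      then have Phix: "Phi x = (fst x, 0)" unfolding Phi_def by simp
      have "Phi x \<in> V" "G (Phi x) = x" using hom W\<psi> unfolding homeomorphism_def x_def by auto
      then have xU: "fst x \<in> U" and \<sigma>x: "\<sigma> (fst x) = x" unfolding Phix U_def \<sigma>_def by auto
      have "line_at a b (fst x) = T"
        using bx unfolding line_at_def a_def b_def \<sigma>x is_basis_def by simp
      then show "z \<in> {(p, q). \<exists>T\<in>line_at a b ` U. is_basis T p q}" using xU pq z by blast
    qed
    ultimately show "openin (top_of_set {(p, q). \<exists>T\<in>fano P. is_basis T p q}) {(p, q). \<exists>T\<in>line_at a b ` U. is_basis T p q}"
      by (simp add: openin_open_Int)
  qed
  moreover have "0 \<in> U" using V(2) unfolding U_def Phi0 by (simp add: zero_prod_def)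
  moreover have "\<sigma> 0 = 0"
  proof -
    have "G (Phi 0) = 0" using hom W(2) unfolding homeomorphism_def by blast
    then show ?thesis unfolding \<sigma>_def Phi0 by (simp add: zero_prod_def)
  qed
  then have "line_at a b 0 = vec.span {e, f}" unfolding line_at_def a_def b_def by (simp add: z)
  ultimately show ?thesis by (metis image_eqI)
qed

end

section \<open>The symplectic form\<close>

text \<open>The residue form, with a basis and a pair \<open>(w, w')\<close> chosen line by line;
  that the choice is immaterial is \<open>fano_form_eq\<close>.\<close>

definition fano_form :: "(V \<Rightarrow> V \<Rightarrow> V \<Rightarrow> complex) \<Rightarrow> V set \<Rightarrow> (V \<Rightarrow> V) \<Rightarrow> (V \<Rightarrow> V) \<Rightarrow> complex" where
  "fano_form P T u v = (case SOME (a, b, w, w'). is_basis T a b \<and> frame_res P a b w w' \<noteq> 0 of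
     (a, b, w, w') \<Rightarrow> frame_form P a b w w' (u a) (u b) (v a) (v b))"

lemma frame_form_same_basis:
  assumes P: "cubic P" and b: "is_basis T e f" "is_basis T a b" and u: "u \<in> tangent_fano P T" and v: "v \<in> tangent_fano P T"
  shows "frame_form P a b w w' (u a) (u b) (v a) (v b) = frame_form P e f w w' (u e) (u f) (v e) (v f)"
    "frame_res P a b w w' \<noteq> 0 \<longleftrightarrow> frame_res P e f w w' \<noteq> 0"
proof -
  obtain k l m n where ab: "a = k *s e + l *s f" "b = m *s e + n *s f" and d: "k * n - l * m \<noteq> 0"
    using is_basis_unique[OF b] by metis
  show "frame_form P a b w w' (u a) (u b) (v a) (v b) = frame_form P e f w w' (u e) (u f) (v e) (v f)"
    unfolding ab tangent_fanoD(2,3)[OF u] tangent_fanoD(2,3)[OF v] by (rule frame_form_change_frame[OF P d])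
  show "frame_res P a b w w' \<noteq> 0 \<longleftrightarrow> frame_res P e f w w' \<noteq> 0"
    unfolding ab frame_res_change_frame[OF P] using d by simp
qed

lemma frechet_derivative_worksI: "(g has_derivative D) F \<Longrightarrow> (g has_derivative frechet_derivative g F) F"
  using frechet_derivative_works differentiableI by metis

context fano_chart_locale
begin

text \<open>The two pairs may span different planes. Both residue forms, multiplied by
  \<open>omega\<close>, equal 3 K wherever both resultants are nonzero, which is an open set
  containing \<open>t\<close>, so \<open>form_unique\<close> applies.\<close>

lemma frame_form_independent:
  assumes plane: "\<not> contains_plane P" and t: "t \<in> U"
    and R: "frame_res P (e t) (f t) w w' \<noteq> 0" "frame_res P (e t) (f t) x x' \<noteq> 0"
    and u: "u \<in> tangent_fano P (line_at e f t)" and v: "v \<in> tangent_fano P (line_at e f t)"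
  shows "frame_form P (e t) (f t) w w' (u (e t)) (u (f t)) (v (e t)) (v (f t)) =
    frame_form P (e t) (f t) x x' (u (e t)) (u (f t)) (v (e t)) (v (f t))"
proof -
  define F where "F = (\<lambda>w w' s (u :: V \<Rightarrow> V) (v :: V \<Rightarrow> V). frame_form P (e s) (f s) w w' (u (e s)) (u (f s)) (v (e s)) (v (f s)))"
  define S where "S = {s \<in> {s \<in> U. frame_res P (e s) (f s) w w' \<noteq> 0}. frame_res P (e s) (f s) x x' \<noteq> 0}"
  have S: "open S" "S \<subseteq> U" "t \<in> S"
  proof -
    show "open S"
      unfolding S_def by (rule open_frame_res[OF open_frame_res[OF chartD(1) subset_refl chartD(2,3)] _ chartD(2,3)]) auto
  qed (use t R in \<open>auto simp: S_def\<close>)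
  have cont: "continuous_on S (\<lambda>s. F y y' s (line_deriv e f s \<xi>) (line_deriv e f s \<eta>))"
    if "\<And>s. s \<in> S \<Longrightarrow> frame_res P (e s) (f s) y y' \<noteq> 0" for y y' \<xi> \<eta>
  proof -
    have "continuous_on S (frame_pullback e f y y' \<xi> \<eta>)"
      using frame_pullback_holomorphic[OF S(1,2) chartD(2,3) that] by (rule holomorphic_C4_continuous_on)
    then show ?thesis
      by (rule continuous_on_eq) (use S(2) in \<open>auto simp: F_def frame_pullback_def line_deriv_simps subset_iff\<close>)
  qed
  have eq: "F w w' t (line_deriv e f t \<xi>) (line_deriv e f t \<eta>) = F x x' t (line_deriv e f t \<xi>) (line_deriv e f t \<eta>)" for \<xi> \<eta>
  proof (rule form_unique[OF plane S])
    fix s u v assume s: "s \<in> S" and u: "u \<in> tangent_fano P (line_at e f s)" and v: "v \<in> tangent_fano P (line_at e f s)"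
    have sU: "s \<in> U" "frame_res P (e s) (f s) w w' \<noteq> 0" "frame_res P (e s) (f s) x x' \<noteq> 0" using s unfolding S_def by auto
    show "omega P (e s) (f s) u v * F w w' s u v = omega P (e s) (f s) u v * F x x' s u v"
      unfolding F_def K_omega_frame_form[OF cubic chartD(5,4)[OF sU(1)] sU(2) u v, symmetric]
        K_omega_frame_form[OF cubic chartD(5,4)[OF sU(1)] sU(3) u v, symmetric] ..
  next
    show "continuous_on S (\<lambda>s. F w w' s (line_deriv e f s \<xi>) (line_deriv e f s \<eta>))"
      "continuous_on S (\<lambda>s. F x x' s (line_deriv e f s \<xi>) (line_deriv e f s \<eta>))"
      by (rule cont; simp add: S_def)+
  next
    show "bilinear_on (tangent_fano P (line_at e f s)) (F w w' s)" "bilinear_on (tangent_fano P (line_at e f s)) (F x x' s)" for s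
      unfolding F_def by (rule bilinear_on_frame_form)+
  qed
  \<comment> \<open>Arbitrary tangent vectors are velocities of the chart modulo T, and the residue
    form sees vectors only modulo T.\<close>
  obtain \<xi> \<eta> where \<xi>: "hom_eq (line_at e f t) u (line_deriv e f t \<xi>)" and \<eta>: "hom_eq (line_at e f t) v (line_deriv e f t \<eta>)"
    using line_deriv_surj[OF t u] line_deriv_surj[OF t v] by blast
  have ef: "e t \<in> line_at e f t" "f t \<in> line_at e f t" unfolding line_at_def by (simp_all add: vec.span_base)
  have "F y y' t u v = F y y' t (line_deriv e f t \<xi>) (line_deriv e f t \<eta>)" for y y'
    unfolding F_def by (rule frame_form_cong) (use \<xi> \<eta> ef in \<open>unfold hom_eq_def line_at_def, blast+\<close>)
  with eq show ?thesis unfolding F_def by metis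
qed

end

section \<open>The global residue form on the variety of lines\<close>

locale good_cubic =
  fixes P
  assumes cubic: "cubic P" and smooth: "\<not> singular_cubic P" and plane: "\<not> contains_plane P"
    and charts: "\<And>T. T \<in> fano P \<Longrightarrow> \<exists>U e f. fano_chart P U e f \<and> T \<in> line_at e f ` U"
begin

lemma chart_locale: "fano_chart P U e f \<Longrightarrow> fano_chart_locale P U e f"
  using cubic smooth by unfold_locales

lemma zero_tangent: "(\<lambda>x. 0) \<in> tangent_fano P T"
  unfolding tangent_fano_def complex_linear_vec_iff using cubic_zero[OF cubic] by simp

lemma good_frame:
  assumes "T \<in> fano P" "is_basis T a b"
  shows "\<exists>w w'. frame_res P a b w w' \<noteq> 0"
proof -
  obtain e f n1 n2 w w' where "is_basis T e f" "normal_frame P e f n1 n2 w w'"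
    using smooth_normal_frame[OF cubic smooth assms(1)] .
  then have "frame_res P a b w w' \<noteq> 0"
    using frame_form_same_basis(2)[OF cubic _ assms(2) zero_tangent zero_tangent, of e f w w'] normal_frame.frame_res_normal by fastforce
  then show ?thesis by blast
qed

text \<open>The comparison passes through the moving basis of a chart, because independence of
  \<open>(w, w')\<close> is a continuity argument in a neighbourhood of the line.\<close>

lemma fano_form_eq:
  assumes T: "T \<in> fano P" and b: "is_basis T a b" and R: "frame_res P a b w w' \<noteq> 0"
    and u: "u \<in> tangent_fano P T" and v: "v \<in> tangent_fano P T"
  shows "fano_form P T u v = frame_form P a b w w' (u a) (u b) (v a) (v b)"
proof -
  define q where "q = (SOME (a, b, w, w'). is_basis T a b \<and> frame_res P a b w w' \<noteq> 0)"
  have "case q of (a, b, w, w') \<Rightarrow> is_basis T a b \<and> frame_res P a b w w' \<noteq> 0"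
    unfolding q_def by (rule someI[of _ "(a, b, w, w')"]) (simp add: b R)
  then obtain a' b' x x' where q: "q = (a', b', x, x')" "is_basis T a' b'" "frame_res P a' b' x x' \<noteq> 0"
    by (cases q) auto
  obtain U e f t where ch: "fano_chart P U e f" and t: "t \<in> U" "T = line_at e f t" using charts[OF T] by blast
  interpret fano_chart_locale P U e f by (rule chart_locale[OF ch])
  have bt: "is_basis T (e t) (f t)" unfolding t(2) by (rule chartD(4)[OF t(1)])
  note same = frame_form_same_basis[OF cubic bt _ u v]
  have "fano_form P T u v = frame_form P a' b' x x' (u a') (u b') (v a') (v b')"
    unfolding fano_form_def q_def[symmetric] q(1) by simp
  also have "\<dots> = frame_form P (e t) (f t) x x' (u (e t)) (u (f t)) (v (e t)) (v (f t))"
    by (rule same(1)[OF q(2)])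
  also have "\<dots> = frame_form P (e t) (f t) w w' (u (e t)) (u (f t)) (v (e t)) (v (f t))"
    using same(2)[OF q(2)] q(3) same(2)[OF b] R u v unfolding t(2)
    by (intro frame_form_independent[OF plane t(1)]) auto
  also have "\<dots> = frame_form P a b w w' (u a) (u b) (v a) (v b)"
    by (rule same(1)[OF b, symmetric])
  finally show ?thesis .
qed

lemma two_form_fano_form: "two_form_on_fano P (\<lambda>T u v. c * fano_form P T u v)"
  unfolding two_form_on_fano_def
proof (intro ballI conjI allI impI)
  fix T u v assume T: "T \<in> fano P" and u: "u \<in> tangent_fano P T" and v: "v \<in> tangent_fano P T"
  obtain a b where b: "is_basis T a b" using fano_is_basis[OF T] .
  obtain w w' where R: "frame_res P a b w w' \<noteq> 0" using good_frame[OF T b] by blast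
  note eq = fano_form_eq[OF T b R]
  have Tab: "T = vec.span {a, b}" "a \<in> T" "b \<in> T" using b vec.span_base[of _ "{a, b}"] unfolding is_basis_def by auto
  show "c * fano_form P T u v = - (c * fano_form P T v u)"
    unfolding eq[OF u v] eq[OF v u] using frame_form_skew[of P a b w w' "u a"] by simp
  show "c * fano_form P T (\<lambda>x. k *s u x) v = k * (c * fano_form P T u v)" for k
    unfolding eq[OF u v] eq[OF tangent_fano_closed(2)[OF cubic u u] v] frame_form_linear by simp
  fix x assume x: "x \<in> tangent_fano P T"
  show "c * fano_form P T (\<lambda>y. u y + x y) v = c * fano_form P T u v + c * fano_form P T x v"
    unfolding eq[OF u v] eq[OF x v] eq[OF tangent_fano_closed(1)[OF cubic u x] v] frame_form_linear by (simp add: algebra_simps)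
  assume h: "hom_eq T u x"
  show "c * fano_form P T u v = c * fano_form P T x v"
    unfolding eq[OF u v] eq[OF x v] using h Tab unfolding hom_eq_def
    by (intro arg_cong[where f = "\<lambda>y. c * y"] frame_form_cong) (auto simp: vec.span_zero)
qed

text \<open>Constant coefficients \<open>k\<close>, \<open>l\<close>, \<open>m\<close>,
  \<open>n\<close> let the moving basis be adapted at one point while it stays holomorphic around
  it.\<close>

lemma pullback_fano_form:
  assumes ch: "fano_chart P U e f" and t: "t \<in> U" and R: "frame_res P (k *s e t + l *s f t) (m *s e t + n *s f t) w w' \<noteq> 0"
    and d: "k * n - l * m \<noteq> 0"
  shows "pullback (fano_form P) e f \<xi> \<eta> t =
    fano_chart_locale.frame_pullback P (\<lambda>t. k *s e t + l *s f t) (\<lambda>t. m *s e t + n *s f t) w w' \<xi> \<eta> t"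
proof -
  interpret fano_chart_locale P U e f by (rule chart_locale[OF ch])
  show ?thesis
    unfolding pullback_def fano_form_eq[OF chartD(5)[OF t] is_basis_change[OF chartD(4)[OF t] d] R line_deriv_tangent[OF t] line_deriv_tangent[OF t]]
      frame_pullback_def line_deriv(2)[OF t] frame_combination(2)[OF t] ..
qed

text \<open>A pair \<open>(w, w')\<close> that works at \<open>t\<close> works, kept constant,
  wherever its resultant is nonzero; there the pullback is a quotient of holomorphic
  functions.\<close>

lemma holomorphic_fano_form:
  assumes ch: "fano_chart P U e f"
  shows "holomorphic_C4 U (pullback (fano_form P) e f \<xi> \<eta>)"
proof (rule holomorphic_C4_local)
  interpret fano_chart_locale P U e f by (rule chart_locale[OF ch])
  fix t assume t: "t \<in> U"
  obtain w w' where R: "frame_res P (e t) (f t) w w' \<noteq> 0" using good_frame[OF chartD(5,4)[OF t]] by blast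
  define S where "S = {s \<in> U. frame_res P (e s) (f s) w w' \<noteq> 0}"
  have S: "open S" "S \<subseteq> U" "t \<in> S" unfolding S_def using open_frame_res[OF chartD(1) subset_refl chartD(2,3)] t R by auto
  have "pullback (fano_form P) e f \<xi> \<eta> s = frame_pullback e f w w' \<xi> \<eta> s" if "s \<in> S" for s
    using pullback_fano_form[OF ch, of s 1 0 0 1 w w'] that unfolding S_def by simp
  moreover have "holomorphic_C4 S (frame_pullback e f w w' \<xi> \<eta>)"
    by (rule frame_pullback_holomorphic[OF S(1,2) chartD(2,3)]) (simp add: S_def)
  ultimately show "\<exists>W h. open W \<and> t \<in> W \<and> W \<subseteq> U \<and> holomorphic_C4 W h \<and> (\<forall>s\<in>W. pullback (fano_form P) e f \<xi> \<eta> s = h s)"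
    using S by blast
qed

lemma nondegenerate_fano_form:
  assumes T: "T \<in> fano P" and u: "u \<in> tangent_fano P T" and z: "\<And>v. v \<in> tangent_fano P T \<Longrightarrow> fano_form P T u v = 0"
  shows "hom_eq T u (\<lambda>x. 0)"
proof -
  obtain e f n1 n2 w w' where fr: "is_basis T e f" "normal_frame P e f n1 n2 w w'"
    using smooth_normal_frame[OF cubic smooth T] .
  interpret N: normal_frame P e f n1 n2 w w' by fact
  have T': "T = vec.span {e, f}" using fr(1) unfolding is_basis_def by simp
  have R: "frame_res P e f w w' \<noteq> 0" unfolding N.frame_res_normal by simp
  have tu: "N.tangent_pair (u e) (u f)" using u N.tangent_fano_iff[OF tangent_fanoD(1)[OF u]] unfolding T' by blast
  have "frame_form P e f w w' (u e) (u f) p q = 0" if pq: "N.tangent_pair p q" for p q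
  proof -
    obtain v where v: "Vector_Spaces.linear (*s) (*s) v" "v e = p" "v f = q" using linear_extension_pair[OF fr(1)] by metis
    then have vT: "v \<in> tangent_fano P T" using pq unfolding T' by (simp add: N.tangent_fano_iff)
    show ?thesis using z[OF vT] unfolding fano_form_eq[OF T fr(1) R u vT] v .
  qed
  from N.frame_form_nondegenerate[OF tu this] have "u e \<in> T" "u f \<in> T" unfolding T' by auto
  then show ?thesis using hom_eq_iff[OF fr(1) tangent_fanoD(1)[OF u] tangent_fanoD(1)[OF zero_tangent]] by simp
qed

text \<open>The moving basis is adapted at \<open>t\<close> and \<open>w\<close>, \<open>w'\<close>
  are constant, so the quotient rule at \<open>t\<close> involves only the normalized values of A
  and B and their first derivatives. The terms with second derivatives of the basis are separated
  from the rest.\<close>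

lemma closed_fano_form:
  assumes ch: "fano_chart P U e f" and t: "t \<in> U"
  shows "dird (pullback (fano_form P) e f \<eta> \<zeta>) \<xi> t + dird (pullback (fano_form P) e f \<zeta> \<xi>) \<eta> t
     + dird (pullback (fano_form P) e f \<xi> \<eta>) \<zeta> t = 0"
proof -
  interpret fano_chart_locale P U e f by (rule chart_locale[OF ch])
  obtain a b n1 n2 w w' where fr: "is_basis (line_at e f t) a b" "normal_frame P a b n1 n2 w w'"
    using smooth_normal_frame[OF cubic smooth chartD(5)[OF t]] .
  interpret N: normal_frame P a b n1 n2 w w' by fact
  have T: "line_at e f t = vec.span {a, b}" using fr(1) unfolding is_basis_def by simp
  obtain k l m n where ab: "a = k *s e t + l *s f t" "b = m *s e t + n *s f t" and d: "k * n - l * m \<noteq> 0"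
    using is_basis_unique[OF chartD(4)[OF t] fr(1)] by metis
  define A B where "A = (\<lambda>t. k *s e t + l *s f t)" and "B = (\<lambda>t. m *s e t + n *s f t)"
  have AB: "A t = a" "B t = b" by (simp_all add: A_def B_def ab)
  have hol: "holomorphic_vec U A" "holomorphic_vec U B" unfolding A_def B_def by (rule frame_combination)+
  define S where "S = {s \<in> U. frame_res P (A s) (B s) w w' \<noteq> 0}"
  have S: "open S" "S \<subseteq> U" "t \<in> S"
    unfolding S_def using open_frame_res[OF chartD(1) subset_refl hol] t N.frame_res_normal by (auto simp: AB)
  note DA = holomorphic_vec_has_derivative(1)[OF hol(1) t] and DB = holomorphic_vec_has_derivative(1)[OF hol(2) t]
  note DDA = holomorphic_vec_has_derivative(1)[OF holomorphic_vec_dird[OF chartD(1) hol(1)] t]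
    and DDB = holomorphic_vec_has_derivative(1)[OF holomorphic_vec_dird[OF chartD(1) hol(2)] t]
  define g0 g1 g2 where "g0 = (\<lambda>\<eta> \<zeta> s. D6 (A s) (B s) (dird A \<eta> s) (dird A \<zeta> s) w w')"
    and "g1 = (\<lambda>\<eta> \<zeta> s. D6 (A s) (B s) (dird A \<eta> s) (dird B \<zeta> s) w w' + D6 (A s) (B s) (dird B \<eta> s) (dird A \<zeta> s) w w')"
    and "g2 = (\<lambda>\<eta> \<zeta> s. D6 (A s) (B s) (dird B \<eta> s) (dird B \<zeta> s) w w')"
  define g1' where "g1' = (\<lambda>\<eta> \<zeta> \<xi>. D6 (dird A \<xi> t) b (dird A \<eta> t) (dird B \<zeta> t) w w' + D6 a (dird B \<xi> t) (dird A \<eta> t) (dird B \<zeta> t) w w'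
      + D6 a b (dird (dird A \<eta>) \<xi> t) (dird B \<zeta> t) w w' + D6 a b (dird A \<eta> t) (dird (dird B \<zeta>) \<xi> t) w w'
      + (D6 (dird A \<xi> t) b (dird B \<eta> t) (dird A \<zeta> t) w w' + D6 a (dird B \<xi> t) (dird B \<eta> t) (dird A \<zeta> t) w w'
      + D6 a b (dird (dird B \<eta>) \<xi> t) (dird A \<zeta> t) w w' + D6 a b (dird B \<eta> t) (dird (dird A \<zeta>) \<xi> t) w w'))"
  have Dg1: "(g1 \<eta> \<zeta> has_derivative g1' \<eta> \<zeta>) (at t)" for \<eta> \<zeta>
    unfolding g1_def
    by (rule has_derivative_eq_rhs[OF has_derivative_add[OF has_derivative_D6[OF DA DB DDA DDB has_derivative_const has_derivative_const]
        has_derivative_D6[OF DA DB DDB DDA has_derivative_const has_derivative_const]]])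
       (simp add: g1'_def AB fun_eq_iff)
  have Dg0: "(g0 \<eta> \<zeta> has_derivative frechet_derivative (g0 \<eta> \<zeta>) (at t)) (at t)"
    and Dg2: "(g2 \<eta> \<zeta> has_derivative frechet_derivative (g2 \<eta> \<zeta>) (at t)) (at t)" for \<eta> \<zeta>
    unfolding g0_def g2_def
    by (rule frechet_derivative_worksI, rule has_derivative_D6[OF DA DB DDA DDA has_derivative_const has_derivative_const],
        rule frechet_derivative_worksI, rule has_derivative_D6[OF DA DB DDB DDB has_derivative_const has_derivative_const])
  define q0' q1' q2' where "q0' = (\<lambda>z \<xi>. 2 * P (dird A \<xi> t) a z)" and "q1' = (\<lambda>z \<xi>. 2 * (P (dird A \<xi> t) b z + P a (dird B \<xi> t) z))"
    and "q2' = (\<lambda>z \<xi>. 2 * P (dird B \<xi> t) b z)"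
  have Dq: "((\<lambda>s. P (A s) (A s) z) has_derivative q0' z) (at t)" "((\<lambda>s. 2 * P (A s) (B s) z) has_derivative q1' z) (at t)"
    "((\<lambda>s. P (B s) (B s) z) has_derivative q2' z) (at t)" for z
    by (rule has_derivative_eq_rhs[OF has_derivative_cubic[OF cubic DA DA has_derivative_const]]
        has_derivative_eq_rhs[OF has_derivative_mult_right[OF has_derivative_cubic[OF cubic DA DB has_derivative_const]]]
        has_derivative_eq_rhs[OF has_derivative_cubic[OF cubic DB DB has_derivative_const]];
        simp add: q0'_def q1'_def q2'_def AB fun_eq_iff cubic_zero[OF cubic] cubicD(1)[OF cubic, of a] cubicD(1)[OF cubic, of b]; fail)+
  define \<Lambda> where "\<Lambda> = (\<lambda>\<eta> \<zeta> \<xi>. g1' \<eta> \<zeta> \<xi> - q0' w \<xi> * g1 \<eta> \<zeta> t - q1' w \<xi> * g0 \<eta> \<zeta> t - q2' w' \<xi> * g1 \<eta> \<zeta> t - q1' w' \<xi> * g2 \<eta> \<zeta> t)"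
  have D\<Lambda>: "dird (pullback (fano_form P) e f \<eta> \<zeta>) \<xi> t = \<Lambda> \<eta> \<zeta> \<xi>" for \<eta> \<zeta> \<xi>
  proof -
    define num res where "num = (\<lambda>s. det3 (P (A s) (A s) w) (2 * P (A s) (B s) w) (P (B s) (B s) w) (g0 \<eta> \<zeta> s) (g1 \<eta> \<zeta> s) (g2 \<eta> \<zeta> s)
       (P (A s) (A s) w') (2 * P (A s) (B s) w') (P (B s) (B s) w'))"
      and "res = (\<lambda>s. resultant2 (P (A s) (A s) w) (2 * P (A s) (B s) w) (P (B s) (B s) w) (P (A s) (A s) w') (2 * P (A s) (B s) w') (P (B s) (B s) w'))"
    have val: "P (A t) (A t) w = 1" "2 * P (A t) (B t) w = 0" "P (B t) (B t) w = 0"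
      "P (A t) (A t) w' = 0" "2 * P (A t) (B t) w' = 0" "P (B t) (B t) w' = 1"
      using N.w N.w' by (simp_all add: AB)
    note Dn = has_derivative_det3_normal[OF Dq[of w] Dg0[of \<eta> \<zeta>] Dg1[of \<eta> \<zeta>] Dg2[of \<eta> \<zeta>] Dq[of w'] val]
    have nt: "num t = g1 \<eta> \<zeta> t" "res t = 1" unfolding num_def res_def val det3_def resultant2_def by simp_all
    have "((\<lambda>s. num s / res s) has_derivative \<Lambda> \<eta> \<zeta>) (at t)"
      by (rule has_derivative_eq_rhs[OF has_derivative_divide'[OF Dn(1)[folded num_def] Dn(2)[folded res_def]]])
         (simp_all add: nt \<Lambda>_def fun_eq_iff algebra_simps)
    then have "(pullback (fano_form P) e f \<eta> \<zeta> has_derivative \<Lambda> \<eta> \<zeta>) (at t)"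
      using S(1,3)
    proof (rule has_derivative_transform_within_open)
      fix s assume s: "s \<in> S"
      have "pullback (fano_form P) e f \<eta> \<zeta> s = frame_pullback A B w w' \<eta> \<zeta> s"
        using s pullback_fano_form[OF ch, of s k l m n w w'] d unfolding S_def A_def B_def by auto
      then show "num s / res s = pullback (fano_form P) e f \<eta> \<zeta> s"
        unfolding frame_pullback_def frame_form_def frame_num_def frame_res_def num_def res_def g0_def g1_def g2_def by simp
    qed
    then show ?thesis by (rule dird_eq)
  qed
  have tp: "N.tangent_pair (dird A \<xi> t) (dird B \<xi> t)" for \<xi>
  proof -
    have "line_deriv e f t \<xi> a = dird A \<xi> t" "line_deriv e f t \<xi> b = dird B \<xi> t"
      unfolding A_def B_def frame_combination(2)[OF t] by (simp_all add: ab line_deriv(2)[OF t])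
    then show ?thesis
      using line_deriv_tangent[OF t, of \<xi>] N.tangent_fano_iff[OF line_deriv(1)[OF t, of \<xi>]] unfolding T by simp
  qed
  have second: "dird (dird A \<xi>) \<eta> t = dird (dird A \<eta>) \<xi> t" "dird (dird B \<xi>) \<eta> t = dird (dird B \<eta>) \<xi> t" for \<xi> \<eta>
    using dird_vec_commute[OF chartD(1) _ t] hol by blast+
  \<comment> \<open>The terms with second derivatives; equality of mixed derivatives makes this
    symmetric in its first two arguments, so they cancel in the cyclic sum.\<close>
  define sec where "sec = (\<lambda>\<xi> \<eta> \<zeta>. D6 a b (dird (dird A \<xi>) \<eta> t) (dird B \<zeta> t) w w' + D6 a b (dird (dird B \<xi>) \<eta> t) (dird A \<zeta> t) w w')"
  \<comment> \<open>The first-order part, in exactly the form treated by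
    \<open>closedness_identity\<close>.\<close>
  define red where "red = (\<lambda>u1 u2 v1 v2 z1 z2.
     D6 u1 b v1 z2 w w' + D6 a u2 v1 z2 w w' + D6 u1 b v2 z1 w w' + D6 a u2 v2 z1 w w'
     - 2 * P u1 a w * (D6 a b v1 z2 w w' + D6 a b v2 z1 w w')
     - 2 * (P u1 b w + P a u2 w) * D6 a b v1 z1 w w'
     - 2 * P u2 b w' * (D6 a b v1 z2 w w' + D6 a b v2 z1 w w')
     - 2 * (P u1 b w' + P a u2 w') * D6 a b v2 z2 w w')"
  have \<Lambda>: "\<Lambda> \<eta> \<zeta> \<xi> = red (dird A \<xi> t) (dird B \<xi> t) (dird A \<eta> t) (dird B \<eta> t) (dird A \<zeta> t) (dird B \<zeta> t) + sec \<eta> \<xi> \<zeta> - sec \<zeta> \<xi> \<eta>" for \<xi> \<eta> \<zeta>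
  proof -
    have sw: "D6 a b (dird A \<eta> t) (dird (dird B \<zeta>) \<xi> t) w w' = - D6 a b (dird (dird B \<zeta>) \<xi> t) (dird A \<eta> t) w w'"
      "D6 a b (dird B \<eta> t) (dird (dird A \<zeta>) \<xi> t) w w' = - D6 a b (dird (dird A \<zeta>) \<xi> t) (dird B \<eta> t) w w'"
      by (rule D6_swap(3))+
    show ?thesis unfolding \<Lambda>_def g1'_def sw red_def sec_def q0'_def q1'_def q2'_def g0_def g1_def g2_def AB
      by (simp add: algebra_simps)
  qed
  have sec: "sec \<xi> \<eta> \<zeta> = sec \<eta> \<xi> \<zeta>" for \<xi> \<eta> \<zeta> unfolding sec_def second[of \<xi> \<eta>] ..
  have "red (dird A \<xi> t) (dird B \<xi> t) (dird A \<eta> t) (dird B \<eta> t) (dird A \<zeta> t) (dird B \<zeta> t)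
    + red (dird A \<eta> t) (dird B \<eta> t) (dird A \<zeta> t) (dird B \<zeta> t) (dird A \<xi> t) (dird B \<xi> t)
    + red (dird A \<zeta> t) (dird B \<zeta> t) (dird A \<xi> t) (dird B \<xi> t) (dird A \<eta> t) (dird B \<eta> t) = 0"
    unfolding red_def by (rule N.closedness_identity[OF tp tp tp])
  then show ?thesis
    unfolding D\<Lambda> \<Lambda> using sec[of \<eta> \<xi> \<zeta>] sec[of \<zeta> \<xi> \<eta>] sec[of \<zeta> \<eta> \<xi>] by (simp add: add.assoc)
qed

lemma pullback_scaled: "pullback (\<lambda>T u v. c * \<Omega> T u v) e f \<xi> \<eta> = (\<lambda>t. c * pullback \<Omega> e f \<xi> \<eta> t)"
  by (simp add: pullback_def fun_eq_iff)

text \<open>The residue form satisfies the identity with the constant 3 in front of K, hence the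
  normalization \<open>c / 3\<close>.\<close>

lemma determined_fano_form: "determined_form c P (\<lambda>T u v. c / 3 * fano_form P T u v)"
  unfolding determined_form_def continuous_form_def
proof (intro conjI allI impI ballI)
  show "two_form_on_fano P (\<lambda>T u v. c / 3 * fano_form P T u v)" by (rule two_form_fano_form)
  show "continuous_on U (pullback (\<lambda>T u v. c / 3 * fano_form P T u v) e f \<xi> \<eta>)" if "fano_chart P U e f" for U e f \<xi> \<eta>
    unfolding pullback_scaled using holomorphic_C4_continuous_on[OF holomorphic_fano_form[OF that]] by (intro continuous_intros)
  fix T e f u v assume T: "T \<in> fano P" "is_basis T e f" and u: "u \<in> tangent_fano P T" and v: "v \<in> tangent_fano P T"
  obtain w w' where R: "frame_res P e f w w' \<noteq> 0" using good_frame[OF T] by blast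
  show "c * K_form e f u v = omega P e f u v * (c / 3 * fano_form P T u v)"
    using K_omega_frame_form[OF cubic T R u v] unfolding fano_form_eq[OF T R u v] by (simp add: mult.commute)
qed

lemma two_form_cong:
  assumes "two_form_on_fano P \<Omega>" "T \<in> fano P" "u \<in> tangent_fano P T" "v \<in> tangent_fano P T"
    "u' \<in> tangent_fano P T" "v' \<in> tangent_fano P T" "hom_eq T u u'" "hom_eq T v v'"
  shows "\<Omega> T u v = \<Omega> T u' v'"
proof -
  have "\<Omega> T u v = \<Omega> T u' v" "\<Omega> T v u' = \<Omega> T v' u'" "\<Omega> T u' v = - \<Omega> T v u'" "\<Omega> T u' v' = - \<Omega> T v' u'"
    using assms unfolding two_form_on_fano_def by blast+
  then show ?thesis by simp
qed

text \<open>Any determined form and the multiple \<open>c / 3\<close> of the residue form have the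
  same product with \<open>omega\<close>, and both are continuous in charts. Compatibility with
  \<open>hom_eq\<close> carries the equality from velocities of the chart to all tangent
  vectors.\<close>

lemma determined_form_unique:
  assumes det: "determined_form c P \<Omega>" and T: "T \<in> fano P" and u: "u \<in> tangent_fano P T" and v: "v \<in> tangent_fano P T"
  shows "\<Omega> T u v = c / 3 * fano_form P T u v"
proof -
  define \<Omega>' where "\<Omega>' = (\<lambda>T u v. c / 3 * fano_form P T u v)"
  have det': "determined_form c P \<Omega>'" unfolding \<Omega>'_def by (rule determined_fano_form)
  obtain U e f t where ch: "fano_chart P U e f" and t: "t \<in> U" "T = line_at e f t" using charts[OF T] by blast
  interpret fano_chart_locale P U e f by (rule chart_locale[OF ch])
  have two: "two_form_on_fano P \<Omega>" "two_form_on_fano P \<Omega>'" using det det' unfolding determined_form_def by auto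
  have eq: "\<Omega> (line_at e f t) (line_deriv e f t \<xi>) (line_deriv e f t \<eta>) = \<Omega>' (line_at e f t) (line_deriv e f t \<xi>) (line_deriv e f t \<eta>)" for \<xi> \<eta>
  proof (rule form_unique[OF plane chartD(1) subset_refl t(1), where F = "\<lambda>s. \<Omega> (line_at e f s)" and G = "\<lambda>s. \<Omega>' (line_at e f s)"])
    show "bilinear_on (tangent_fano P (line_at e f s)) (\<Omega> (line_at e f s))"
      "bilinear_on (tangent_fano P (line_at e f s)) (\<Omega>' (line_at e f s))" if "s \<in> U" for s
      using bilinear_on_two_form[OF cubic _ chartD(5)[OF that]] two by blast+
    show "omega P (e s) (f s) u v * \<Omega> (line_at e f s) u v = omega P (e s) (f s) u v * \<Omega>' (line_at e f s) u v"
      if "s \<in> U" "u \<in> tangent_fano P (line_at e f s)" "v \<in> tangent_fano P (line_at e f s)" for s u v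
    proof -
      have "c * K_form (e s) (f s) u v = omega P (e s) (f s) u v * \<Omega> (line_at e f s) u v"
        "c * K_form (e s) (f s) u v = omega P (e s) (f s) u v * \<Omega>' (line_at e f s) u v"
        using det det' chartD(4,5)[OF that(1)] that(2,3) unfolding determined_form_def by blast+
      then show ?thesis by metis
    qed
    have "continuous_on U (pullback \<Omega> e f \<xi> \<eta>)" "continuous_on U (pullback \<Omega>' e f \<xi> \<eta>)"
      using det det' ch unfolding determined_form_def continuous_form_def by blast+
    then show "continuous_on U (\<lambda>s. \<Omega> (line_at e f s) (line_deriv e f s \<xi>) (line_deriv e f s \<eta>))"
      "continuous_on U (\<lambda>s. \<Omega>' (line_at e f s) (line_deriv e f s \<xi>) (line_deriv e f s \<eta>))"
      unfolding pullback_def .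
  qed
  obtain \<xi> \<eta> where \<xi>: "hom_eq T u (line_deriv e f t \<xi>)" and \<eta>: "hom_eq T v (line_deriv e f t \<eta>)"
    using line_deriv_surj[OF t(1), folded t(2), OF u] line_deriv_surj[OF t(1), folded t(2), OF v] by blast
  have ld: "line_deriv e f t \<zeta> \<in> tangent_fano P T" for \<zeta> unfolding t(2) by (rule line_deriv_tangent[OF t(1)])
  have "\<Omega> T u v = \<Omega>' T u v"
    unfolding two_form_cong[OF two(1) T u v ld ld \<xi> \<eta>] two_form_cong[OF two(2) T u v ld ld \<xi> \<eta>]
    using eq unfolding t(2) .
  then show ?thesis unfolding \<Omega>'_def .
qed

lemma determined_form_symplectic:
  assumes "c \<noteq> 0" and det: "determined_form c P \<Omega>"
  shows "symplectic_form P \<Omega>"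
  unfolding symplectic_form_def
proof (intro conjI)
  show "two_form_on_fano P \<Omega>" using det unfolding determined_form_def by blast
  have pb: "pullback \<Omega> e f \<xi> \<eta> t = c / 3 * pullback (fano_form P) e f \<xi> \<eta> t"
    if ch: "fano_chart P U e f" and t: "t \<in> U" for U e f \<xi> \<eta> t
  proof -
    interpret fano_chart_locale P U e f by (rule chart_locale[OF ch])
    show ?thesis unfolding pullback_def
      by (rule determined_form_unique[OF det chartD(5)[OF t] line_deriv_tangent[OF t] line_deriv_tangent[OF t]])
  qed
  have hol: "holomorphic_C4 U (\<lambda>t. c / 3 * pullback (fano_form P) e f \<xi> \<eta> t)" if "fano_chart P U e f" for U e f \<xi> \<eta>
    by (intro holomorphic_C4_mult holomorphic_C4_const holomorphic_fano_form that)
  show "holomorphic_form P \<Omega>"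
    unfolding holomorphic_form_def
  proof (intro allI impI)
    fix U e f \<xi> \<eta> assume ch: "fano_chart P U e f"
    then have "open U" unfolding fano_chart_def by blast
    then show "holomorphic_C4 U (pullback \<Omega> e f \<xi> \<eta>)"
      using hol[OF ch] pb[OF ch] by (intro holomorphic_C4_local) blast
  qed
  show "closed_form P \<Omega>"
    unfolding closed_form_def
  proof (intro allI impI ballI)
    fix U e f t \<xi> \<eta> \<zeta> assume ch: "fano_chart P U e f" and t: "t \<in> U"
    have U: "open U" using ch unfolding fano_chart_def by blast
    have d: "dird (pullback \<Omega> e f \<alpha> \<beta>) \<gamma> t = c / 3 * dird (pullback (fano_form P) e f \<alpha> \<beta>) \<gamma> t" for \<alpha> \<beta> \<gamma>
    proof -
      have "((\<lambda>t. c / 3 * pullback (fano_form P) e f \<alpha> \<beta> t) has_derivative (\<lambda>\<gamma>. c / 3 * dird (pullback (fano_form P) e f \<alpha> \<beta>) \<gamma> t)) (at t)"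
        by (intro has_derivative_mult_right holomorphic_C4D(1)[OF holomorphic_fano_form[OF ch] t])
      then have "(pullback \<Omega> e f \<alpha> \<beta> has_derivative (\<lambda>\<gamma>. c / 3 * dird (pullback (fano_form P) e f \<alpha> \<beta>) \<gamma> t)) (at t)"
        using U t by (rule has_derivative_transform_within_open) (simp add: pb[OF ch])
      then show ?thesis by (rule dird_eq)
    qed
    show "dird (pullback \<Omega> e f \<eta> \<zeta>) \<xi> t + dird (pullback \<Omega> e f \<zeta> \<xi>) \<eta> t + dird (pullback \<Omega> e f \<xi> \<eta>) \<zeta> t = 0"
      unfolding d distrib_left[symmetric] closed_fano_form[OF ch t] by simp
  qed
  show "nondegenerate_form P \<Omega>"
    unfolding nondegenerate_form_def
  proof (intro ballI impI)
    fix T u assume T: "T \<in> fano P" and u: "u \<in> tangent_fano P T" and z: "\<forall>v\<in>tangent_fano P T. \<Omega> T u v = 0"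
    have "fano_form P T u v = 0" if "v \<in> tangent_fano P T" for v
      using z that assms(1) determined_form_unique[OF det T u that] by simp
    then show "hom_eq T u (\<lambda>x. 0)" by (rule nondegenerate_fano_form[OF T u])
  qed
qed

end

theorem theorem1:
  shows "for_general_cubic (\<lambda>P. smooth_fourfold P \<and>
           (\<forall>c. c \<noteq> 0 \<longrightarrow>
              (\<exists>\<Omega>. determined_form c P \<Omega>) \<and>
              (\<forall>\<Omega>. determined_form c P \<Omega> \<longrightarrow> symplectic_form P \<Omega>)))"
proof (rule for_general_cubic_mono[OF for_general_cubic_conj[OF for_general_cubic_nonsingular for_general_cubic_no_plane]])
  fix P assume P: "cubic P" "\<not> singular_cubic P \<and> \<not> contains_plane P"
  have charts: "\<exists>U e f. fano_chart P U e f \<and> T \<in> line_at e f ` U" if T: "T \<in> fano P" for T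
  proof -
    obtain e f n1 n2 w w' where "is_basis T e f" "normal_frame P e f n1 n2 w w'"
      using smooth_normal_frame[OF P(1) _ T] P(2) by metis
    then show ?thesis using normal_frame.chart_exists unfolding is_basis_def by metis
  qed
  interpret good_cubic P using P charts by unfold_locales auto
  have "smooth_fourfold P"
    unfolding smooth_fourfold_def
  proof (intro conjI ballI allI impI)
    fix U e f t assume "fano_chart P U e f" and t: "t \<in> U"
    then interpret fano_chart_locale P U e f by (intro chart_locale)
    show "line_deriv e f t \<xi> \<in> tangent_fano P (line_at e f t)" for \<xi> by (rule line_deriv_tangent[OF t])
    show "\<exists>\<xi>. hom_eq (line_at e f t) u (line_deriv e f t \<xi>)" if "u \<in> tangent_fano P (line_at e f t)" for u
      by (rule line_deriv_surj[OF t that])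
  qed (rule charts)
  moreover have "\<exists>\<Omega>. determined_form c P \<Omega>" for c using determined_fano_form by blast
  ultimately show "smooth_fourfold P \<and> (\<forall>c. c \<noteq> 0 \<longrightarrow> (\<exists>\<Omega>. determined_form c P \<Omega>) \<and>
      (\<forall>\<Omega>. determined_form c P \<Omega> \<longrightarrow> symplectic_form P \<Omega>))"
    using determined_form_symplectic by blast
qed

end
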